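(* Let $n\ge 2$ be an integer and $0<s<1$. Define $$\Gamma_{n,s}=\mathcal F^{-1}\left(\frac{1}{|\xi|^2+|\xi|^{2s}}\right)\in\mathcal S'(\mathbb R^n).$$ Then $\mathscr{L}_s\Gamma_{n,s}=\delta_0$ in $\mathcal S'(\mathbb R^n)$, where $\mathscr{L}_s=-\Delta+(-\Delta)^s$, and $\Gamma_{n,s}$ is represented by a smooth real-valued radial function in $\mathbb R^n\setminus\{0\}$. Moreover, the following assertions hold (vector-valued little-$o$ terms are understood with respect to the Euclidean norm). (1) Asymptotics at the origin. (1a) If $n\ge 3$ and $4-2s<n$, then as $|x|\to 0$, $$\Gamma_{n,s}(x)=\frac{|x|^{2-n}}{(n-2)\omega_{n-1}}-\kappa_{n,4-2s}|x|^{4-2s-n}+o\left(|x|^{4-2s-n}\right),$$ $$\nabla\Gamma_{n,s}(x)=-\frac{x}{\omega_{n-1}|x|^n}-(4-2s-n)\kappa_{n,4-2s}\,x|x|^{2-2s-n}+o\left(|x|^{3-2s-n}\right).$$ (1b) If $n=3$ and $s=\frac12$, then as $|x|\to0$, $$\Gamma_{3,1/2}(x)=\frac{1}{4\pi|x|}-\frac{1}{2\pi^2}\log\frac1{|x|}+O(1),\qquad \nabla\Gamma_{3,1/2}(x)=-\frac{x}{4\pi|x|^3}+\frac{1}{2\pi^2}\frac{x}{|x|^2}+O(1).$$ (1c) If $n=3$ and $0<s<\frac12$, then there exists $C_{3,s}\in\mathbb R$ such that, as $|x|\to0$, $$\Gamma_{3,s}(x)=\frac{1}{4\pi|x|}+C_{3,s}-\kappa_{3,4-2s}|x|^{1-2s}+o\left(|x|^{1-2s}\right),$$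 $$\nabla\Gamma_{3,s}(x)=-\frac{x}{4\pi|x|^3}-(1-2s)\kappa_{3,4-2s}\,x|x|^{-1-2s}+o\left(|x|^{-2s}\right).$$ (1d) If $n=2$, then there exists $C_{2,s}\in\mathbb R$ such that, as $|x|\to0$, $$\Gamma_{2,s}(x)=\frac{1}{2\pi}\log\frac1{|x|}+C_{2,s}-\kappa_{2,4-2s}|x|^{2-2s}+o\left(|x|^{2-2s}\right),$$ $$\nabla\Gamma_{2,s}(x)=-\frac{x}{2\pi|x|^2}-(2-2s)\kappa_{2,4-2s}\,x|x|^{-2s}+o\left(|x|^{1-2s}\right).$$ (2) Asymptotics at infinity. (2a) If $s\ne\frac12$, then as $|x|\to\infty$, $$\Gamma_{n,s}(x)=\kappa_{n,2s}|x|^{2s-n}-\kappa_{n,4s-2}|x|^{4s-2-n}+o\left(|x|^{4s-2-n}\right),$$ $$\nabla\Gamma_{n,s}(x)=-(n-2s)\kappa_{n,2s}\frac{x}{|x|^{n+2-2s}}+(n+2-4s)\kappa_{n,4s-2}\frac{x}{|x|^{n+4-4s}}+o\left(|x|^{4s-3-n}\right).$$ (2b) If $s=\frac12$, then as $|x|\to\infty$, $$\Gamma_{n,1/2}(x)=\kappa_{n,1}|x|^{1-n}+\kappa_{n,-1}|x|^{-n-1}+o\left(|x|^{-n-1}\right),$$ $$\nabla\Gamma_{n,1/2}(x)=-(n-1)\kappa_{n,1}\frac{x}{|x|^{n+1}}-(n+1)\kappa_{n,-1}\frac{x}{|x|^{n+3}}+o\left(|x|^{-n-2}\right).$$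
   Context: The Fourier transform is normalized by $\widehat f(\xi)=\int_{\mathbb R^n}e^{-ix\cdot\xi}f(x)\,dx$, $f(x)=(2\pi)^{-n}\int_{\mathbb R^n}e^{ix\cdot\xi}\widehat f(\xi)\,d\xi$, and $\mathcal F^{-1}$ denotes the inverse Fourier transform on $\mathcal S'(\mathbb R^n)$. The function $(|\xi|^2+|\xi|^{2s})^{-1}$ is locally integrable (as $n>2s$) and bounded at infinity, so it defines a tempered distribution. The fractional Laplacian is $(-\Delta)^su(x)=C_{n,s}\,\mathrm{PV}\int_{\mathbb R^n}\frac{u(x)-u(y)}{|x-y|^{n+2s}}\,dy$ with $C_{n,s}=\frac{2^{2s}\Gamma(s+n/2)}{\pi^{n/2}|\Gamma(-s)|}$; its Fourier symbol is $|\xi|^{2s}$, and $\mathscr{L}_s=-\Delta+(-\Delta)^s$ has symbol $|\xi|^2+|\xi|^{2s}$. The identity $\mathscr{L}_s\Gamma_{n,s}=\delta_0$ in $\mathcal S'(\mathbb R^n)$ is understood through the Fourier multiplier: $\widehat{\Gamma_{n,s}}$ is a locally integrable function, and $\mathscr{L}_s\Gamma_{n,s}$ is the tempered distribution whose Fourier transform is $(|\xi|^2+|\xi|^{2s})\widehat{\Gamma_{n,s}}(\xi)$. Constants: $\omega_{n-1}=|\mathbb S^{n-1}|=\frac{2\pi^{n/2}}{\Gamma(n/2)}$ and, for real $\alpha\notin\{n,n+2,n+4,\ldots\}$, $$\kappa_{n,\alpha}=\frac{\Gamma\left(\frac{n-\alpha}{2}\right)}{2^\alpha\pi^{n/2}\Gamma\left(\frac\alpha2\right)},$$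 where $\Gamma$ with a single argument is the (meromorphically continued) Euler Gamma function. *)

theory Defs
  imports "HOL-Analysis.Analysis" "HOL-Library.Landau_Symbols"
begin

section \<open>Smooth functions on Euclidean space\<close>

definition partial :: "'n::finite \<Rightarrow> (real^'n \<Rightarrow> 'b::real_normed_vector) \<Rightarrow> real^'n \<Rightarrow> 'b" where
  "partial i f x = vector_derivative (\<lambda>t. f (x + t *\<^sub>R axis i 1)) (at 0)"

primrec iter_partial ::
  "'n::finite list \<Rightarrow> (real^'n \<Rightarrow> 'b::real_normed_vector) \<Rightarrow> real^'n \<Rightarrow> 'b" where
  "iter_partial [] f = f"
| "iter_partial (i # is) f = partial i (iter_partial is f)"

text \<open>On an open set, \<open>C\<^sup>\<infinity>\<close> means that every iterated partial derivative is
  (Frechet) differentiable, which includes its continuity.\<close>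

definition smooth_on :: "(real^'n::finite) set \<Rightarrow> (real^'n \<Rightarrow> 'b::real_normed_vector) \<Rightarrow> bool" where
  "smooth_on S f \<longleftrightarrow> open S \<and> (\<forall>is. \<forall>x\<in>S. iter_partial is f differentiable (at x))"

definition grad :: "(real^'n::finite \<Rightarrow> real) \<Rightarrow> real^'n \<Rightarrow> real^'n" where
  "grad f x = (\<chi> i. partial i f x)"


section \<open>Schwartz functions and tempered distributions\<close>

definition schwartz :: "(real^'n::finite \<Rightarrow> complex) \<Rightarrow> bool" where
  "schwartz \<phi> \<longleftrightarrow> smooth_on UNIV \<phi> \<and>
     (\<forall>k is. bounded (range (\<lambda>x. norm x ^ k *\<^sub>R iter_partial is \<phi> x)))"

definition schwartz_norm :: "nat \<Rightarrow> (real^'n::finite \<Rightarrow> complex) \<Rightarrow> real" where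
  "schwartz_norm N \<phi> =
     (\<Sum>k\<le>N. \<Sum>is\<in>{is. length is \<le> N}. SUP x. norm x ^ k * norm (iter_partial is \<phi> x))"

text \<open>A distribution is a functional on all functions of which only the values at Schwartz
  functions matter; accordingly equality in \<open>\<S>'\<close> is \<open>eq_distr\<close>, not \<open>(=)\<close>.
  Continuity on the Frechet space \<open>\<S>\<close> is a bound by one of the seminorms \<open>schwartz_norm N\<close>,
  which increase with \<open>N\<close> and generate the topology.\<close>

type_synonym 'n distr = "(real^'n \<Rightarrow> complex) \<Rightarrow> complex"

definition tempered :: "'n::finite distr \<Rightarrow> bool" where
  "tempered T \<longleftrightarrow>
     (\<forall>\<phi> \<psi>. schwartz \<phi> \<and> schwartz \<psi> \<longrightarrow> T (\<lambda>x. \<phi> x + \<psi> x) = T \<phi> + T \<psi>) \<and>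
     (\<forall>c \<phi>. schwartz \<phi> \<longrightarrow> T (\<lambda>x. c * \<phi> x) = c * T \<phi>) \<and>
     (\<exists>C N. \<forall>\<phi>. schwartz \<phi> \<longrightarrow> norm (T \<phi>) \<le> C * schwartz_norm N \<phi>)"

definition eq_distr :: "'n::finite distr \<Rightarrow> 'n distr \<Rightarrow> bool" where
  "eq_distr T U \<longleftrightarrow> (\<forall>\<phi>. schwartz \<phi> \<longrightarrow> T \<phi> = U \<phi>)"

definition delta0 :: "'n::finite distr" where
  "delta0 \<phi> = \<phi> 0"

definition distr_of :: "(real^'n::finite \<Rightarrow> complex) \<Rightarrow> 'n distr" where
  "distr_of g \<phi> = (LINT x|lborel. g x * \<phi> x)"

definition locally_integrable_on ::
  "(real^'n::finite) set \<Rightarrow> (real^'n \<Rightarrow> complex) \<Rightarrow> bool" where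
  "locally_integrable_on U g \<longleftrightarrow>
     (\<forall>K. compact K \<and> K \<subseteq> U \<longrightarrow> set_integrable lborel K g)"

definition tempered_function :: "(real^'n::finite \<Rightarrow> complex) \<Rightarrow> bool" where
  "tempered_function g \<longleftrightarrow> locally_integrable_on UNIV g \<and>
     (\<forall>\<phi>. schwartz \<phi> \<longrightarrow> integrable lborel (\<lambda>x. g x * \<phi> x)) \<and> tempered (distr_of g)"

definition test_function_on :: "(real^'n::finite) set \<Rightarrow> (real^'n \<Rightarrow> complex) \<Rightarrow> bool" where
  "test_function_on U \<phi> \<longleftrightarrow> smooth_on UNIV \<phi> \<and>
     compact (closure {x. \<phi> x \<noteq> 0}) \<and> closure {x. \<phi> x \<noteq> 0} \<subseteq> U"

definition represented_on ::
  "(real^'n::finite) set \<Rightarrow> 'n distr \<Rightarrow> (real^'n \<Rightarrow> complex) \<Rightarrow> bool" where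
  "represented_on U T g \<longleftrightarrow> locally_integrable_on U g \<and>
     (\<forall>\<phi>. test_function_on U \<phi> \<longrightarrow> T \<phi> = distr_of g \<phi>)"


section \<open>Fourier transform and Fourier multipliers\<close>

definition fourier :: "(real^'n::finite \<Rightarrow> complex) \<Rightarrow> real^'n \<Rightarrow> complex" where
  "fourier \<phi> \<xi> = (LINT x|lborel. exp (- (\<i> * complex_of_real (x \<bullet> \<xi>))) * \<phi> x)"

definition inv_fourier :: "(real^'n::finite \<Rightarrow> complex) \<Rightarrow> real^'n \<Rightarrow> complex" where
  "inv_fourier \<phi> x =
     complex_of_real (1 / (2 * pi) ^ CARD('n)) *
     (LINT \<xi>|lborel. exp (\<i> * complex_of_real (x \<bullet> \<xi>)) * \<phi> \<xi>)"

definition fourier_distr :: "'n::finite distr \<Rightarrow> 'n distr" where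
  "fourier_distr T \<phi> = T (fourier \<phi>)"

definition inv_fourier_distr :: "'n::finite distr \<Rightarrow> 'n distr" where
  "inv_fourier_distr T \<phi> = T (inv_fourier \<phi>)"

text \<open>\<open>fourier_multiplier p T U\<close> says that the operator with symbol \<open>p\<close> maps \<open>T\<close> to \<open>U\<close> in \<open>\<S>'\<close>.
  It is a relation because the operator is applied only to those \<open>T\<close> whose Fourier transform is
  a locally integrable function \<open>g\<close> for which \<open>p g\<close> is again a tempered distribution;
  \<open>U\<close> is then unique up to \<open>eq_distr\<close>.\<close>

definition fourier_multiplier ::
  "(real^'n::finite \<Rightarrow> complex) \<Rightarrow> 'n distr \<Rightarrow> 'n distr \<Rightarrow> bool" where
  "fourier_multiplier p T U \<longleftrightarrow> tempered T \<and> tempered U \<and>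
     (\<exists>g. tempered_function g \<and> tempered_function (\<lambda>\<xi>. p \<xi> * g \<xi>) \<and>
          eq_distr (fourier_distr T) (distr_of g) \<and>
          eq_distr (fourier_distr U) (distr_of (\<lambda>\<xi>. p \<xi> * g \<xi>)))"


section \<open>The operator \<open>-\<Delta> + (-\<Delta>)\<^sup>s\<close> and its fundamental solution\<close>

definition symbol :: "real \<Rightarrow> real^'n::finite \<Rightarrow> real" where
  "symbol s \<xi> = norm \<xi> ^ 2 + norm \<xi> powr (2 * s)"

definition Ls :: "real \<Rightarrow> 'n::finite distr \<Rightarrow> 'n distr \<Rightarrow> bool" where
  "Ls s = fourier_multiplier (\<lambda>\<xi>. complex_of_real (symbol s \<xi>))"

definition Gamma_distr :: "real \<Rightarrow> 'n::finite distr" where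
  "Gamma_distr s = inv_fourier_distr (distr_of (\<lambda>\<xi>. complex_of_real (1 / symbol s \<xi>)))"

text \<open>\<open>sphere_area n\<close> is \<open>\<omega>\<close> with index \<open>n - 1\<close>, the area of the unit sphere of \<open>\<real>\<^sup>n\<close>.\<close>

definition sphere_area :: "nat \<Rightarrow> real" where
  "sphere_area n = 2 * pi powr (real n / 2) / Gamma (real n / 2)"

definition kappa :: "nat \<Rightarrow> real \<Rightarrow> real" where
  "kappa n \<alpha> = Gamma ((real n - \<alpha>) / 2) /
     (2 powr \<alpha> * pi powr (real n / 2) * Gamma (\<alpha> / 2))"

end

theory Submission
  imports Defs "HOL-Probability.Probability" "HOL-Complex_Analysis.Complex_Analysis" "HOL-Real_Asymp.Real_Asymp"
begin

text \<open>
  The symbol depends on \<open>lam = \<bar>\<xi>\<bar>\<^sup>2\<close> only, and \<open>1 / (lam + lam powr s)\<close> is a Stieltjes function: it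
  continues analytically to the plane cut along the negative axis, and Cauchy's theorem writes it
  as \<open>\<integral> \<mu> t / (lam + t) dt\<close> with an explicit positive density \<open>\<mu>\<close> (\<open>spectral_density_stieltjes\<close>).
  Hence it is also the Laplace transform of \<open>h = \<integral> exp (- \<tau> * t) * \<mu> t dt\<close>
  (\<open>mittag_leffler_laplace\<close>); with \<open>a = 1 - s\<close>, \<open>h \<tau>\<close> is the Mittag-Leffler function
  \<open>E\<^sub>a (- \<tau> powr a)\<close>. In other words, the inverse symbol is a positive superposition of the
  Gaussians \<open>exp (- \<tau> * \<bar>\<xi>\<bar>\<^sup>2)\<close>, and inverting the Fourier transform under the integral gives the
  fundamental solution as a superposition of heat kernels,
  \<open>\<Gamma> x = \<integral> (4 * pi * \<tau>) powr (- n / 2) * exp (- \<bar>x\<bar>\<^sup>2 / (4 * \<tau>)) * h \<tau> d\<tau>\<close> (\<open>Gamma_distr_kernel\<close>).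

  With \<open>v = 1 / (4 * \<tau>)\<close> this is a Laplace transform in \<open>\<rho> = \<bar>x\<bar>\<^sup>2\<close>, and so is \<open>h\<close> in \<open>\<tau>\<close>. Smoothness off
  the origin is differentiation under the integral, which in addition shows that \<open>d / d\<rho>\<close> maps the
  integral of dimension \<open>n\<close> to \<open>- pi\<close> times that of dimension \<open>n + 2\<close> (\<open>heat_deriv\<close>); the gradient
  is therefore an instance of the same integral and needs no separate analysis.

  For the asymptotics, \<open>\<mu>\<close> near \<open>0\<close> governs \<open>h\<close> near \<open>\<infinity>\<close>, and this governs \<open>\<Gamma>\<close> near \<open>\<infinity>\<close>; \<open>\<mu>\<close> near \<open>\<infinity>\<close>
  governs \<open>h\<close> near \<open>0\<close> and then \<open>\<Gamma>\<close> near the origin. The term \<open>\<tau> powr \<beta> / Gamma (1 + \<beta>)\<close> of \<open>h\<close>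
  contributes \<open>kappa n (2 * \<beta> + 2) * \<bar>x\<bar> powr (2 * \<beta> + 2 - n)\<close>. All remainders are bounded by a single
  power on the whole half-line, and the Laplace transform maps such bounds to such bounds
  (\<open>laplace_bound\<close>, \<open>heat_expansion\<close>). If the second term of \<open>h\<close> at \<open>0\<close> is not integrable against
  the heat kernel, which happens at the origin in dimension \<open>2\<close> and, for \<open>s \<le> 1 / 2\<close>, in dimension \<open>3\<close>,
  the expansion is valid for the derivative, and integrating it produces the constant
  (\<open>integrate_bound\<close>, \<open>heat_primitive\<close>) or, for \<open>s = 1 / 2\<close>, the logarithm.

  On the side of distributions, the facts needed are that the Fourier transform of a Schwartz function
  is bounded by one of its seminorms times the reciprocal of an integrable weight
  (\<open>fourier_decay\<close>), that the inverse symbol is integrable against this reciprocal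
  (\<open>integrable_inverse_symbol_weight\<close>), and the inversion formula (\<open>fourier_inversion\<close>).
\<close>

section \<open>Laplace transforms on the half-line\<close>

definition laplace :: "(real \<Rightarrow> real) \<Rightarrow> real \<Rightarrow> real" where
  "laplace q \<rho> = (LINT v:{0<..}|lborel. exp (- (\<rho> * v)) * q v)"

text \<open>Convergence for every \<open>\<rho> > 0\<close> is preserved by multiplication with \<open>v\<close>, because half of the
  exponential absorbs this factor; so the transform may be differentiated any number of times.\<close>

definition laplaceable :: "(real \<Rightarrow> real) \<Rightarrow> bool" where
  "laplaceable q \<longleftrightarrow> (\<forall>\<rho>>0. set_integrable lborel {0<..} (\<lambda>v. exp (- (\<rho> * v)) * q v))"

lemma
  fixes b \<rho> :: real
  assumes b: "b > 0" and r: "\<rho> > 0"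
  shows set_integrable_exp_powr: "set_integrable lborel {0<..} (\<lambda>v. exp (- (\<rho> * v)) * v powr (b - 1))"
    and laplace_powr: "laplace (\<lambda>v. v powr (b - 1)) \<rho> = Gamma b * \<rho> powr (- b)"
proof -
  \<comment> \<open>Scale the Gamma integral by \<open>t = \<rho> * v\<close>.\<close>
  let ?f = "\<lambda>t::real. indicator {0..} t * t powr (b - 1) / exp t"
  let ?g = "\<lambda>v::real. indicator {0<..} v * (exp (- (\<rho> * v)) * v powr (b - 1))"
  have eq: "?f (\<rho> * v) = \<rho> powr (b - 1) * ?g v" for v
    using r by (cases "v = 0"; cases "v > 0")
      (auto simp: indicator_def powr_mult exp_minus field_simps zero_le_mult_iff)
  have "ennreal (Gamma b) = (\<integral>\<^sup>+t. ennreal (?f t) \<partial>lborel)"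
    by (rule Gamma_conv_nn_integral_real[OF b])
  also have "\<dots> = \<bar>\<rho>\<bar> * (\<integral>\<^sup>+v. ennreal (?f (0 + \<rho> * v)) \<partial>lborel)"
    using r by (intro nn_integral_real_affine) auto
  also have "(\<lambda>v. ennreal (?f (0 + \<rho> * v))) = (\<lambda>v. ennreal (\<rho> powr (b - 1)) * ennreal (?g v))"
    using eq by (simp add: ennreal_mult')
  also have "(\<integral>\<^sup>+v. ennreal (\<rho> powr (b - 1)) * ennreal (?g v) \<partial>lborel)
      = ennreal (\<rho> powr (b - 1)) * (\<integral>\<^sup>+v. ennreal (?g v) \<partial>lborel)"
    by (rule nn_integral_cmult) auto
  also have "\<bar>\<rho>\<bar> * (ennreal (\<rho> powr (b - 1)) * (\<integral>\<^sup>+v. ennreal (?g v) \<partial>lborel))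
       = ennreal (\<rho> powr b) * (\<integral>\<^sup>+v. ennreal (?g v) \<partial>lborel)"
    using r by (simp add: mult.assoc[symmetric] ennreal_mult'[symmetric] powr_diff)
  finally have e: "ennreal (Gamma b) = ennreal (\<rho> powr b) * (\<integral>\<^sup>+v. ennreal (?g v) \<partial>lborel)" .
  have "(\<integral>\<^sup>+v. ennreal (?g v) \<partial>lborel) = ennreal (\<rho> powr (-b)) * (ennreal (\<rho> powr b) * (\<integral>\<^sup>+v. ennreal (?g v) \<partial>lborel))"
    using r by (simp add: mult.assoc[symmetric] ennreal_mult'[symmetric] powr_add[symmetric])
  also have "\<dots> = ennreal (Gamma b * \<rho> powr (-b))"
    unfolding e[symmetric] using b Gamma_real_pos[OF b] by (simp add: ennreal_mult mult.commute)
  finally have nn: "(\<integral>\<^sup>+v. ennreal (?g v) \<partial>lborel) = ennreal (Gamma b * \<rho> powr (-b))" .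
  have "has_bochner_integral lborel ?g (Gamma b * \<rho> powr (-b))"
    using b Gamma_real_pos[OF b] by (intro has_bochner_integral_nn_integral nn) auto
  then show "set_integrable lborel {0<..} (\<lambda>v. exp (- (\<rho> * v)) * v powr (b - 1))"
    and "laplace (\<lambda>v. v powr (b - 1)) \<rho> = Gamma b * \<rho> powr (- b)"
    by (auto simp: set_integrable_def laplace_def set_lebesgue_integral_def has_bochner_integral_iff)
qed

lemma laplaceable_bound:
  assumes [measurable]: "q \<in> borel_measurable borel"
    and bd: "\<And>v. v > 0 \<Longrightarrow> \<bar>q v\<bar> \<le> C * v powr (b - 1)" and b: "b > 0"
  shows "laplaceable q"
  unfolding laplaceable_def set_integrable_def
proof (intro allI impI)
  fix \<rho> :: real assume r: "\<rho> > 0"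
  show "integrable lborel (\<lambda>v. indicator {0<..} v *\<^sub>R (exp (- (\<rho> * v)) * q v))"
  proof (rule Bochner_Integration.integrable_bound)
    show "integrable lborel (\<lambda>v. C * (indicator {0<..} v *\<^sub>R (exp (- (\<rho> * v)) * v powr (b - 1))))"
      using set_integrable_exp_powr[OF b r] unfolding set_integrable_def by (intro integrable_mult_right)
    show "AE v in lborel. norm (indicator {0<..} v *\<^sub>R (exp (- (\<rho> * v)) * q v))
       \<le> norm (C * (indicator {0<..} v *\<^sub>R (exp (- (\<rho> * v)) * v powr (b - 1))))"
      using bd by (intro AE_I2) (force simp: indicator_def abs_mult mult_left_mono mult.left_commute
          intro: order_trans[OF bd] mult_right_mono)
  qed auto
qed

text \<open>A bound by one power, valid on the whole half-line, is transformed into a bound by one power,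
  again valid on the whole half-line. All asymptotic statements below are of this kind, so that
  neither dominated convergence nor a splitting of the integral is needed to expand a transform at
  \<open>0\<close> or at \<open>\<infinity>\<close>.\<close>

lemma laplace_bound:
  assumes q[measurable]: "q \<in> borel_measurable borel"
    and bd: "\<And>v. v > 0 \<Longrightarrow> \<bar>q v\<bar> \<le> C * v powr (b - 1)" and b: "b > 0" and r: "\<rho> > 0"
  shows "\<bar>laplace q \<rho>\<bar> \<le> C * Gamma b * \<rho> powr (- b)"
proof -
  have "norm (LINT v|lborel. indicator {0<..} v *\<^sub>R (exp (- (\<rho> * v)) * q v))
      \<le> (LINT v|lborel. norm (indicator {0<..} v *\<^sub>R (exp (- (\<rho> * v)) * q v)))"
    by (rule integral_norm_bound)
  also have "\<dots> \<le> (LINT v|lborel. C * (indicator {0<..} v *\<^sub>R (exp (- (\<rho> * v)) * v powr (b - 1))))"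
  proof (rule integral_mono)
    show "integrable lborel (\<lambda>v. norm (indicator {0<..} v *\<^sub>R (exp (- (\<rho> * v)) * q v)))"
      using laplaceable_bound[OF q bd b] r by (intro integrable_norm) (auto simp: laplaceable_def set_integrable_def)
    show "integrable lborel (\<lambda>v. C * (indicator {0<..} v *\<^sub>R (exp (- (\<rho> * v)) * v powr (b - 1))))"
      using set_integrable_exp_powr[OF b r] unfolding set_integrable_def by (intro integrable_mult_right)
    show "norm (indicator {0<..} v *\<^sub>R (exp (- (\<rho> * v)) * q v))
       \<le> C * (indicator {0<..} v *\<^sub>R (exp (- (\<rho> * v)) * v powr (b - 1)))" for v
      using bd[of v] by (auto simp: indicator_def abs_mult mult_left_mono mult.left_commute)
  qed
  also have "\<dots> = C * laplace (\<lambda>v. v powr (b - 1)) \<rho>"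
    by (simp add: laplace_def set_lebesgue_integral_def)
  finally show ?thesis
    using laplace_powr[OF b r] by (simp add: laplace_def set_lebesgue_integral_def)
qed

lemma laplaceable_integrable:
  "laplaceable q \<Longrightarrow> \<rho> > 0 \<Longrightarrow> integrable lborel (\<lambda>v. indicator {0<..} v * (exp (- (\<rho> * v)) * q v))"
  by (auto simp: laplaceable_def set_integrable_def)

lemma laplaceable_times:
  assumes q: "laplaceable q"
  shows "laplaceable (\<lambda>v. v * q v)"
  unfolding laplaceable_def set_integrable_def
proof (intro allI impI)
  fix \<rho> :: real assume r: "\<rho> > 0"
  let ?h = "\<lambda>v. indicator {0<..} v * (exp (- (\<rho>/2 * v)) * q v)"
  have i: "integrable lborel ?h"
    using r by (intro laplaceable_integrable q) auto
  have eq: "indicator {0<..} v *\<^sub>R (exp (- (\<rho> * v)) * (v * q v)) = (v * exp (- (\<rho>/2 * v))) * ?h v" for v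
    by (simp add: exp_add[symmetric] mult.assoc[symmetric])
  show "integrable lborel (\<lambda>v. indicator {0<..} v *\<^sub>R (exp (- (\<rho> * v)) * (v * q v)))"
    unfolding eq
  proof (rule Bochner_Integration.integrable_bound)
    show "integrable lborel (\<lambda>v. (2/\<rho>) * ?h v)" using i by (intro integrable_mult_right)
    show "(\<lambda>v. (v * exp (- (\<rho>/2 * v))) * ?h v) \<in> borel_measurable lborel"
      using borel_measurable_integrable[OF i] by measurable
    have le: "v * exp (- (\<rho>/2 * v)) \<le> 2/\<rho>" for v
    proof -
      have "\<rho>/2 * v \<le> exp (\<rho>/2 * v)" using exp_ge_add_one_self[of "\<rho>/2 * v"] by linarith
      then show ?thesis using r by (simp add: exp_minus field_simps)
    qed
    show "AE v in lborel. norm ((v * exp (- (\<rho>/2 * v))) * ?h v) \<le> norm ((2/\<rho>) * ?h v)"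
    proof (rule AE_I2)
      fix v :: real
      show "norm ((v * exp (- (\<rho>/2 * v))) * ?h v) \<le> norm ((2/\<rho>) * ?h v)"
      proof (cases "v > 0")
        case True
        then have "norm (v * exp (- (\<rho>/2 * v))) \<le> norm (2/\<rho>)"
          using le[of v] r by simp
        then show ?thesis using mult_right_mono[OF _ norm_ge_zero, of "norm (v * exp (- (\<rho>/2 * v)))" "norm (2/\<rho>)" "?h v"]
          by (simp only: norm_mult)
      qed simp
    qed
  qed
qed

text \<open>Differentiation under the integral sign. For \<open>\<bar>h\<bar> < \<rho> / 2\<close> the mean value theorem bounds the
  difference quotients of \<open>\<lambda>x. exp (- (x * v))\<close> by \<open>v * exp (- (\<rho> / 2 * v))\<close>, which is an
  integrable majorant.\<close>

lemma laplace_deriv: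
  assumes q: "laplaceable q" and r: "\<rho> > 0"
  shows "(laplace q has_real_derivative - laplace (\<lambda>v. v * q v) \<rho>) (at \<rho>)"
proof -
  let ?S = "{-\<rho>/2<..<\<rho>/2}"
  let ?I = "\<lambda>x v. indicator {0<..} v * (exp (- (x * v)) * q v)"
  have "((\<lambda>h. (laplace q (\<rho> + h) - laplace q \<rho>) / h) \<longlongrightarrow> - laplace (\<lambda>v. v * q v) \<rho>) (at 0 within ?S)"
    unfolding tendsto_at_iff_sequentially
  proof (intro allI impI)
    fix X :: "nat \<Rightarrow> real" assume X: "\<forall>i. X i \<in> ?S - {0}" and lim: "X \<longlonglongrightarrow> 0"
    have X': "X i \<noteq> 0" "\<bar>X i\<bar> < \<rho>/2" for i using X[rule_format, of i] by auto
    have pos: "\<rho> + X i > 0" for i using X'(2)[of i] r by linarith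
    let ?s = "\<lambda>i v. (?I (\<rho> + X i) v - ?I \<rho> v) / X i"
    let ?d = "\<lambda>v. - (indicator {0<..} v * (exp (- (\<rho> * v)) * (v * q v)))"
    let ?w = "\<lambda>v. indicator {0<..} v * (exp (- (\<rho>/2 * v)) * (v * q v))"
    have iw: "integrable lborel ?w" using r by (intro laplaceable_integrable laplaceable_times q) auto
    have id: "integrable lborel ?d" using r by (intro Bochner_Integration.integrable_minus laplaceable_integrable laplaceable_times q) auto
    have ii: "integrable lborel (?s i)" for i using pos r by (intro Bochner_Integration.integrable_divide Bochner_Integration.integrable_diff laplaceable_integrable q) auto
    have "(\<lambda>i. integral\<^sup>L lborel (?s i)) \<longlonglongrightarrow> integral\<^sup>L lborel ?d"
    proof (rule integral_dominated_convergence[where w = "\<lambda>v. norm (?w v)"])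
      show "AE v in lborel. (\<lambda>i. ?s i v) \<longlonglongrightarrow> ?d v"
      proof (rule AE_I2)
        fix v :: real
        have "((\<lambda>x. ?I x v) has_real_derivative ?d v) (at \<rho>)"
          by (auto intro!: derivative_eq_intros)
        then have "((\<lambda>h. (?I (\<rho> + h) v - ?I \<rho> v) / h) \<longlongrightarrow> ?d v) (at 0)"
          by (simp add: DERIV_def)
        then show "(\<lambda>i. ?s i v) \<longlonglongrightarrow> ?d v"
          using lim X' unfolding tendsto_at_iff_sequentially by (auto simp: o_def)
      qed
      show "AE v in lborel. norm (?s i v) \<le> norm (?w v)" for i
      proof (rule AE_I2)
        fix v :: real
        have mv: "\<bar>exp (- ((\<rho> + X i) * v)) - exp (- (\<rho> * v))\<bar> \<le> v * exp (- (\<rho>/2 * v)) * \<bar>X i\<bar>" if v: "v > 0"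
        proof -
          have "norm (exp (- ((\<rho> + X i) * v)) - exp (- (\<rho> * v))) \<le> v * exp (- (\<rho>/2 * v)) * norm ((\<rho> + X i) - \<rho>)"
          proof (rule field_differentiable_bound[where S = "{\<rho>/2..}" and f = "\<lambda>x. exp (- (x * v))" and f' = "\<lambda>x. - v * exp (- (x * v))"])
            show "norm (- v * exp (- (x * v))) \<le> v * exp (- (\<rho>/2 * v))" if "x \<in> {\<rho>/2..}" for x
              using that v by (auto simp: abs_mult intro!: mult_left_mono mult_right_mono)
          qed (use r X'(2)[of i] in \<open>auto intro!: derivative_eq_intros\<close>)
          then show ?thesis by simp
        qed
        show "norm (?s i v) \<le> norm (?w v)"
        proof (cases "v > 0")
          case True
          have "norm (?s i v) = \<bar>exp (- ((\<rho> + X i) * v)) - exp (- (\<rho> * v))\<bar> * \<bar>q v\<bar> / \<bar>X i\<bar>"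
            using True by (simp add: abs_mult[symmetric] left_diff_distrib)
          also have "\<dots> \<le> (v * exp (- (\<rho>/2 * v)) * \<bar>X i\<bar>) * \<bar>q v\<bar> / \<bar>X i\<bar>"
            using mv[OF True] by (intro divide_right_mono mult_right_mono) auto
          also have "\<dots> = norm (?w v)" using True X'(1)[of i] by (simp add: abs_mult)
          finally show ?thesis .
        qed auto
      qed
    qed (use iw id ii in \<open>auto intro: borel_measurable_integrable integrable_norm\<close>)
    moreover have "integral\<^sup>L lborel ?d = - laplace (\<lambda>v. v * q v) \<rho>"
      by (simp add: laplace_def set_lebesgue_integral_def)
    moreover have "integral\<^sup>L lborel (?s i) = (laplace q (\<rho> + X i) - laplace q \<rho>) / X i" for i
      using pos[of i] r by (simp add: laplace_def set_lebesgue_integral_def laplaceable_integrable[OF q] Bochner_Integration.integral_diff)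
    ultimately show "((\<lambda>h. (laplace q (\<rho> + h) - laplace q \<rho>) / h) \<circ> X) \<longlonglongrightarrow> - laplace (\<lambda>v. v * q v) \<rho>"
      by (simp only: o_def)
  qed
  moreover have "at 0 within ?S = at (0::real)"
    using r by (intro at_within_open) auto
  ultimately show ?thesis by (simp add: DERIV_def)
qed

lemma laplace_add:
  assumes "laplaceable p" "laplaceable q"
  shows "laplaceable (\<lambda>v. p v + q v)" "\<rho> > 0 \<Longrightarrow> laplace (\<lambda>v. p v + q v) \<rho> = laplace p \<rho> + laplace q \<rho>"
  using assms unfolding laplaceable_def laplace_def by (auto simp: distrib_left intro: set_integral_add)

lemma laplace_cmult:
  shows "laplaceable p \<Longrightarrow> laplaceable (\<lambda>v. c * p v)" "laplace (\<lambda>v. c * p v) \<rho> = c * laplace p \<rho>"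
  unfolding laplaceable_def laplace_def
  by (auto simp: mult.left_commute[of _ c])

lemma laplaceable_powr: "b > 0 \<Longrightarrow> laplaceable (\<lambda>v. v powr (b - 1))"
  by (auto simp: laplaceable_def set_integrable_exp_powr)

lemma laplace_cong:
  assumes "\<And>v. v > 0 \<Longrightarrow> p v = q v"
  shows "laplaceable p \<longleftrightarrow> laplaceable q" "laplace p \<rho> = laplace q \<rho>"
proof -
  have "(\<lambda>v. indicator {0<..} v *\<^sub>R (exp (- (\<rho> * v)) * p v)) = (\<lambda>v. indicator {0<..} v *\<^sub>R (exp (- (\<rho> * v)) * q v))" for \<rho> :: real
    using assms by (auto simp: indicator_def fun_eq_iff)
  then show "laplaceable p \<longleftrightarrow> laplaceable q" "laplace p \<rho> = laplace q \<rho>"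
    unfolding laplaceable_def laplace_def set_integrable_def set_lebesgue_integral_def by simp_all
qed

text \<open>Since \<open>g > 0\<close>, the derivative is integrable at \<open>0\<close>, so \<open>D\<close> has a limit \<open>L\<close> there. It is found
  without integrating: \<open>D + C / g * x powr g\<close> is nondecreasing and \<open>D - C / g * x powr g\<close> is
  nonincreasing, the second lies below the first, and \<open>L\<close> is the infimum of the first.\<close>

lemma integrate_bound:
  fixes D :: "real \<Rightarrow> real"
  assumes der: "\<And>x. x > 0 \<Longrightarrow> (D has_real_derivative D' x) (at x)"
    and bd: "\<And>x. x > 0 \<Longrightarrow> \<bar>D' x\<bar> \<le> C * x powr (g - 1)" and g: "g > 0"
  shows "\<exists>L. \<forall>x>0. \<bar>D x - L\<bar> \<le> C / g * x powr g"
proof -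
  define U where "U x = D x + C / g * x powr g" for x
  define V where "V x = D x - C / g * x powr g" for x
  have dp: "((\<lambda>x. C / g * x powr g) has_real_derivative C * x powr (g - 1)) (at x)" if "x > 0" for x
    using that g by (auto intro!: derivative_eq_intros simp: powr_diff)
  have C: "C \<ge> 0" using bd[of 1] by simp
  have U: "U x \<le> U y" if "0 < x" "x \<le> y" for x y
  proof (rule DERIV_nonneg_imp_nondecreasing[OF that(2)])
    fix z assume "x \<le> z" "z \<le> y"
    then have "z > 0" using that by simp
    then show "\<exists>m. (U has_real_derivative m) (at z) \<and> 0 \<le> m"
      using bd[of z] unfolding U_def by (intro exI[of _ "D' z + C * z powr (g-1)"] conjI DERIV_add der dp) auto
  qed
  have V: "V x \<ge> V y" if "0 < x" "x \<le> y" for x y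
  proof (rule DERIV_nonpos_imp_nonincreasing[OF that(2)])
    fix z assume "x \<le> z" "z \<le> y"
    then have "z > 0" using that by simp
    then show "\<exists>m. (V has_real_derivative m) (at z) \<and> m \<le> 0"
      using bd[of z] unfolding V_def by (intro exI[of _ "D' z - C * z powr (g-1)"] conjI DERIV_diff der dp) auto
  qed
  have UV: "V x \<le> U x" for x using C g by (simp add: U_def V_def)
  have VU: "V x \<le> U y" if "x > 0" "y > 0" for x y
    using V[of "min x y" x] U[of "min x y" y] UV[of "min x y"] that by auto
  have "Inf (U ` {0<..}) \<le> U x" "V x \<le> Inf (U ` {0<..})" if "x > 0" for x
    using that VU by (auto intro!: cInf_lower cInf_greatest bdd_belowI2[where m = "V x"])
  then show ?thesis
    by (intro exI[of _ "Inf (U ` {0<..})"]) (auto simp: U_def V_def abs_le_iff algebra_simps)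
qed

section \<open>The Stieltjes representation of the inverse symbol\<close>

text \<open>This is the squared modulus of \<open>1 + w * exp (\<i> * pi * a)\<close> for real \<open>w\<close>.\<close>

definition spectral_denom :: "real \<Rightarrow> real \<Rightarrow> real" where
  "spectral_denom a w = 1 + 2 * cos (pi * a) * w + w^2"

text \<open>The density of the Stieltjes measure of \<open>1 / (lam + lam powr (1 - a))\<close>: up to the factor
  \<open>- 1 / pi\<close>, the imaginary part of the continuation of this function to the upper side of the cut
  \<open>lam = - t\<close>.\<close>

definition spectral_density :: "real \<Rightarrow> real \<Rightarrow> real" where
  "spectral_density a t = sin (pi * a) / pi * t powr (a - 1) / spectral_denom a (t powr a)"

lemma spectral_denom_eq: "spectral_denom a w = (w + cos (pi * a))^2 + (sin (pi * a))^2"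
  unfolding spectral_denom_def using sin_cos_squared_add[of "pi * a"] by (simp add: power2_sum algebra_simps)

lemma sin_pi_pos: "0 < a \<Longrightarrow> a < 1 \<Longrightarrow> 0 < sin (pi * a)"
  by (intro sin_gt_zero) auto

lemma spectral_denom_pos: "0 < a \<Longrightarrow> a < 1 \<Longrightarrow> 0 < spectral_denom a w"
  unfolding spectral_denom_eq using sin_pi_pos[of a] by (simp add: add_nonneg_pos)

text \<open>In the variable \<open>y = ln t\<close> the two sides of the cut are the lines \<open>Im y = - pi\<close> and \<open>Im y = pi\<close>.
  The integrand takes conjugate values there, and its jump is \<open>2 * pi * \<i>\<close> times the spectral
  density at \<open>t = exp v\<close>, divided by \<open>t + lam\<close> and multiplied by \<open>dt / dv\<close>.\<close>

lemma edge_jump: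
  fixes a v lam :: real
  assumes a: "0 < a" "a < 1" and lam: "lam > 0"
  defines "Z \<equiv> \<lambda>y :: complex. exp (a * y) / ((1 + exp (a * y)) * (exp y - lam))"
  shows "Z (of_real v - \<i> * pi) - Z (of_real v + \<i> * pi) =
     2 * \<i> * of_real (sin (pi * a) * exp (a * v) / (spectral_denom a (exp (a * v)) * (exp v + lam)))"
proof -
  define E where "E = exp (a * v)"
  define c s where "c = cos (pi * a)" and "s = sin (pi * a)"
  have cs: "c^2 + s^2 = 1" by (simp add: c_def s_def)
  have e1: "exp (of_real a * (of_real v + \<i> * pi)) = of_real E * (of_real c + \<i> * of_real s)"
  proof -
    have "exp (of_real a * (of_real v + \<i> * pi)) = exp (of_real (a * v)) * exp (\<i> * of_real (pi * a))"
      by (simp add: exp_add[symmetric] algebra_simps)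
    then show ?thesis unfolding exp_Euler E_def c_def s_def by (simp only: exp_of_real cos_of_real sin_of_real)
  qed
  have e2: "exp (of_real a * (of_real v - \<i> * pi)) = of_real E * (of_real c - \<i> * of_real s)"
  proof -
    have "exp (of_real a * (of_real v - \<i> * pi)) = cnj (exp (of_real a * (of_real v + \<i> * pi)))"
      by (simp add: exp_cnj)
    then show ?thesis unfolding e1 by simp
  qed
  have p1: "exp (of_real v + \<i> * pi) = - of_real (exp v)"
    by (simp add: exp_add exp_of_real mult.commute[of \<i>])
  have p2: "exp (of_real v - \<i> * pi) = - of_real (exp v)"
    by (simp add: exp_diff exp_of_real mult.commute[of \<i>])
  have D: "spectral_denom a E = 1 + 2 * c * E + E^2" by (simp add: spectral_denom_def c_def)
  have Dp: "spectral_denom a E > 0" using a by (rule spectral_denom_pos)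
  have prod: "(1 + of_real E * (of_real c + \<i> * of_real s)) * (1 + of_real E * (of_real c - \<i> * of_real s))
     = complex_of_real (spectral_denom a E)"
  proof -
    have "(1 + of_real E * (of_real c + \<i> * of_real s)) * (1 + of_real E * (of_real c - \<i> * of_real s))
      = complex_of_real (1 + 2 * c * E + E^2 * (c^2 + s^2))"
      by (simp add: complex_eq_iff power2_eq_square algebra_simps)
    then show ?thesis using cs D by simp
  qed
  have nz: "1 + of_real E * (of_real c + \<i> * of_real s) \<noteq> 0" "1 + of_real E * (of_real c - \<i> * of_real s) \<noteq> 0"
    using prod Dp by auto
  have nz2: "complex_of_real (exp v + lam) \<noteq> 0" using lam exp_gt_zero[of v] by (simp only: of_real_eq_0_iff)
  have "Z (of_real v - \<i> * pi) - Z (of_real v + \<i> * pi) =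
     (of_real E * (of_real c + \<i> * of_real s) / (1 + of_real E * (of_real c + \<i> * of_real s))
      - of_real E * (of_real c - \<i> * of_real s) / (1 + of_real E * (of_real c - \<i> * of_real s))) / of_real (exp v + lam)"
  proof -
    have k: "X / (Y * (- W - L)) = - (X / Y) / (W + L)" for X Y W L :: complex
      by (metis (no_types, opaque_lifting) divide_divide_eq_left minus_add_distrib minus_divide_right mult_minus_right uminus_add_conv_diff add.commute minus_divide_left diff_conv_add_uminus)
    show ?thesis
      unfolding Z_def e1 e2 p1 p2 k by (simp add: diff_divide_distrib)
  qed
  also have "(of_real E * (of_real c + \<i> * of_real s) / (1 + of_real E * (of_real c + \<i> * of_real s))
      - of_real E * (of_real c - \<i> * of_real s) / (1 + of_real E * (of_real c - \<i> * of_real s)))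
     = 2 * \<i> * of_real (s * E) / complex_of_real (spectral_denom a E)"
  proof -
    have "(of_real E * (of_real c + \<i> * of_real s) / (1 + of_real E * (of_real c + \<i> * of_real s))
      - of_real E * (of_real c - \<i> * of_real s) / (1 + of_real E * (of_real c - \<i> * of_real s)))
      = (of_real E * (of_real c + \<i> * of_real s) * (1 + of_real E * (of_real c - \<i> * of_real s))
        - of_real E * (of_real c - \<i> * of_real s) * (1 + of_real E * (of_real c + \<i> * of_real s)))
         / ((1 + of_real E * (of_real c + \<i> * of_real s)) * (1 + of_real E * (of_real c - \<i> * of_real s)))"
      by (rule diff_frac_eq[OF nz])
    also have "(of_real E * (of_real c + \<i> * of_real s) * (1 + of_real E * (of_real c - \<i> * of_real s))
        - of_real E * (of_real c - \<i> * of_real s) * (1 + of_real E * (of_real c + \<i> * of_real s)))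
        = 2 * \<i> * of_real (s * E)"
      by (simp add: complex_eq_iff algebra_simps)
    finally show ?thesis unfolding prod .
  qed
  finally show ?thesis
    unfolding E_def[symmetric] s_def[symmetric] by simp
qed

lemma contour_integral_linepath_shift_Reals:
  fixes f :: "complex \<Rightarrow> complex"
  assumes "x < y"
  shows "contour_integral (linepath (Complex x c) (Complex y c)) f = integral {x..y} (\<lambda>v. f (of_real v + \<i> * of_real c))"
proof -
  have "linepath (Complex x c) (Complex y c) = (+) (\<i> * of_real c) \<circ> linepath (of_real x) (of_real y)"
    by (auto simp: linepath_def fun_eq_iff complex_eq_iff algebra_simps)
  then have "contour_integral (linepath (Complex x c) (Complex y c)) f
     = contour_integral (linepath (of_real x) (of_real y)) (\<lambda>z. f (z + \<i> * of_real c))"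
    by (simp add: contour_integral_translate)
  also have "\<dots> = integral {x..y} (\<lambda>v. f (of_real v + \<i> * of_real c))"
    using assms by (subst contour_integral_linepath_Reals_eq) auto
  finally show ?thesis .
qed

text \<open>The residue theorem on the rectangle with corners \<open>\<plusminus> M \<plusminus> \<i> * pi\<close>. In the strip that is
  slightly wider than the rectangle the only pole is \<open>ln lam\<close>: \<open>1 + exp (a * y)\<close> vanishes only for
  \<open>\<bar>Im y\<bar> \<ge> pi / a > pi\<close>, and \<open>exp y = lam\<close> has no further solution with \<open>\<bar>Im y\<bar> < 2 * pi\<close>. The
  horizontal edges give the integral of the jump, the vertical ones the error term.\<close>

lemma stieltjes_kernel_rectangle:
  fixes a lam M :: real
  assumes a: "0 < a" "a < 1" and lam: "lam > 0" and M: "M > \<bar>ln lam\<bar>"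
  shows "\<bar>integral {-M..M} (\<lambda>v. sin (pi * a) * exp (a * v) / (spectral_denom a (exp (a * v)) * (exp v + lam)))
      - pi * lam powr (a - 1) / (1 + lam powr a)\<bar>
    \<le> pi * (exp (a * M) / ((exp (a * M) - 1) * (exp M - lam))
         + exp (- (a * M)) / ((1 - exp (- (a * M))) * (lam - exp (- M))))"
proof -
  define l where "l = complex_of_real (ln lam)"
  define Z where "Z = (\<lambda>y :: complex. exp (a * y) / ((1 + exp (a * y)) * (exp y - lam)))"
  \<comment> \<open>The half-width of the strip around the rectangle that contains no other singularity.\<close>
  define d where "d = min (2 * pi) (pi / a)"
  define S where "S = {z. Im z < d} \<inter> {z. Im z > - d}"
  have d: "d > pi" using a pi_gt_zero by (simp add: d_def field_simps)
  have dp: "d > 0" using d pi_gt_zero by linarith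
  have dn: "- pi < d" "- d < pi" using d dp pi_gt_zero by linarith+
  have Mp: "M > 0" using M by linarith
  have el: "exp l = lam" using lam by (simp add: l_def exp_of_real)
  have S: "open S" "convex S"
    unfolding S_def by (auto intro!: open_Int convex_Int open_halfspace_Im_lt open_halfspace_Im_gt convex_halfspace_Im_lt convex_halfspace_Im_gt)
  have nz1: "1 + exp (a * y) \<noteq> 0" if "y \<in> S" for y :: complex
  proof
    assume "1 + exp (a * y) = 0"
    then have "exp (a * y) = exp (\<i> * pi)" by (simp add: eq_neg_iff_add_eq_0 add.commute)
    then obtain n :: int where "of_real a * y = \<i> * pi + (of_int (2 * n) * pi) * \<i>"
      unfolding exp_eq by blast
    then have "Im (of_real a * y) = (2 * n + 1) * pi" by (simp add: algebra_simps)
    then have i: "Im y = (2 * n + 1) * (pi / a)" using a by (simp add: field_simps)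
    have "1 \<le> \<bar>2 * n + 1\<bar>" by presburger
    then have "1 \<le> \<bar>real_of_int (2 * n + 1)\<bar>" by linarith
    then have "pi / a \<le> \<bar>real_of_int (2 * n + 1)\<bar> * (pi / a)"
      using a pi_gt_zero mult_right_mono[of 1 "\<bar>real_of_int (2 * n + 1)\<bar>" "pi / a"] by simp
    also have "\<dots> = \<bar>Im y\<bar>" unfolding i using a pi_gt_zero by (simp add: abs_mult)
    also have "\<dots> < d" using that by (auto simp: S_def)
    finally show False by (simp add: d_def)
  qed
  have nz2: "exp y - lam \<noteq> 0" if "y \<in> S" "y \<noteq> l" for y :: complex
  proof
    assume "exp y - lam = 0"
    then have "exp y = exp l" by (simp add: el)
    then obtain n :: int where e: "y = l + (of_int (2 * n) * pi) * \<i>"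
      unfolding exp_eq by blast
    then have i: "Im y = of_int n * (2 * pi)" by (simp add: l_def)
    have "n \<noteq> 0" using e that by auto
    then have "1 \<le> \<bar>real_of_int n\<bar>" by linarith
    then have "2 * pi \<le> \<bar>real_of_int n\<bar> * (2 * pi)"
      using pi_gt_zero mult_right_mono[of 1 "\<bar>real_of_int n\<bar>" "2 * pi"] by simp
    also have "\<dots> = \<bar>Im y\<bar>" unfolding i using pi_gt_zero by (simp add: abs_mult)
    also have "\<dots> < d" using that by (auto simp: S_def)
    finally show False by (simp add: d_def)
  qed
  have lS: "l \<in> S" using d dp dn by (auto simp: S_def l_def)
  define A B C D where "A = Complex (-M) (-pi)" and "B = Complex M (-pi)" and "C = Complex M pi" and "D = Complex (-M) pi"
  define R where "R = rectpath A C"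
  have holo: "Z holomorphic_on S - {l}"
    unfolding Z_def using nz1 nz2 by (intro holomorphic_intros) auto
  have img: "path_image R \<subseteq> cbox A C - box A C"
    unfolding R_def using Mp pi_gt_zero by (subst path_image_rectpath_cbox_minus_box) (auto simp: A_def C_def)
  have lbox: "l \<in> box A C" using M pi_gt_zero by (auto simp: in_box_complex_iff A_def C_def l_def)
  have cb: "cbox A C \<subseteq> S" using d dp dn by (auto simp: in_cbox_complex_iff A_def C_def S_def)
  have Rsub: "path_image R \<subseteq> S - {l}" using img lbox cb by auto
  have "contour_integral R Z = 2 * pi * \<i> * (\<Sum>p\<in>{l}. winding_number R p * residue Z p)"
  proof (rule Residue_theorem[OF S(1) _ _ holo])
    show "connected S" using S(2) by (rule convex_connected)
    show "path_image R \<subseteq> S - {l}" by fact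
    show "\<forall>z. z \<notin> S \<longrightarrow> winding_number R z = 0"
      unfolding R_def using cb Mp by (auto intro!: winding_number_rectpath_outside simp: A_def C_def)
  qed (auto simp: R_def)
  also have "\<dots> = 2 * pi * \<i> * residue Z l"
    using winding_number_rectpath[OF lbox] by (simp add: R_def)
  also have "residue Z l = (exp (a * l) / (1 + exp (a * l))) / exp l"
  proof -
    have "residue (\<lambda>w. (exp (a * w) / (1 + exp (a * w))) / (exp w - lam)) l = (exp (a * l) / (1 + exp (a * l))) / exp l"
      using nz1 lS S lam by (intro residue_simple_pole_deriv[where s = S] holomorphic_intros convex_connected)
        (auto intro!: derivative_eq_intros simp: el)
    then show ?thesis by (simp add: Z_def)
  qed
  also have "\<dots> = of_real (lam powr (a - 1) / (1 + lam powr a))"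
  proof -
    have "exp (a * l) = of_real (lam powr a)"
      unfolding l_def using lam by (simp add: powr_def exp_of_real[symmetric])
    then show ?thesis using lam by (simp add: el powr_diff field_simps)
  qed
  finally have total: "contour_integral R Z = 2 * pi * \<i> * of_real (lam powr (a - 1) / (1 + lam powr a))" .
  have AC: "Complex (Re C) (Im A) = B" "Complex (Re A) (Im C) = D"
    by (auto simp: A_def B_def C_def D_def)
  have Req: "R = linepath A B +++ linepath B C +++ linepath C D +++ linepath D A"
    unfolding R_def rectpath_def Let_def AC ..
  have pim: "path_image R = closed_segment A B \<union> closed_segment B C \<union> closed_segment C D \<union> closed_segment D A"
    unfolding Req by (simp add: path_image_join Un_assoc)
  have cont: "continuous_on (S - {l}) Z" using holo by (rule holomorphic_on_imp_continuous_on)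
  have ci: "Z contour_integrable_on linepath A B" "Z contour_integrable_on linepath B C"
     "Z contour_integrable_on linepath C D" "Z contour_integrable_on linepath D A"
    using Rsub unfolding pim by (auto intro!: contour_integrable_continuous_linepath continuous_on_subset[OF cont])
  have split: "contour_integral R Z = contour_integral (linepath A B) Z + contour_integral (linepath B C) Z
      + contour_integral (linepath C D) Z + contour_integral (linepath D A) Z"
    unfolding Req using ci by (simp add: contour_integrable_join)
  have AB: "contour_integral (linepath A B) Z = integral {-M..M} (\<lambda>v. Z (of_real v - \<i> * pi))"
    unfolding A_def B_def using Mp by (subst contour_integral_linepath_shift_Reals) auto
  have "contour_integral (linepath C D) Z = - contour_integral (linepath D C) Z"
    using contour_integral_reverse_linepath[of C D Z] contour_integral_reverse_linepath[of D C Z] ci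
     Rsub unfolding pim by (metis Un_subset_iff cont continuous_on_subset)
  also have "contour_integral (linepath D C) Z = integral {-M..M} (\<lambda>v. Z (of_real v + \<i> * pi))"
    unfolding D_def C_def using Mp by (subst contour_integral_linepath_shift_Reals) auto
  finally have CD: "contour_integral (linepath C D) Z = - integral {-M..M} (\<lambda>v. Z (of_real v + \<i> * pi))" .
  have seg: "of_real v - \<i> * pi \<in> S - {l}" "of_real v + \<i> * pi \<in> S - {l}" for v
    using d dp dn by (auto simp: S_def l_def complex_eq_iff)
  have io: "(\<lambda>v. Z (of_real v - \<i> * pi)) integrable_on {-M..M}" "(\<lambda>v. Z (of_real v + \<i> * pi)) integrable_on {-M..M}"
    using seg by (auto intro!: integrable_continuous_real continuous_on_compose2[OF cont] continuous_intros)
  define k where "k = (\<lambda>v. sin (pi * a) * exp (a * v) / (spectral_denom a (exp (a * v)) * (exp v + lam)))"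
  have "contour_integral (linepath A B) Z + contour_integral (linepath C D) Z
     = integral {-M..M} (\<lambda>v. Z (of_real v - \<i> * pi) - Z (of_real v + \<i> * pi))"
    unfolding AB CD using io by (simp add: Henstock_Kurzweil_Integration.integral_diff)
  also have "\<dots> = integral {-M..M} (\<lambda>v. 2 * \<i> * of_real (k v))"
    unfolding Z_def k_def using edge_jump[OF a lam] by simp
  also have "\<dots> = 2 * \<i> * of_real (integral {-M..M} k)"
  proof -
    have dn: "spectral_denom a w \<noteq> 0" for w using spectral_denom_pos[OF a, of w] by simp
    have en: "exp v + lam \<noteq> 0" for v using lam exp_gt_zero[of v] by linarith
    have "continuous_on {-M..M} k" unfolding k_def
      by (intro continuous_intros) (use dn en in \<open>auto simp: spectral_denom_def intro!: continuous_intros\<close>)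
    then have "k integrable_on {-M..M}" by (rule integrable_continuous_real)
    then have "(k has_integral integral {-M..M} k) {-M..M}" by (rule integrable_integral)
    then have "((\<lambda>v. 2 * \<i> * of_real (k v)) has_integral 2 * \<i> * of_real (integral {-M..M} k)) {-M..M}"
      by (intro has_integral_mult_right has_integral_of_real)
    then show ?thesis by (rule integral_unique)
  qed
  finally have hor: "contour_integral (linepath A B) Z + contour_integral (linepath C D) Z = 2 * \<i> * of_real (integral {-M..M} k)" .
  define b1 b2 where "b1 = exp (a * M) / ((exp (a * M) - 1) * (exp M - lam))"
    and "b2 = exp (- (a * M)) / ((1 - exp (- (a * M))) * (lam - exp (- M)))"
  have "exp (ln lam) < exp M" "exp (- M) < exp (ln lam)" using M by (auto simp: abs_less_iff)
  then have eM: "exp M > lam" "exp (- M) < lam" using lam by simp_all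
  have eaM: "exp (a * M) > 1" "exp (- (a * M)) < 1" using a Mp by auto
  have nb1: "norm (Z y) \<le> b1" if "y \<in> closed_segment B C" for y
  proof -
    have y: "Re y = M" using that by (auto simp: B_def C_def closed_segment_same_Re)
    have "norm (exp (a * y)) = exp (a * M)" "norm (exp y) = exp M" using y by (auto simp: norm_exp_eq_Re)
    moreover have "exp (a * M) - 1 \<le> norm (1 + exp (a * y))"
      using norm_diff_ineq[of "exp (a * y)" 1] calculation by (simp add: add.commute)
    moreover have "exp M - lam \<le> norm (exp y - lam)"
      using norm_triangle_ineq2[of "exp y" "of_real lam"] calculation lam by simp
    ultimately show ?thesis unfolding Z_def b1_def norm_divide norm_mult
      using eM eaM by (intro divide_mono mult_mono mult_pos_pos) auto
  qed
  have nb2: "norm (Z y) \<le> b2" if "y \<in> closed_segment D A" for y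
  proof -
    have y: "Re y = - M" using that by (auto simp: D_def A_def closed_segment_same_Re)
    have "norm (exp (a * y)) = exp (- (a * M))" "norm (exp y) = exp (- M)" using y by (auto simp: norm_exp_eq_Re)
    moreover have "1 - exp (- (a * M)) \<le> norm (1 + exp (a * y))"
      using norm_diff_ineq[of 1 "exp (a * y)"] calculation by simp
    moreover have "lam - exp (- M) \<le> norm (exp y - lam)"
      using norm_triangle_ineq2[of "of_real lam" "exp y"] calculation lam by (simp add: norm_minus_commute)
    ultimately show ?thesis unfolding Z_def b2_def norm_divide norm_mult
      using eM eaM by (intro divide_mono mult_mono mult_pos_pos) auto
  qed
  have bp: "b1 \<ge> 0" "b2 \<ge> 0" using eM eaM by (auto simp: b1_def b2_def)
  have "norm (contour_integral (linepath B C) Z) \<le> b1 * norm (C - B)"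
    using ci bp nb1 by (intro contour_integral_bound_linepath) auto
  also have "norm (C - B) = 2 * pi" using pi_gt_zero by (simp add: C_def B_def cmod_def real_sqrt_mult)
  finally have vBC: "norm (contour_integral (linepath B C) Z) \<le> b1 * (2 * pi)" .
  have "norm (contour_integral (linepath D A) Z) \<le> b2 * norm (A - D)"
    using ci bp nb2 by (intro contour_integral_bound_linepath) auto
  also have "norm (A - D) = 2 * pi" using pi_gt_zero by (simp add: A_def D_def cmod_def real_sqrt_mult)
  finally have vDA: "norm (contour_integral (linepath D A) Z) \<le> b2 * (2 * pi)" .
  define r where "r = lam powr (a - 1) / (1 + lam powr a)"
  have "2 * \<i> * of_real (integral {-M..M} k - pi * r) = - (contour_integral (linepath B C) Z + contour_integral (linepath D A) Z)"
    using split total hor unfolding r_def[symmetric] by (simp add: algebra_simps)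
  then have "norm (2 * \<i> * of_real (integral {-M..M} k - pi * r)) \<le> b1 * (2 * pi) + b2 * (2 * pi)"
    using vBC vDA norm_triangle_ineq[of "contour_integral (linepath B C) Z" "contour_integral (linepath D A) Z"]
    by (simp only: norm_minus_cancel)
  then have "2 * \<bar>integral {-M..M} k - pi * r\<bar> \<le> b1 * (2 * pi) + b2 * (2 * pi)"
    by (simp add: norm_mult del: of_real_diff)
  moreover have "pi * lam powr (a - 1) / (1 + lam powr a) = pi * r" by (simp add: r_def)
  ultimately show ?thesis
    unfolding k_def[symmetric] b1_def[symmetric] b2_def[symmetric] by (simp add: algebra_simps)
qed

text \<open>Change of variables for Henstock--Kurzweil integrals, transferred to the Lebesgue integral of Borel
  functions.\<close>

lemma lborel_substitution:
  fixes f g g' :: "real \<Rightarrow> real"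
  assumes [measurable]: "S \<in> sets borel" "g ` S \<in> sets borel" "f \<in> borel_measurable borel"
      "g \<in> borel_measurable borel" "g' \<in> borel_measurable borel"
    and der: "\<And>x. x \<in> S \<Longrightarrow> (g has_field_derivative g' x) (at x within S)" and inj: "inj_on g S"
  shows "set_integrable lborel (g ` S) f \<longleftrightarrow> set_integrable lborel S (\<lambda>x. \<bar>g' x\<bar> * f (g x))" (is "?A \<longleftrightarrow> ?B")
    and "set_integrable lborel (g ` S) f \<Longrightarrow>
         (LINT x:g ` S|lborel. f x) = (LINT x:S|lborel. \<bar>g' x\<bar> * f (g x))"
proof -
  have leb: "set_integrable lebesgue T k \<longleftrightarrow> set_integrable lborel T k"
    "(LINT x:T|lebesgue. k x) = (LINT x:T|lborel. k x)"
    if [measurable]: "T \<in> sets borel" "k \<in> borel_measurable borel" for T and k :: "real \<Rightarrow> real"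
    unfolding set_integrable_def set_lebesgue_integral_def
    by (auto intro!: integrable_completion integral_completion)
  have Sl: "S \<in> sets lebesgue" by auto
  note cov = has_absolute_integral_change_of_variables_1'[OF Sl der inj, of f]
  have B: "?B \<longleftrightarrow> (\<lambda>x. \<bar>g' x\<bar> * f (g x)) absolutely_integrable_on S"
    by (subst leb) auto
  have A: "?A \<longleftrightarrow> f absolutely_integrable_on g ` S"
    by (subst leb) auto
  show AB: "?A \<longleftrightarrow> ?B" unfolding A B using cov by blast
  assume a: ?A
  then have b: ?B using AB by blast
  have "integral (g ` S) f = integral S (\<lambda>x. \<bar>g' x\<bar> * f (g x))"
    using cov[of "integral (g ` S) f"] a unfolding A by auto
  moreover have "(LINT x:g ` S|lebesgue. f x) = integral (g ` S) f"
    using a unfolding A by (intro set_lebesgue_integral_eq_integral)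
  moreover have "(LINT x:S|lebesgue. \<bar>g' x\<bar> * f (g x)) = integral S (\<lambda>x. \<bar>g' x\<bar> * f (g x))"
    using b unfolding B by (intro set_lebesgue_integral_eq_integral)
  ultimately show "(LINT x:g ` S|lborel. f x) = (LINT x:S|lborel. \<bar>g' x\<bar> * f (g x))"
    by (simp add: leb)
qed

lemma spectral_denom_measurable [measurable]: "spectral_denom a \<in> borel_measurable borel"
  unfolding spectral_denom_def[abs_def] by measurable

lemma spectral_density_measurable [measurable]: "spectral_density a \<in> borel_measurable borel"
  unfolding spectral_density_def[abs_def] by measurable

lemma spectral_density_nonneg: "0 < a \<Longrightarrow> a < 1 \<Longrightarrow> 0 \<le> spectral_density a t"
  unfolding spectral_density_def using sin_pi_pos[of a] spectral_denom_pos[of a "t powr a"] by simp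

text \<open>For a nonnegative function convergence of the integrals over \<open>{- M..M}\<close> is integrability, by
  monotone convergence.\<close>

lemma integral_symmetric_limit:
  fixes k :: "real \<Rightarrow> real"
  assumes k[measurable]: "k \<in> borel_measurable borel" and pos: "\<And>v. k v \<ge> 0"
    and cont: "continuous_on UNIV k" and lim: "((\<lambda>M. integral {-M..M} k) \<longlongrightarrow> x) at_top"
  shows "has_bochner_integral lborel k (x::real)"
proof -
  let ?f = "\<lambda>(i::nat) v. indicator {- real i..real i} v *\<^sub>R k v"
  have i: "set_integrable lborel {- real i..real i} k" for i
    by (intro borel_integrable_atLeastAtMost' continuous_on_subset[OF cont]) auto
  show ?thesis
  proof (rule has_bochner_integral_monotone_convergence)
    show "integrable lborel (?f i)" for i using i[of i] by (simp add: set_integrable_def)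
    show "AE v in lborel. mono (\<lambda>n. ?f n v)"
      using pos by (auto intro!: AE_I2 monoI simp: indicator_def)
    show "AE v in lborel. (\<lambda>i. ?f i v) \<longlonglongrightarrow> k v"
    proof (rule AE_I2)
      fix v
      have "eventually (\<lambda>i. ?f i v = k v) sequentially"
        by (rule eventually_sequentiallyI[of "nat \<lceil>\<bar>v\<bar>\<rceil>"]) (auto simp: indicator_def nat_le_iff ceiling_le_iff)
      then show "(\<lambda>i. ?f i v) \<longlonglongrightarrow> k v" by (rule tendsto_eventually)
    qed
    have "integral\<^sup>L lborel (?f i) = integral {- real i..real i} k" for i
      using set_borel_integral_eq_integral(2)[OF i[of i]] by (simp add: set_lebesgue_integral_def)
    then show "(\<lambda>i. integral\<^sup>L lborel (?f i)) \<longlonglongrightarrow> x"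
      using filterlim_compose[OF lim filterlim_real_sequentially] by simp
  qed auto
qed

text \<open>Let the rectangle of \<open>stieltjes_kernel_rectangle\<close> become infinitely long and return to \<open>t = exp v\<close>.\<close>

lemma spectral_density_stieltjes:
  assumes a: "0 < a" "a < 1" and lam: "lam > 0"
  shows "has_bochner_integral lborel (\<lambda>t. indicator {0<..} t * (spectral_density a t / (t + lam))) (1 / (lam + lam powr (1 - a)))"
proof -
  define k where "k = (\<lambda>v. sin (pi * a) * exp (a * v) / (spectral_denom a (exp (a * v)) * (exp v + lam)))"
  define b where "b = (\<lambda>M. pi * (exp (a * M) / ((exp (a * M) - 1) * (exp M - lam))
         + exp (- (a * M)) / ((1 - exp (- (a * M))) * (lam - exp (- M)))))"
  define r where "r = lam powr (a - 1) / (1 + lam powr a)"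
  have dp: "spectral_denom a w > 0" for w using a by (rule spectral_denom_pos)
  have ep: "exp v + lam > 0" for v using lam exp_gt_zero[of v] by linarith
  have "continuous_on UNIV k" unfolding k_def
    by (intro continuous_intros) (use dp[THEN less_imp_neq] ep[THEN less_imp_neq] in \<open>force simp: spectral_denom_def intro!: continuous_intros\<close>)+
  have "(b \<longlongrightarrow> 0) at_top"
    unfolding b_def using a lam by real_asymp
  have "((\<lambda>M. integral {-M..M} k - pi * r) \<longlongrightarrow> 0) at_top"
  proof (rule Lim_null_comparison)
    show "\<forall>\<^sub>F M in at_top. norm (integral {-M..M} k - pi * r) \<le> b M"
      using eventually_gt_at_top[of "\<bar>ln lam\<bar>"]
      by eventually_elim (use stieltjes_kernel_rectangle[OF a lam] in \<open>simp add: k_def b_def r_def\<close>)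
  qed fact
  then have lim: "((\<lambda>M. integral {-M..M} k) \<longlongrightarrow> pi * r) at_top"
    by (simp add: LIM_zero_iff)
  have kpos: "k v \<ge> 0" for v
    unfolding k_def using sin_pi_pos[OF a] dp ep by (simp add: less_imp_le)
  have kint: "has_bochner_integral lborel k (pi * r)"
    by (rule integral_symmetric_limit[OF _ kpos _ lim]) (use \<open>continuous_on UNIV k\<close> in \<open>auto intro: borel_measurable_continuous_onI\<close>)
  let ?f = "\<lambda>t. spectral_density a t / (t + lam)"
  have ke: "\<bar>exp v\<bar> * ?f (exp v) = k v / pi" for v
  proof -
    have "exp v powr (a - 1) = exp (a * v) / exp v" "exp v powr a = exp (a * v)"
      by (simp_all add: powr_def left_diff_distrib exp_diff)
    then show ?thesis by (simp add: spectral_density_def k_def)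
  qed
  have rng: "exp ` UNIV = {0::real<..}"
    by (auto simp: image_iff) (metis exp_ln)
  have d: "((exp::real\<Rightarrow>real) has_field_derivative exp x) (at x within UNIV)" for x
    by (auto intro!: derivative_eq_intros)
  have inj: "inj_on (exp :: real \<Rightarrow> real) UNIV" by (auto intro: inj_onI)
  have "set_integrable lborel UNIV (\<lambda>v. \<bar>exp v\<bar> * ?f (exp v))"
    unfolding ke set_integrable_def using kint by (auto simp: has_bochner_integral_iff)
  then have si: "set_integrable lborel {0<..} ?f"
    using lborel_substitution(1)[of UNIV exp ?f exp, OF _ _ _ _ _ d inj] unfolding rng by auto
  moreover have "(LINT t:{0<..}|lborel. ?f t) = (LINT v:UNIV|lborel. \<bar>exp v\<bar> * ?f (exp v))"
    using lborel_substitution(2)[of UNIV exp ?f exp, OF _ _ _ _ _ d inj] si unfolding rng by auto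
  moreover have "\<dots> = r"
    unfolding ke set_lebesgue_integral_def using kint by (auto simp: has_bochner_integral_iff)
  moreover have "r = 1 / (lam + lam powr (1 - a))"
  proof -
    have "lam powr (1 - a) * (1 + lam powr a) = lam + lam powr (1 - a)"
      using lam by (simp add: distrib_left powr_add[symmetric])
    moreover have "lam powr (a - 1) = 1 / lam powr (1 - a)"
      by (metis minus_diff_eq powr_minus_divide)
    ultimately show ?thesis by (simp add: r_def)
  qed
  ultimately show ?thesis
    by (simp add: has_bochner_integral_iff set_integrable_def set_lebesgue_integral_def)
qed

section \<open>The Mittag-Leffler function\<close>

lemma laplace_measurable [measurable]:
  assumes [measurable]: "q \<in> borel_measurable borel"
  shows "laplace q \<in> borel_measurable borel"
  unfolding laplace_def[abs_def] set_lebesgue_integral_def by measurable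

lemma laplace_nonneg: "(\<And>v. v > 0 \<Longrightarrow> q v \<ge> 0) \<Longrightarrow> laplace q \<rho> \<ge> 0"
  unfolding laplace_def set_lebesgue_integral_def
  by (intro Bochner_Integration.integral_nonneg) (auto simp: indicator_def)

lemma laplace_nn_integral:
  assumes "laplaceable q" "\<And>v. v > 0 \<Longrightarrow> q v \<ge> 0" "\<rho> > 0"
  shows "(\<integral>\<^sup>+v. ennreal (indicator {0<..} v * (exp (- (\<rho> * v)) * q v)) \<partial>lborel) = ennreal (laplace q \<rho>)"
  using nn_integral_eq_integral[OF laplaceable_integrable[OF assms(1,3)]] assms(2)
  by (simp add: laplace_def set_lebesgue_integral_def indicator_def)

text \<open>The value at \<open>\<tau>\<close> is \<open>E\<^sub>a (- \<tau> powr a)\<close> with the Mittag-Leffler function \<open>E\<^sub>a\<close>. Its spectral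
  representation is used as the definition because it makes positivity and the behaviour at
  infinity visible, which the alternating power series hides.\<close>

definition mittag_leffler :: "real \<Rightarrow> real \<Rightarrow> real" where
  "mittag_leffler a = laplace (spectral_density a)"

lemma mittag_leffler_measurable [measurable]: "mittag_leffler a \<in> borel_measurable borel"
  unfolding mittag_leffler_def by measurable

lemma mittag_leffler_nonneg: "0 < a \<Longrightarrow> a < 1 \<Longrightarrow> 0 \<le> mittag_leffler a \<tau>"
  unfolding mittag_leffler_def by (intro laplace_nonneg spectral_density_nonneg)

text \<open>Both \<open>(w + cos)\<^sup>2 + sin\<^sup>2\<close> and \<open>(1 + w * cos)\<^sup>2 + sin\<^sup>2 * w\<^sup>2\<close> are ways to write the denominator;
  their average gives a lower bound that is sharp in order at \<open>w = 0\<close> and at \<open>w = \<infinity>\<close>.\<close>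

lemma spectral_denom_lower:
  assumes a: "0 < a" "a < 1"
  shows "(sin (pi * a))^2 / 2 * (1 + w^2) \<le> spectral_denom a w"
proof -
  have "(sin (pi * a))^2 \<le> spectral_denom a w" unfolding spectral_denom_eq by simp
  moreover have "(sin (pi * a))^2 * w^2 \<le> spectral_denom a w"
  proof -
    have "spectral_denom a w = (1 + cos (pi * a) * w)^2 + (sin (pi * a))^2 * w^2"
      unfolding spectral_denom_def by (simp add: power2_sum power_mult_distrib distrib_right[symmetric])
    then show ?thesis by simp
  qed
  ultimately show ?thesis by (simp add: algebra_simps)
qed

lemma spectral_denom_ratio:
  assumes a: "0 < a" "a < 1" and p: "\<bar>p\<bar> \<le> C * (1 + w^2)"
  shows "\<bar>p / spectral_denom a w\<bar> \<le> 2 * C / (sin (pi * a))^2"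
proof -
  have s: "sin (pi * a) > 0" using a by (rule sin_pi_pos)
  have d: "spectral_denom a w > 0" using a by (rule spectral_denom_pos)
  have w: "1 + w^2 > 0" by (simp add: add_pos_nonneg)
  have "0 \<le> C * (1 + w^2)" using p by linarith
  then have C: "C \<ge> 0" using w by (simp add: zero_le_mult_iff)
  have "\<bar>p\<bar> \<le> C * (1 + w^2)" by fact
  also have "\<dots> = 2 * C / (sin (pi * a))^2 * ((sin (pi * a))^2 / 2 * (1 + w^2))" using s by simp
  also have "\<dots> \<le> 2 * C / (sin (pi * a))^2 * spectral_denom a w"
    using C by (intro mult_left_mono spectral_denom_lower a) auto
  finally show ?thesis using d by (simp add: divide_le_eq)
qed

lemma linear_le_square: "\<bar>w\<bar> \<le> 1 + w^2" for w :: real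
  using sum_squares_bound[of "\<bar>w\<bar>" 1] by (simp add: power2_eq_square abs_if split: if_splits)

lemma spectral_density_le:
  assumes a: "0 < a" "a < 1"
  shows "\<bar>spectral_density a t\<bar> \<le> 2 / (pi * sin (pi * a)) * t powr (a - 1)"
proof -
  have s: "sin (pi * a) > 0" using a by (rule sin_pi_pos)
  have "\<bar>1 / spectral_denom a (t powr a)\<bar> \<le> 2 * 1 / (sin (pi * a))^2"
    by (rule spectral_denom_ratio[OF a]) simp
  then have "sin (pi * a) / pi * t powr (a - 1) * \<bar>1 / spectral_denom a (t powr a)\<bar>
      \<le> sin (pi * a) / pi * t powr (a - 1) * (2 / (sin (pi * a))^2)"
    using s by (intro mult_left_mono) auto
  then show ?thesis using s by (simp add: spectral_density_def abs_mult power2_eq_square mult_ac)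
qed

lemma spectral_density_laplaceable: "0 < a \<Longrightarrow> a < 1 \<Longrightarrow> laplaceable (spectral_density a)"
  by (rule laplaceable_bound[OF _ spectral_density_le]) auto

lemma mittag_leffler_le:
  assumes a: "0 < a" "a < 1"
  obtains K where "\<And>\<tau>. \<tau> > 0 \<Longrightarrow> mittag_leffler a \<tau> \<le> K * \<tau> powr (- a)" "K \<ge> 0"
proof
  show "mittag_leffler a \<tau> \<le> 2 / (pi * sin (pi * a)) * Gamma a * \<tau> powr (- a)" if "\<tau> > 0" for \<tau>
    using laplace_bound[OF _ spectral_density_le[OF a] a(1) that] by (simp add: mittag_leffler_def)
  show "2 / (pi * sin (pi * a)) * Gamma a \<ge> 0"
    using sin_pi_pos[OF a] Gamma_real_pos[OF a(1)] by simp
qed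

text \<open>By Tonelli the iterated Laplace transform is the Stieltjes transform of the spectral density.\<close>

lemma
  assumes a: "0 < a" "a < 1"
  shows mittag_leffler_laplaceable: "laplaceable (mittag_leffler a)"
    and mittag_leffler_laplace: "lam > 0 \<Longrightarrow> laplace (mittag_leffler a) lam = 1 / (lam + lam powr (1 - a))"
proof -
  obtain K where K: "\<And>\<tau>. \<tau> > 0 \<Longrightarrow> mittag_leffler a \<tau> \<le> K * \<tau> powr (- a)" using mittag_leffler_le[OF a] by metis
  show l: "laplaceable (mittag_leffler a)"
    using K mittag_leffler_nonneg[OF a] a by (intro laplaceable_bound[of _ K "1 - a"]) auto
  assume lam: "lam > 0"
  let ?F = "\<lambda>\<tau> t. ennreal (indicator {0<..} \<tau> * indicator {0<..} t * (exp (- ((lam + t) * \<tau>)) * spectral_density a t))"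
  have "ennreal (laplace (mittag_leffler a) lam) = (\<integral>\<^sup>+\<tau>. ennreal (indicator {0<..} \<tau> * (exp (- (lam * \<tau>)) * mittag_leffler a \<tau>)) \<partial>lborel)"
    using laplace_nn_integral[OF l mittag_leffler_nonneg[OF a] lam] by simp
  also have "\<dots> = (\<integral>\<^sup>+\<tau>. (\<integral>\<^sup>+t. ?F \<tau> t \<partial>lborel) \<partial>lborel)"
  proof (rule nn_integral_cong)
    fix \<tau> :: real
    show "ennreal (indicator {0<..} \<tau> * (exp (- (lam * \<tau>)) * mittag_leffler a \<tau>)) = (\<integral>\<^sup>+t. ?F \<tau> t \<partial>lborel)"
    proof (cases "\<tau> > 0")
      case True
      have "ennreal (exp (- (lam * \<tau>)) * mittag_leffler a \<tau>) = ennreal (exp (- (lam * \<tau>))) *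
         (\<integral>\<^sup>+t. ennreal (indicator {0<..} t * (exp (- (\<tau> * t)) * spectral_density a t)) \<partial>lborel)"
        using laplace_nn_integral[OF spectral_density_laplaceable[OF a] spectral_density_nonneg[OF a] True]
        by (simp add: mittag_leffler_def ennreal_mult')
      also have "\<dots> = (\<integral>\<^sup>+t. ennreal (exp (- (lam * \<tau>))) * ennreal (indicator {0<..} t * (exp (- (\<tau> * t)) * spectral_density a t)) \<partial>lborel)"
        by (rule nn_integral_cmult[symmetric]) auto
      also have "\<dots> = (\<integral>\<^sup>+t. ?F \<tau> t \<partial>lborel)"
        using True by (intro nn_integral_cong) (simp add: ennreal_mult'[symmetric] mult.left_commute exp_add[symmetric] algebra_simps)
      finally show ?thesis using True by simp
    qed simp
  qed
  also have "\<dots> = (\<integral>\<^sup>+t. (\<integral>\<^sup>+\<tau>. ?F \<tau> t \<partial>lborel) \<partial>lborel)"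
    by (rule lborel_pair.Fubini') measurable
  also have "\<dots> = (\<integral>\<^sup>+t. ennreal (indicator {0<..} t * (spectral_density a t / (t + lam))) \<partial>lborel)"
  proof (rule nn_integral_cong)
    fix t :: real
    show "(\<integral>\<^sup>+\<tau>. ?F \<tau> t \<partial>lborel) = ennreal (indicator {0<..} t * (spectral_density a t / (t + lam)))"
    proof (cases "t > 0")
      case True
      then have p: "lam + t > 0" using lam by simp
      have "(\<integral>\<^sup>+\<tau>. ?F \<tau> t \<partial>lborel) = (\<integral>\<^sup>+\<tau>. ennreal (spectral_density a t) * ennreal (indicator {0<..} \<tau> * (exp (- ((lam + t) * \<tau>)) * (\<tau> powr (1 - 1)))) \<partial>lborel)"
        using True by (intro nn_integral_cong) (auto simp: ennreal_mult'[symmetric] spectral_density_nonneg[OF a] indicator_def mult.commute)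
      also have "\<dots> = ennreal (spectral_density a t) * (\<integral>\<^sup>+\<tau>. ennreal (indicator {0<..} \<tau> * (exp (- ((lam + t) * \<tau>)) * (\<tau> powr (1 - 1)))) \<partial>lborel)"
        by (rule nn_integral_cmult) auto
      also have "\<dots> = ennreal (spectral_density a t) * ennreal (1 / (lam + t))"
        using laplace_nn_integral[OF laplaceable_powr[of 1] _ p] laplace_powr[of 1 "lam + t"] p
        by (simp add: powr_minus_divide)
      finally show ?thesis using True p spectral_density_nonneg[OF a, of t]
        by (simp add: ennreal_mult'[symmetric] add.commute)
    qed simp
  qed
  also have "\<dots> = ennreal (1 / (lam + lam powr (1 - a)))"
    using spectral_density_stieltjes[OF a lam] spectral_density_nonneg[OF a] lam
    by (subst nn_integral_eq_integral) (auto simp: has_bochner_integral_iff indicator_def)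
  finally show "laplace (mittag_leffler a) lam = 1 / (lam + lam powr (1 - a))"
    using laplace_nonneg[of "mittag_leffler a" lam] mittag_leffler_nonneg[OF a] lam by (simp add: ennreal_inj)
qed

text \<open>Holds for every real \<open>z\<close>: at an integer both sides are \<open>0\<close>, since \<open>Gamma\<close> is \<open>0\<close> at its poles and
  division by \<open>0\<close> gives \<open>0\<close>. The expansion at infinity below is therefore also right when the
  coefficient \<open>1 / Gamma (1 - 2 * a)\<close> degenerates.\<close>

lemma Gamma_reflection_on_reals:
  fixes z :: real
  shows "Gamma z * Gamma (1 - z) = pi / sin (pi * z)"
proof -
  have "complex_of_real (Gamma z * Gamma (1 - z)) = Gamma (of_real z) * Gamma (1 - of_real z)"
    by (simp add: Gamma_complex_of_real[symmetric])
  also have "\<dots> = of_real pi / sin (of_real pi * of_real z)"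
    by (rule Gamma_reflection_complex)
  also have "\<dots> = of_real (pi / sin (pi * z))" by (simp add: sin_of_real[symmetric])
  finally show ?thesis by (simp only: of_real_eq_iff)
qed

lemma laplace_plus_two_powers:
  assumes q: "laplaceable q" and xy: "x > 0" "y > 0" and \<tau>: "\<tau> > 0"
  shows "laplace (\<lambda>t. q t + (A * t powr (x - 1) + B * t powr (y - 1))) \<tau>
     = laplace q \<tau> + (A * (Gamma x * \<tau> powr (- x)) + B * (Gamma y * \<tau> powr (- y)))"
proof -
  have p: "laplaceable (\<lambda>t. A * t powr (x - 1))" "laplaceable (\<lambda>t. B * t powr (y - 1))"
    using xy by (auto intro: laplace_cmult(1) laplaceable_powr)
  show ?thesis
    by (simp only: laplace_add(2)[OF q laplace_add(1)[OF p] \<tau>] laplace_add(2)[OF p \<tau>]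
        laplace_cmult(2) laplace_powr[OF xy(1) \<tau>] laplace_powr[OF xy(2) \<tau>])
qed

text \<open>Behaviour at infinity comes from the spectral density near \<open>t = 0\<close>, where with \<open>w = t powr a\<close> it is
  a multiple of \<open>t powr (a - 1) * (1 - 2 * cos (pi * a) * w + O (w\<^sup>2))\<close>. The remainder is \<open>O (w\<^sup>2)\<close> for
  all \<open>w\<close>, and the reflection formula turns the coefficients into reciprocal Gamma values.\<close>

lemma mittag_leffler_large:
  assumes a: "0 < a" "a < 1"
  obtains C where "\<And>\<tau>. \<tau> > 0 \<Longrightarrow>
    \<bar>mittag_leffler a \<tau> - (\<tau> powr (- a) / Gamma (1 - a) - \<tau> powr (- (2 * a)) / Gamma (1 - 2 * a))\<bar> \<le> C * \<tau> powr (- (3 * a))"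
proof -
  define c s where "c = cos (pi * a)" and "s = sin (pi * a)"
  have s: "s > 0" unfolding s_def using a by (rule sin_pi_pos)
  have c: "\<bar>c\<bar> \<le> 1" unfolding c_def by simp
  define q where "q = (\<lambda>t. spectral_density a t - (s / pi * t powr (a - 1) + (- (2 * c * s / pi)) * t powr (2 * a - 1)))"
  define C where "C = s / pi * (2 * 5 / s^2)"
  have [measurable]: "q \<in> borel_measurable borel" unfolding q_def by measurable
  have bd: "\<bar>q t\<bar> \<le> C * t powr (3 * a - 1)" if t: "t > 0" for t
  proof -
    define w where "w = t powr a"
    have w: "w > 0" using t by (simp add: w_def)
    have d: "spectral_denom a w > 0" using a by (rule spectral_denom_pos)
    have pw: "t powr (2 * a - 1) = t powr (a - 1) * w" "t powr (3 * a - 1) = t powr (a - 1) * w^2"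
      using t by (simp_all add: w_def powr_add[symmetric] power2_eq_square)
    have "q t = s / pi * t powr (a - 1) * (1 / spectral_denom a w - 1 + 2 * c * w)"
      unfolding q_def pw spectral_density_def w_def[symmetric] s_def[symmetric] by (simp add: algebra_simps)
    also have "1 / spectral_denom a w - 1 + 2 * c * w = w^2 * (((4 * c^2 - 1) + 2 * c * w) / spectral_denom a w)"
      using d by (simp add: field_simps) (simp add: spectral_denom_def c_def[symmetric] power2_eq_square power3_eq_cube algebra_simps)
    finally have e: "\<bar>q t\<bar> = s / pi * t powr (a - 1) * w^2 * \<bar>((4 * c^2 - 1) + 2 * c * w) / spectral_denom a w\<bar>"
      using s by (simp add: abs_mult)
    have "\<bar>(4 * c^2 - 1) + 2 * c * w\<bar> \<le> 5 * (1 + w^2)"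
    proof -
      have "c^2 \<le> 1" using c by (simp add: abs_square_le_1)
      moreover have "\<bar>c * w\<bar> \<le> 1 * (1 + w^2)" unfolding abs_mult
        using c linear_le_square[of w] by (intro mult_mono) auto
      then have "c * w \<le> 1 + w^2" "- (c * w) \<le> 1 + w^2" by (simp_all add: abs_le_iff)
      moreover have "\<bar>(4 * C - 1) + 2 * c * w\<bar> \<le> 5 * (1 + W)"
        if "0 \<le> C" "C \<le> 1" "0 \<le> W" "c * w \<le> 1 + W" "- (c * w) \<le> 1 + W" for C W
        using that by (auto simp: mult.assoc abs_le_iff)
      ultimately show ?thesis by simp
    qed
    then have "\<bar>((4 * c^2 - 1) + 2 * c * w) / spectral_denom a w\<bar> \<le> 2 * 5 / s^2"
      unfolding s_def by (rule spectral_denom_ratio[OF a])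
    then have "\<bar>q t\<bar> \<le> s / pi * t powr (a - 1) * w^2 * (2 * 5 / s^2)"
      unfolding e using s by (intro mult_left_mono) auto
    also have "\<dots> = C * t powr (3 * a - 1)" by (simp add: C_def pw)
    finally show ?thesis .
  qed
  have lq: "laplaceable q" using bd a by (intro laplaceable_bound[of _ C "3 * a"]) auto
  show ?thesis
  proof
    fix \<tau> :: real assume \<tau>: "\<tau> > 0"
    have "mittag_leffler a \<tau> = laplace (\<lambda>t. q t + (s / pi * t powr (a - 1) + (- (2 * c * s / pi)) * t powr (2 * a - 1))) \<tau>"
      unfolding mittag_leffler_def q_def by (intro laplace_cong) simp
    also have "\<dots> = laplace q \<tau> + (s / pi * (Gamma a * \<tau> powr (- a)) + (- (2 * c * s / pi)) * (Gamma (2 * a) * \<tau> powr (- (2 * a))))"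
      using a by (intro laplace_plus_two_powers lq \<tau>) auto
    also have "s / pi * (Gamma a * \<tau> powr (- a)) = \<tau> powr (- a) / Gamma (1 - a)"
    proof -
      have "Gamma (1 - a) > 0" using a by (intro Gamma_real_pos) simp
      then show ?thesis using Gamma_reflection_on_reals[of a] s
        unfolding s_def by (simp add: field_simps)
    qed
    also have "(- (2 * c * s / pi)) * (Gamma (2 * a) * \<tau> powr (- (2 * a))) = - (\<tau> powr (- (2 * a)) / Gamma (1 - 2 * a))"
    proof -
      have d: "2 * c * s = sin (pi * (2 * a))" using sin_double[of "pi * a"] by (simp add: c_def s_def mult_ac)
      have r: "Gamma (2 * a) * Gamma (1 - 2 * a) = pi / sin (pi * (2 * a))" by (rule Gamma_reflection_on_reals)
      have g: "Gamma (2 * a) > 0" using a by (intro Gamma_real_pos) simp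
      show ?thesis
      proof (cases "sin (pi * (2 * a)) = 0")
        case True
        then show ?thesis using r g unfolding d by simp
      next
        case False
        then have "Gamma (1 - 2 * a) \<noteq> 0" using r by auto
        then show ?thesis unfolding d using r False by (simp add: field_simps)
      qed
    qed
    finally have "mittag_leffler a \<tau> - (\<tau> powr (- a) / Gamma (1 - a) - \<tau> powr (- (2 * a)) / Gamma (1 - 2 * a)) = laplace q \<tau>"
      by simp
    then show "\<bar>mittag_leffler a \<tau> - (\<tau> powr (- a) / Gamma (1 - a) - \<tau> powr (- (2 * a)) / Gamma (1 - 2 * a))\<bar>
       \<le> (C * Gamma (3 * a)) * \<tau> powr (- (3 * a))"
      using laplace_bound[OF _ bd _ \<tau>] a by simp
  qed
qed

lemma not_nonpos_Int: "(x::real) > - 1 \<Longrightarrow> x \<noteq> 0 \<Longrightarrow> x \<notin> \<int>\<^sub>\<le>\<^sub>0"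
  by (auto elim!: nonpos_Ints_cases)

lemma Gamma_three_halves: "Gamma (3 / 2 :: real) = sqrt pi / 2"
  using Gamma_plus1[of "1 / 2 :: real"] not_nonpos_Int[of "1 / 2"] Gamma_one_half_real by simp

lemma spectral_density_half:
  assumes t: "t > 0"
  shows "spectral_density (1/2) t = 1 / pi * (t powr (- 1/2) / (1 + t))"
  using t by (simp add: spectral_density_def spectral_denom_def powr_power)

text \<open>For \<open>a = 1 / 2\<close> the second term of the general expansion vanishes and one more is needed. Here
  the denominator is \<open>1 + t\<close>, and \<open>1 / (1 + t) = 1 - t + t\<^sup>2 / (1 + t)\<close>.\<close>

lemma mittag_leffler_half_large:
  obtains C where "\<And>\<tau>. \<tau> > 0 \<Longrightarrow>
    \<bar>mittag_leffler (1/2) \<tau> - (\<tau> powr (- 1/2) / Gamma (1/2) + \<tau> powr (- 3/2) / Gamma (- 1/2))\<bar> \<le> C * \<tau> powr (- 5/2)"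
proof -
  define q where "q = (\<lambda>t. spectral_density (1/2) t - (1 / pi * t powr (1/2 - 1) + (- (1 / pi)) * t powr (3/2 - 1)))"
  have [measurable]: "q \<in> borel_measurable borel" unfolding q_def by measurable
  have bd: "\<bar>q t\<bar> \<le> 1 / pi * t powr (5/2 - 1)" if t: "t > 0" for t
  proof -
    have pw: "t powr (3/2 - 1) = t powr (- 1/2) * t" "t powr (5/2 - 1) = t powr (- 1/2) * (t * t)"
      using t powr_add[of t "- 1/2" 1] powr_add[of t "- 1/2" 2] by (simp_all add: powr_numeral power2_eq_square)
    have ring: "p * (A * B) - (p * A + (- p) * (A * t)) = p * A * (B - 1 + t)" for p A B :: real
      by (simp add: algebra_simps)
    have "q t = 1 / pi * t powr (- 1/2) * (1 / (1 + t) - 1 + t)"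
      unfolding ring[symmetric] unfolding q_def pw spectral_density_half[OF t] by simp
    also have "1 / (1 + t) - 1 + t = t * t / (1 + t)" using t by (simp add: field_simps)
    finally have "\<bar>q t\<bar> = 1 / pi * t powr (- 1/2) * (t * t / (1 + t))" using t by (simp add: abs_mult)
    also have "\<dots> \<le> 1 / pi * t powr (- 1/2) * (t * t)"
      using t by (intro mult_left_mono) (auto simp: field_simps)
    finally show ?thesis unfolding pw by (simp only: mult.assoc)
  qed
  have lq: "laplaceable q" using bd by (intro laplaceable_bound[of _ "1/pi" "5/2"]) auto
  have G1: "Gamma (1/2) = sqrt pi" by (rule Gamma_one_half_real)
  have G3: "Gamma (3/2) = sqrt pi / 2" by (rule Gamma_three_halves)
  have G5: "Gamma (- 1/2) = - 2 * sqrt pi"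
  proof -
    have "(- 1/2 :: real) \<notin> \<int>\<^sub>\<le>\<^sub>0" by (rule not_nonpos_Int) auto
    then show ?thesis using Gamma_plus1[of "- 1/2 :: real"] G1 by simp
  qed
  show ?thesis
  proof
    fix \<tau> :: real assume \<tau>: "\<tau> > 0"
    have "mittag_leffler (1/2) \<tau> = laplace (\<lambda>t. q t + (1 / pi * t powr (1/2 - 1) + (- (1 / pi)) * t powr (3/2 - 1))) \<tau>"
      unfolding mittag_leffler_def q_def by (intro laplace_cong) simp
    also have "\<dots> = laplace q \<tau> + (1 / pi * (Gamma (1/2) * \<tau> powr (- (1/2))) + (- (1 / pi)) * (Gamma (3/2) * \<tau> powr (- (3/2))))"
      by (intro laplace_plus_two_powers lq \<tau>) auto
    also have "(1 / pi * (Gamma (1/2) * \<tau> powr (- (1/2))) + (- (1 / pi)) * (Gamma (3/2) * \<tau> powr (- (3/2))))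
       = \<tau> powr (- 1/2) / Gamma (1/2) + \<tau> powr (- 3/2) / Gamma (- 1/2)"
    proof -
      have "1 / pi * (sqrt pi * A) = A / sqrt pi" "- (1 / pi) * (sqrt pi / 2 * A) = A / (- 2 * sqrt pi)" for A
        by (simp_all add: field_simps)
      then show ?thesis unfolding G1 G3 G5 by simp
    qed
    finally have "mittag_leffler (1/2) \<tau> - (\<tau> powr (- 1/2) / Gamma (1/2) + \<tau> powr (- 3/2) / Gamma (- 1/2)) = laplace q \<tau>"
      by simp
    then show "\<bar>mittag_leffler (1/2) \<tau> - (\<tau> powr (- 1/2) / Gamma (1/2) + \<tau> powr (- 3/2) / Gamma (- 1/2))\<bar>
       \<le> (1 / pi * Gamma (5/2)) * \<tau> powr (- 5/2)"
      using laplace_bound[OF _ bd _ \<tau>] by simp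
  qed
qed

text \<open>Near \<open>\<tau> = 0\<close> the derivative is expanded instead of the function: it is the transform of
  \<open>- t * spectral_density a t\<close>, whose large-\<open>t\<close> behaviour \<open>t powr (- a)\<close> gives the term
  \<open>- \<tau> powr (a - 1) / Gamma a\<close>, with a remainder \<open>O (\<tau> powr (e - 1))\<close>. Integration gives the claim
  up to the value at \<open>0\<close>, and this is \<open>1\<close> because \<open>lam\<close> times the Laplace transform of the function
  tends to \<open>1\<close> as \<open>lam\<close> tends to infinity.\<close>

lemma mittag_leffler_small:
  assumes a: "0 < a" "a < 1" and e: "a < e" "e < 1" "e \<le> 2 * a"
  obtains C where "\<And>\<tau>. \<tau> > 0 \<Longrightarrow> \<bar>mittag_leffler a \<tau> - (1 - \<tau> powr a / Gamma (1 + a))\<bar> \<le> C * \<tau> powr e"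
proof -
  define c s where "c = cos (pi * a)" and "s = sin (pi * a)"
  have s: "s > 0" unfolding s_def using a by (rule sin_pi_pos)
  have c: "\<bar>c\<bar> \<le> 1" unfolding c_def by simp
  define q where "q = (\<lambda>t. s / pi * t powr ((1 - a) - 1) - t * spectral_density a t)"
  define K where "K = 2 * 4 / s^2"
  define C where "C = s / pi * K"
  have [measurable]: "q \<in> borel_measurable borel" unfolding q_def by measurable
  have bd: "\<bar>q t\<bar> \<le> C * t powr ((1 - e) - 1)" if t: "t > 0" for t
  proof -
    define w where "w = t powr a"
    have w: "w > 0" using t by (simp add: w_def)
    have d: "spectral_denom a w > 0" using a by (rule spectral_denom_pos)
    have pw: "t * t powr (a - 1) = t powr (- a) * w^2" "t powr ((1 - a) - 1) = t powr (- a)"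
      using t powr_mult_base[of t "a - 1"] by (simp_all add: w_def powr_add[symmetric] power2_eq_square)
    have "q t = s / pi * t powr (- a) * (1 - w^2 / spectral_denom a w)"
      unfolding q_def pw(2) spectral_density_def w_def[symmetric] s_def[symmetric] using pw(1)
      by (simp add: algebra_simps)
    also have "1 - w^2 / spectral_denom a w = (1 + 2 * c * w) / spectral_denom a w"
      using d by (simp add: field_simps) (simp add: spectral_denom_def c_def)
    finally have e1: "\<bar>q t\<bar> = s / pi * t powr (- a) * \<bar>(1 + 2 * c * w) / spectral_denom a w\<bar>"
      using s by (simp add: abs_mult)
    have cw: "\<bar>1 + 2 * c * w\<bar> \<le> 1 + 2 * w"
    proof -
      have "\<bar>c * w\<bar> \<le> 1 * w" unfolding abs_mult using c w by (intro mult_mono) auto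
      then show ?thesis by (auto simp: abs_le_iff)
    qed
    have lw: "w \<le> 1 + w^2" using linear_le_square[of w] w by simp
    have k1: "\<bar>(1 + 2 * c * w) / spectral_denom a w\<bar> \<le> K"
      unfolding K_def s_def
    proof (rule spectral_denom_ratio[OF a])
      have "1 + 2 * w \<le> 4 * (1 + W)" if "0 \<le> W" "w \<le> 1 + W" for W using that by simp
      from this[OF zero_le_power2 lw] have "1 + 2 * w \<le> 4 * (1 + w^2)" .
      then show "\<bar>1 + 2 * c * w\<bar> \<le> 4 * (1 + w^2)" using cw by linarith
    qed
    have k2: "w * \<bar>(1 + 2 * c * w) / spectral_denom a w\<bar> \<le> K"
    proof -
      have "\<bar>w * (1 + 2 * c * w) / spectral_denom a w\<bar> \<le> K"
        unfolding K_def s_def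
      proof (rule spectral_denom_ratio[OF a])
        have "\<bar>w * (1 + 2 * c * w)\<bar> \<le> w * (1 + 2 * w)"
          unfolding abs_mult using cw w by simp
        also have "\<dots> = w + 2 * w^2" by (simp add: algebra_simps power2_eq_square)
        also have "w + 2 * W \<le> 4 * (1 + W)" if "0 \<le> W" "w \<le> 1 + W" for W using that by simp
        from this[OF zero_le_power2 lw] have "w + 2 * w^2 \<le> 4 * (1 + w^2)" .
        finally show "\<bar>w * (1 + 2 * c * w)\<bar> \<le> 4 * (1 + w^2)" .
      qed
      then show ?thesis using w by (simp add: abs_mult)
    qed
    \<comment> \<open>Interpolates between the bounds \<open>K\<close> and \<open>K / w\<close> so that the powers of \<open>t\<close> add up to \<open>- e\<close>.\<close>
    define th where "th = (e - a) / a"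
    have th: "0 < th" "th \<le> 1" using a e by (auto simp: th_def field_simps)
    have "\<bar>(1 + 2 * c * w) / spectral_denom a w\<bar> \<le> K * w powr (- th)"
    proof (cases "w \<le> 1")
      case True
      then have "1 \<le> w powr (- th)" using w th powr_mono2'[of "- th" w 1] by simp
      moreover have "K \<ge> 0" by (simp add: K_def)
      ultimately show ?thesis using k1 mult_left_mono[of 1 "w powr (- th)" K] by linarith
    next
      case False
      have "w powr (- 1) \<le> w powr (- th)" using False th by (intro powr_mono) auto
      moreover have "K \<ge> 0" by (simp add: K_def)
      moreover have "\<bar>(1 + 2 * c * w) / spectral_denom a w\<bar> \<le> K * w powr (- 1)"
        using k2 w by (simp add: powr_minus field_simps)
      ultimately show ?thesis using mult_left_mono[of "w powr (- 1)" "w powr (- th)" K] by linarith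
    qed
    then have "\<bar>q t\<bar> \<le> s / pi * t powr (- a) * (K * w powr (- th))"
      unfolding e1 using s by (intro mult_left_mono) auto
    also have "\<dots> = C * (t powr (- a) * w powr (- th))" by (simp add: C_def)
    also have "t powr (- a) * w powr (- th) = t powr ((1 - e) - 1)"
      using a by (simp add: w_def powr_powr powr_add[symmetric] th_def field_simps)
    finally show ?thesis .
  qed
  let ?R = "\<lambda>\<tau>. mittag_leffler a \<tau> + \<tau> powr a / Gamma (1 + a)"
  have ga: "Gamma (1 + a) = a * Gamma a" "Gamma a > 0" "Gamma (1 - a) > 0"
    using Gamma_plus1[of a] not_nonpos_Int[of a] a by (auto simp: add.commute intro: Gamma_real_pos)
  have der: "(?R has_real_derivative laplace q \<tau>) (at \<tau>)" if \<tau>: "\<tau> > 0" for \<tau>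
  proof -
    have lm: "laplaceable (\<lambda>t. t * spectral_density a t)" by (intro laplaceable_times spectral_density_laplaceable a)
    have lp: "laplaceable (\<lambda>t. s / pi * t powr ((1 - a) - 1))" using a by (intro laplace_cmult(1) laplaceable_powr) auto
    have "laplace q \<tau> = laplace (\<lambda>t. s / pi * t powr ((1 - a) - 1) + (- 1) * (t * spectral_density a t)) \<tau>"
      unfolding q_def by (intro laplace_cong) simp
    also have "\<dots> = s / pi * (Gamma (1 - a) * \<tau> powr (- (1 - a))) + (- 1) * laplace (\<lambda>t. t * spectral_density a t) \<tau>"
      unfolding laplace_add(2)[OF lp laplace_cmult(1)[OF lm] \<tau>] laplace_cmult(2)
      using laplace_powr[of "1 - a" \<tau>] a \<tau> by simp
    finally have q: "laplace q \<tau> = s / pi * (Gamma (1 - a) * \<tau> powr (a - 1)) - laplace (\<lambda>t. t * spectral_density a t) \<tau>"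
      by simp
    have "s / pi * Gamma (1 - a) = 1 / Gamma a"
      using Gamma_reflection_on_reals[of a] s ga unfolding s_def by (simp add: field_simps)
    then have "s / pi * (Gamma (1 - a) * \<tau> powr (a - 1)) = \<tau> powr (a - 1) / Gamma a"
      by (metis mult.assoc mult.left_neutral times_divide_eq_left)
    then have q': "laplace q \<tau> = \<tau> powr (a - 1) / Gamma a - laplace (\<lambda>t. t * spectral_density a t) \<tau>"
      using q by simp
    have "((\<lambda>\<tau>. \<tau> powr a / Gamma (1 + a)) has_real_derivative \<tau> powr (a - 1) / Gamma a) (at \<tau>)"
      using \<tau> a ga(1) less_imp_neq[OF ga(2)] by (auto intro!: derivative_eq_intros simp: powr_diff)
    from DERIV_add[OF laplace_deriv[OF spectral_density_laplaceable[OF a] \<tau>] this]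
    show ?thesis unfolding q' mittag_leffler_def by simp
  qed
  have "\<exists>L. \<forall>x>0. \<bar>?R x - L\<bar> \<le> C * Gamma (1 - e) / e * x powr e"
  proof (rule integrate_bound[OF der])
    show "\<bar>laplace q x\<bar> \<le> C * Gamma (1 - e) * x powr (e - 1)" if "x > 0" for x
      using laplace_bound[OF _ bd _ that] e by simp
  qed (use a e in auto)
  then obtain L where L: "\<And>x. x > 0 \<Longrightarrow> \<bar>?R x - L\<bar> \<le> C * Gamma (1 - e) / e * x powr e" by blast
  define C' where "C' = C * Gamma (1 - e) / e"
  define p where "p = (\<lambda>t. mittag_leffler a t + (1 / Gamma (1 + a) * t powr ((1 + a) - 1) + (- L) * t powr (1 - 1)))"
  have [measurable]: "p \<in> borel_measurable borel" unfolding p_def by measurable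
  have pb: "\<bar>p t\<bar> \<le> C' * t powr ((1 + e) - 1)" if "t > 0" for t
    using L[OF that] that by (simp add: p_def C'_def)
  \<comment> \<open>Compare \<open>lam\<close> times the Laplace transforms of both sides as \<open>lam\<close> tends to infinity.\<close>
  have "L = 1"
  proof -
    have B: "\<bar>1 / (1 + lam powr (- a)) + (lam powr (- a) - L)\<bar> \<le> C' * Gamma (1 + e) * lam powr (- e)" if lam: "lam > 0" for lam
    proof -
      have "laplace p lam = 1 / (lam + lam powr (1 - a)) + (lam powr (- (1 + a)) - L * lam powr (- 1))"
        unfolding p_def using a ga(1) less_imp_neq[OF ga(2)] mittag_leffler_laplace[OF a lam]
        by (subst laplace_plus_two_powers[OF mittag_leffler_laplaceable[OF a] _ _ lam]) auto
      also have "\<dots> = (1 / (1 + lam powr (- a)) + (lam powr (- a) - L)) / lam"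
      proof -
        have m: "- (1 + a) = - a - 1" by simp
        have "lam powr (1 - a) = lam * lam powr (- a)" "lam powr (- (1 + a)) = lam powr (- a) / lam"
          using lam powr_mult_base[of lam "- a"] powr_diff[of lam "- a" 1] unfolding m by simp_all
        moreover have "lam powr (- 1) = 1 / lam" using lam by (simp add: powr_minus_divide)
        moreover have "1 / (lam + lam * lam powr (- a)) = 1 / (1 + lam powr (- a)) / lam"
          by (simp add: algebra_simps)
        ultimately show ?thesis by (simp add: add_divide_distrib diff_divide_distrib)
      qed
      finally have "\<bar>1 / (1 + lam powr (- a)) + (lam powr (- a) - L)\<bar> = lam * \<bar>laplace p lam\<bar>" using lam by simp
      also have "\<dots> \<le> lam * (C' * Gamma (1 + e) * lam powr (- (1 + e)))"
        using laplace_bound[OF _ pb _ lam] lam a e by (intro mult_left_mono) auto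
      also have "\<dots> = C' * Gamma (1 + e) * lam powr (- e)"
        using powr_mult_base[of lam "- (1 + e)"] lam by simp
      finally show ?thesis .
    qed
    have ev: "\<forall>\<^sub>F lam in at_top. norm (1 / (1 + lam powr (- a)) + (lam powr (- a) - L)) \<le> C' * Gamma (1 + e) * lam powr (- e)"
      using eventually_gt_at_top[of "0 :: real"] by eventually_elim (use B in simp)
    have "((\<lambda>lam. C' * Gamma (1 + e) * lam powr (- e)) \<longlongrightarrow> 0) at_top"
      using a e by (intro tendsto_mult_right_zero tendsto_neg_powr filterlim_ident) auto
    from Lim_null_comparison[OF ev this]
    have "((\<lambda>lam. 1 / (1 + lam powr (- a)) + (lam powr (- a) - L)) \<longlongrightarrow> 0) at_top" .
    moreover have "((\<lambda>lam. lam powr (- a)) \<longlongrightarrow> 0) at_top"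
      using a by (intro tendsto_neg_powr filterlim_ident) auto
    then have "((\<lambda>lam. 1 / (1 + lam powr (- a)) + (lam powr (- a) - L)) \<longlongrightarrow> 1 / (1 + 0) + (0 - L)) at_top"
      by (intro tendsto_intros) auto
    ultimately show ?thesis using tendsto_unique[OF trivial_limit_at_top_linorder] by force
  qed
  then show ?thesis
    using L by (intro that[of C']) (simp add: C'_def algebra_simps)
qed

text \<open>The borderline exponent \<open>e = 1\<close>, excluded above, is reached for \<open>a = 1 / 2\<close>: there
  \<open>(1 + t) * spectral_density a t\<close> is a pure power, so that the derivative of the remainder is the
  function itself, which is bounded.\<close>

lemma mittag_leffler_half_small:
  obtains C where "\<And>\<tau>. \<tau> > 0 \<Longrightarrow> \<bar>mittag_leffler (1/2) \<tau> - (1 - \<tau> powr (1/2) / Gamma (3/2))\<bar> \<le> C * \<tau>"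
proof -
  obtain C where C: "\<And>\<tau>. \<tau> > 0 \<Longrightarrow> \<bar>mittag_leffler (1/2) \<tau> - (1 - \<tau> powr (1/2) / Gamma (1 + 1/2))\<bar> \<le> C * \<tau> powr (3/4)"
    using mittag_leffler_small[of "1/2" "3/4"] by auto
  obtain K where K: "\<And>\<tau>. \<tau> > 0 \<Longrightarrow> mittag_leffler (1/2) \<tau> \<le> K * \<tau> powr (- (1/2))" "K \<ge> 0" using mittag_leffler_le[of "1/2"] by auto
  have g: "Gamma (3/2 :: real) > 0" by (intro Gamma_real_pos) simp
  define B where "B = 1 + \<bar>C\<bar> + K"
  have B: "\<bar>mittag_leffler (1/2) \<tau>\<bar> \<le> B" if \<tau>: "\<tau> > 0" for \<tau>
  proof (cases "\<tau> \<le> 1")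
    case True
    have "mittag_leffler (1/2) \<tau> \<le> 1 - \<tau> powr (1/2) / Gamma (3/2) + C * \<tau> powr (3/4)" using C[OF \<tau>] by simp
    also have "\<dots> \<le> 1 + C * \<tau> powr (3/4)" using g by simp
    also have "C * \<tau> powr (3/4) \<le> \<bar>C\<bar> * 1"
      using True \<tau> by (intro mult_mono powr_le1) auto
    finally show ?thesis using mittag_leffler_nonneg[of "1/2" \<tau>] K(2) by (simp add: B_def)
  next
    case False
    have "mittag_leffler (1/2) \<tau> \<le> K * \<tau> powr (- (1/2))" by (rule K(1)[OF \<tau>])
    also have "\<dots> \<le> K * 1" using False K(2) powr_mono[of "- (1/2)" 0 \<tau>] by (intro mult_left_mono) auto
    finally show ?thesis using mittag_leffler_nonneg[of "1/2" \<tau>] by (simp add: B_def)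
  qed
  let ?R = "\<lambda>\<tau>. mittag_leffler (1/2) \<tau> + \<tau> powr (1/2) / Gamma (3/2)"
  have G1: "Gamma (1/2::real) = sqrt pi" by (rule Gamma_one_half_real)
  have G3: "Gamma (3/2::real) = sqrt pi / 2" by (rule Gamma_three_halves)
  have der: "(?R has_real_derivative mittag_leffler (1/2) \<tau>) (at \<tau>)" if \<tau>: "\<tau> > 0" for \<tau>
  proof -
    have lm: "laplaceable (\<lambda>t. t * spectral_density (1/2) t)" by (intro laplaceable_times spectral_density_laplaceable) auto
    have ld: "laplaceable (spectral_density (1/2))" by (intro spectral_density_laplaceable) auto
    have "laplace (\<lambda>t. spectral_density (1/2) t + t * spectral_density (1/2) t) \<tau> = laplace (\<lambda>t. 1 / pi * t powr (1/2 - 1)) \<tau>"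
    proof (rule laplace_cong)
      fix t :: real assume t: "t > 0"
      have "spectral_density (1/2) t + t * spectral_density (1/2) t = (1 + t) * spectral_density (1/2) t" by (simp add: algebra_simps)
      then show "spectral_density (1/2) t + t * spectral_density (1/2) t = 1 / pi * t powr (1/2 - 1)"
        using t by (simp add: spectral_density_half)
    qed
    also have "\<dots> = 1 / pi * (sqrt pi * \<tau> powr (- (1/2)))"
      unfolding laplace_cmult(2) using laplace_powr[of "1/2" \<tau>] \<tau> G1 by simp
    finally have e: "mittag_leffler (1/2) \<tau> + laplace (\<lambda>t. t * spectral_density (1/2) t) \<tau> = sqrt pi / pi * \<tau> powr (- (1/2))"
      by (simp add: laplace_add(2)[OF ld lm \<tau>] mittag_leffler_def)
    have "((\<lambda>\<tau>. \<tau> powr (1/2) / Gamma (3/2)) has_real_derivative (1/2 * \<tau> powr (1/2 - 1)) / Gamma (3/2)) (at \<tau>)"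
      using \<tau> powr_diff[of \<tau> "1/2" 1] less_imp_neq[OF g] by (auto intro!: derivative_eq_intros)
    from DERIV_add[OF laplace_deriv[OF ld \<tau>] this]
    have "(?R has_real_derivative - laplace (\<lambda>t. t * spectral_density (1/2) t) \<tau> + (1/2 * \<tau> powr (1/2 - 1)) / Gamma (3/2)) (at \<tau>)"
      unfolding mittag_leffler_def by simp
    moreover have "(1/2 * \<tau> powr (1/2 - 1)) / Gamma (3/2) = sqrt pi / pi * \<tau> powr (- (1/2))"
    proof -
      have "(1/2 * A) / (sqrt pi / 2) = sqrt pi / pi * A" for A by (simp add: field_simps)
      then show ?thesis unfolding G3 by simp
    qed
    then have "- laplace (\<lambda>t. t * spectral_density (1/2) t) \<tau> + (1/2 * \<tau> powr (1/2 - 1)) / Gamma (3/2) = mittag_leffler (1/2) \<tau>"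
      using e by linarith
    ultimately show ?thesis by (simp only:)
  qed
  have "\<exists>L. \<forall>x>0. \<bar>?R x - L\<bar> \<le> B / 1 * x powr 1"
    using B by (intro integrate_bound[OF der]) auto
  then obtain L where L: "\<And>x. x > 0 \<Longrightarrow> \<bar>?R x - L\<bar> \<le> B * x" by auto
  have "\<forall>\<^sub>F x in at_right 0. norm (1 - L) \<le> B * x + C * x powr (3/4)"
    using eventually_at_right_less[of 0]
  proof eventually_elim
    case (elim x)
    then show ?case using L[of x] C[of x] by (simp add: abs_le_iff)
  qed
  moreover have "((\<lambda>x. B * x + C * x powr (3/4)) \<longlongrightarrow> B * 0 + C * 0) (at_right 0)"
    by (intro tendsto_intros) real_asymp+
  ultimately have "((\<lambda>x::real. 1 - L) \<longlongrightarrow> 0) (at_right 0)"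
    by (intro Lim_null_comparison[where f = "\<lambda>_. 1 - L"]) auto
  then have "L = 1" by (simp add: tendsto_const_iff)
  then show ?thesis using L by (intro that[of B]) (simp add: algebra_simps)
qed

section \<open>Superpositions of heat kernels\<close>

text \<open>The substitution \<open>v = 1 / (4 * \<tau>)\<close> turns the superposition
  \<open>\<integral> (4 * pi * \<tau>) powr (- m / 2) * exp (- \<rho> / (4 * \<tau>)) * f \<tau> d\<tau>\<close> of heat kernels into the Laplace
  transform of this density. The dimension \<open>m\<close> is real because only its half enters.\<close>

definition heat_density :: "real \<Rightarrow> (real \<Rightarrow> real) \<Rightarrow> real \<Rightarrow> real" where
  "heat_density m f v = (v / pi) powr (m / 2) * f (1 / (4 * v)) / (4 * v^2)"

definition heat :: "real \<Rightarrow> (real \<Rightarrow> real) \<Rightarrow> real \<Rightarrow> real" where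
  "heat m f = laplace (heat_density m f)"

definition heat_coeff :: "real \<Rightarrow> real \<Rightarrow> real" where
  "heat_coeff m \<beta> = pi powr (- m / 2) * 4 powr (- \<beta> - 1) * Gamma (m / 2 - 1 - \<beta>)"

lemma heat_density_measurable [measurable]:
  assumes [measurable]: "f \<in> borel_measurable borel"
  shows "heat_density m f \<in> borel_measurable borel"
  unfolding heat_density_def[abs_def] by measurable

lemma heat_density_powr:
  assumes v: "v > 0"
  shows "heat_density m (\<lambda>\<tau>. \<tau> powr \<beta>) v
     = pi powr (- m / 2) * 4 powr (- \<beta> - 1) * v powr ((m / 2 - 1 - \<beta>) - 1)"
proof -
  have "(v / pi) powr (m / 2) = v powr (m / 2) * pi powr (- m / 2)"
    using v by (simp add: powr_divide powr_minus_divide)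
  moreover have "(1 / (4 * v)) powr \<beta> = 4 powr (- \<beta>) * v powr (- \<beta>)"
    using v by (simp add: powr_divide powr_mult powr_minus_divide)
  moreover have "1 / (4 * v^2) = 4 powr (- 1) * v powr (- 2)"
    using v by (simp add: powr_minus_divide powr_numeral)
  moreover have "heat_density m (\<lambda>\<tau>. \<tau> powr \<beta>) v = (v / pi) powr (m / 2) * ((1 / (4 * v)) powr \<beta>) * (1 / (4 * v^2))"
    by (simp add: heat_density_def)
  ultimately have "heat_density m (\<lambda>\<tau>. \<tau> powr \<beta>) v
     = pi powr (- m / 2) * (4 powr (- \<beta>) * 4 powr (- 1)) * (v powr (m / 2) * v powr (- \<beta>) * v powr (- 2))"
    by (simp only: mult_ac)
  moreover have "4 powr (- \<beta>) * 4 powr (- 1) = (4 :: real) powr (- \<beta> - 1)"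
    using powr_add[of "4::real" "- \<beta>" "- 1"] by simp
  moreover have "v powr (m / 2) * v powr (- \<beta>) * v powr (- 2) = v powr ((m / 2 - 1 - \<beta>) - 1)"
    by (simp add: powr_add[symmetric] algebra_simps)
  ultimately show ?thesis by (simp only:)
qed

lemma heat_density_bound:
  assumes bd: "\<And>\<tau>. \<tau> > 0 \<Longrightarrow> \<bar>f \<tau>\<bar> \<le> C * \<tau> powr \<beta>" and v: "v > 0"
  shows "\<bar>heat_density m f v\<bar> \<le> C * (pi powr (- m / 2) * 4 powr (- \<beta> - 1)) * v powr ((m / 2 - 1 - \<beta>) - 1)"
proof -
  have "\<bar>heat_density m f v\<bar> = (v / pi) powr (m / 2) * \<bar>f (1 / (4 * v))\<bar> / (4 * v^2)"
    by (simp add: heat_density_def abs_mult)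
  also have "\<dots> \<le> (v / pi) powr (m / 2) * (C * (1 / (4 * v)) powr \<beta>) / (4 * v^2)"
    using bd[of "1 / (4 * v)"] v by (intro divide_right_mono mult_left_mono) auto
  also have "\<dots> = C * heat_density m (\<lambda>\<tau>. \<tau> powr \<beta>) v" by (simp add: heat_density_def)
  finally show ?thesis using heat_density_powr[OF v, of m \<beta>] by (simp add: mult.assoc)
qed

lemma heat_laplaceable:
  assumes "f \<in> borel_measurable borel" "\<And>\<tau>. \<tau> > 0 \<Longrightarrow> \<bar>f \<tau>\<bar> \<le> C * \<tau> powr \<beta>" "m / 2 - 1 - \<beta> > 0"
  shows "laplaceable (heat_density m f)"
  using assms(1,3) by (intro laplaceable_bound[OF _ heat_density_bound[OF assms(2)]]) auto

lemma heat_bound: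
  assumes "f \<in> borel_measurable borel" "\<And>\<tau>. \<tau> > 0 \<Longrightarrow> \<bar>f \<tau>\<bar> \<le> C * \<tau> powr \<beta>" "m / 2 - 1 - \<beta> > 0" "\<rho> > 0"
  shows "\<bar>heat m f \<rho>\<bar> \<le> C * heat_coeff m \<beta> * \<rho> powr (\<beta> + 1 - m / 2)"
proof -
  have "\<bar>heat m f \<rho>\<bar> \<le> C * (pi powr (- m / 2) * 4 powr (- \<beta> - 1)) * Gamma (m / 2 - 1 - \<beta>) * \<rho> powr (- (m / 2 - 1 - \<beta>))"
    unfolding heat_def using assms(1,3,4) by (intro laplace_bound[OF _ heat_density_bound[OF assms(2)]]) auto
  moreover have "- (m / 2 - 1 - \<beta>) = \<beta> + 1 - m / 2" by simp
  ultimately show ?thesis by (simp only: heat_coeff_def mult.assoc)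
qed

lemma heat_powr:
  assumes "m / 2 - 1 - \<beta> > 0" "\<rho> > 0"
  shows "heat m (\<lambda>\<tau>. \<tau> powr \<beta>) \<rho> = heat_coeff m \<beta> * \<rho> powr (\<beta> + 1 - m / 2)"
proof -
  have "heat m (\<lambda>\<tau>. \<tau> powr \<beta>) \<rho>
     = laplace (\<lambda>v. pi powr (- m / 2) * 4 powr (- \<beta> - 1) * v powr ((m / 2 - 1 - \<beta>) - 1)) \<rho>"
    unfolding heat_def by (intro laplace_cong heat_density_powr)
  also have "\<dots> = pi powr (- m / 2) * 4 powr (- \<beta> - 1) * (Gamma (m / 2 - 1 - \<beta>) * \<rho> powr (- (m / 2 - 1 - \<beta>)))"
    unfolding laplace_cmult(2) laplace_powr[OF assms] ..
  also have "- (m / 2 - 1 - \<beta>) = \<beta> + 1 - m / 2" by simp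
  finally show ?thesis by (simp only: heat_coeff_def mult.assoc)
qed

text \<open>Up to the factor \<open>- pi\<close>, differentiating the heat kernel in \<open>\<rho>\<close> raises its dimension by \<open>2\<close>: the
  factor \<open>v\<close> that appears is absorbed by \<open>(v / pi) powr (m / 2)\<close>.\<close>

lemma heat_deriv:
  assumes "laplaceable (heat_density m f)" "\<rho> > 0"
  shows "(heat m f has_real_derivative - pi * heat (m + 2) f \<rho>) (at \<rho>)"
proof -
  have "laplace (\<lambda>v. v * heat_density m f v) \<rho> = laplace (\<lambda>v. pi * heat_density (m + 2) f v) \<rho>"
  proof (rule laplace_cong)
    fix v :: real assume v: "v > 0"
    have "(v / pi) powr ((m + 2) / 2) = (v / pi) powr (m / 2) * (v / pi)"
      using v powr_add[of "v / pi" "m / 2" 1] by (simp add: add_divide_distrib)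
    then show "v * heat_density m f v = pi * heat_density (m + 2) f v"
      by (simp add: heat_density_def)
  qed
  then show ?thesis using laplace_deriv[OF assms] by (simp add: heat_def laplace_cmult(2))
qed

text \<open>For \<open>\<beta> > - 1\<close> the function \<open>\<tau> powr \<beta> / Gamma (1 + \<beta>)\<close> has Laplace transform \<open>lam powr (- \<beta> - 1)\<close>, and \<open>kappa\<close> is the
  coefficient of the inverse Fourier transform of this power of \<open>lam = \<bar>\<xi>\<bar>\<^sup>2\<close>.\<close>

lemma heat_coeff_kappa: "heat_coeff (real n) \<beta> / Gamma (1 + \<beta>) = kappa n (2 * \<beta> + 2)"
proof -
  have "(2::real) powr (2 * \<beta> + 2) = 4 powr (\<beta> + 1)"
    using powr_powr[of 2 2 "\<beta> + 1"] by (simp add: algebra_simps)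
  moreover have "(4::real) powr (- \<beta> - 1) = 1 / 4 powr (\<beta> + 1)"
    by (metis minus_add_distrib diff_conv_add_uminus powr_minus_divide)
  moreover have "pi powr (- real n / 2) = 1 / pi powr (real n / 2)"
    by (simp add: powr_minus_divide)
  moreover have "(real n - (2 * \<beta> + 2)) / 2 = real n / 2 - 1 - \<beta>" "(2 * \<beta> + 2) / 2 = 1 + \<beta>"
    by (simp_all add: field_simps)
  ultimately show ?thesis unfolding heat_coeff_def kappa_def by (simp only:) (simp add: mult_ac)
qed

text \<open>Expansions of \<open>f\<close> are transformed term by term. The same statement serves for \<open>\<rho>\<close> near \<open>0\<close> and near
  \<open>\<infinity>\<close>; which of the two is meant is decided by the size of \<open>\<gamma>\<close> relative to \<open>\<alpha>\<close> and \<open>\<beta>\<close>. The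
  conditions on the exponents are integrability of \<open>\<tau> powr (\<alpha> - n / 2)\<close> at infinity.\<close>

lemma heat_expansion:
  fixes n :: nat
  assumes f[measurable]: "f \<in> borel_measurable borel"
    and bd: "\<And>\<tau>. \<tau> > 0 \<Longrightarrow> \<bar>f \<tau> - (A * \<tau> powr \<alpha> / Gamma (1 + \<alpha>) + B * \<tau> powr \<beta> / Gamma (1 + \<beta>))\<bar> \<le> C * \<tau> powr \<gamma>"
    and e: "\<alpha> < n / 2 - 1" "\<beta> < n / 2 - 1" "\<gamma> < n / 2 - 1"
  shows "\<exists>C'. \<forall>\<rho>>0. \<bar>heat n f \<rho> - (A * kappa n (2 * \<alpha> + 2) * \<rho> powr (\<alpha> + 1 - n / 2)
      + B * kappa n (2 * \<beta> + 2) * \<rho> powr (\<beta> + 1 - n / 2))\<bar> \<le> C' * \<rho> powr (\<gamma> + 1 - n / 2)"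
proof (intro exI allI impI)
  fix \<rho> :: real assume r: "\<rho> > 0"
  define R where "R = (\<lambda>\<tau>. f \<tau> - (A * \<tau> powr \<alpha> / Gamma (1 + \<alpha>) + B * \<tau> powr \<beta> / Gamma (1 + \<beta>)))"
  have [measurable]: "R \<in> borel_measurable borel" unfolding R_def by measurable
  have Rb: "\<And>\<tau>. \<tau> > 0 \<Longrightarrow> \<bar>R \<tau>\<bar> \<le> C * \<tau> powr \<gamma>" using bd by (simp add: R_def)
  let ?a = "heat_density n (\<lambda>\<tau>. \<tau> powr \<alpha>)" and ?b = "heat_density n (\<lambda>\<tau>. \<tau> powr \<beta>)"
  have la: "laplaceable ?a" using e by (intro heat_laplaceable[of _ 1 \<alpha>]) auto
  have lb: "laplaceable ?b" using e by (intro heat_laplaceable[of _ 1 \<beta>]) auto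
  have lr: "laplaceable (heat_density n R)" using e Rb by (intro heat_laplaceable[of _ C \<gamma>]) auto
  have "heat n f \<rho> = laplace (\<lambda>v. heat_density n R v + (A / Gamma (1 + \<alpha>) * ?a v + B / Gamma (1 + \<beta>) * ?b v)) \<rho>"
    unfolding heat_def by (intro laplace_cong) (simp add: heat_density_def R_def algebra_simps diff_divide_distrib add_divide_distrib)
  also have "\<dots> = heat n R \<rho> + (A / Gamma (1 + \<alpha>) * heat n (\<lambda>\<tau>. \<tau> powr \<alpha>) \<rho> + B / Gamma (1 + \<beta>) * heat n (\<lambda>\<tau>. \<tau> powr \<beta>) \<rho>)"
    unfolding heat_def
    by (simp only: laplace_add(2)[OF lr laplace_add(1)[OF laplace_cmult(1)[OF la] laplace_cmult(1)[OF lb]] r]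
        laplace_add(2)[OF laplace_cmult(1)[OF la] laplace_cmult(1)[OF lb] r] laplace_cmult(2))
  also have "heat n (\<lambda>\<tau>. \<tau> powr \<alpha>) \<rho> = heat_coeff n \<alpha> * \<rho> powr (\<alpha> + 1 - n / 2)"
    using e r by (intro heat_powr) auto
  also have "heat n (\<lambda>\<tau>. \<tau> powr \<beta>) \<rho> = heat_coeff n \<beta> * \<rho> powr (\<beta> + 1 - n / 2)"
    using e r by (intro heat_powr) auto
  finally have "heat n f \<rho> - (A * kappa n (2 * \<alpha> + 2) * \<rho> powr (\<alpha> + 1 - n / 2)
      + B * kappa n (2 * \<beta> + 2) * \<rho> powr (\<beta> + 1 - n / 2)) = heat n R \<rho>"
    by (simp add: heat_coeff_kappa[symmetric])
  moreover have "\<bar>heat n R \<rho>\<bar> \<le> C * heat_coeff n \<gamma> * \<rho> powr (\<gamma> + 1 - n / 2)"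
    using e r by (intro heat_bound Rb) auto
  ultimately show "\<bar>heat n f \<rho> - (A * kappa n (2 * \<alpha> + 2) * \<rho> powr (\<alpha> + 1 - n / 2)
      + B * kappa n (2 * \<beta> + 2) * \<rho> powr (\<beta> + 1 - n / 2))\<bar> \<le> (C * heat_coeff n \<gamma>) * \<rho> powr (\<gamma> + 1 - n / 2)"
    by simp
qed

text \<open>Together with \<open>heat_deriv\<close> this matches the expansion of the gradient with the derivative of the
  expansion.\<close>

lemma kappa_add_2:
  assumes "real n - \<alpha> > - 2" "real n \<noteq> \<alpha>"
  shows "2 * pi * kappa (n + 2) \<alpha> = (real n - \<alpha>) * kappa n \<alpha>"
proof -
  have "(real n - \<alpha>) / 2 \<notin> \<int>\<^sub>\<le>\<^sub>0" using assms by (intro not_nonpos_Int) auto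
  then have g: "Gamma ((real n - \<alpha>) / 2 + 1) = (real n - \<alpha>) / 2 * Gamma ((real n - \<alpha>) / 2)" by (rule Gamma_plus1)
  have "(real (n + 2) - \<alpha>) / 2 = (real n - \<alpha>) / 2 + 1" by (simp add: field_simps)
  moreover have "pi powr (real (n + 2) / 2) = pi powr (real n / 2) * pi"
    using powr_add[of pi 1 "real n / 2"] by (simp add: add_divide_distrib add.commute mult.commute)
  ultimately have "kappa (n + 2) \<alpha> = (real n - \<alpha>) / 2 * Gamma ((real n - \<alpha>) / 2)
      / (2 powr \<alpha> * (pi powr (real n / 2) * pi) * Gamma (\<alpha> / 2))"
    unfolding kappa_def by (simp only: g)
  then show ?thesis by (simp add: kappa_def)
qed

lemma kappa_add_2_two:
  assumes "n > 0"
  shows "2 * pi * kappa (n + 2) 2 = 1 / sphere_area n"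
proof -
  have "pi powr (real (n + 2) / 2) = pi powr (real n / 2) * pi"
    using powr_add[of pi 1 "real n / 2"] by (simp add: add_divide_distrib add.commute mult.commute)
  then show ?thesis by (simp add: kappa_def sphere_area_def powr_numeral)
qed

lemma kappa_two:
  assumes "n \<ge> 3"
  shows "kappa n 2 = 1 / ((real n - 2) * sphere_area n)"
proof -
  have "1 / sphere_area n = (real n - 2) * kappa n 2"
    using kappa_add_2_two[of n] kappa_add_2[of n 2] assms by simp
  moreover have "real n - 2 \<noteq> 0" using assms by simp
  ultimately show ?thesis by (metis divide_divide_eq_left' mult.commute nonzero_mult_div_cancel_left)
qed

section \<open>Gaussian integrals on Euclidean space\<close>

text \<open>A rescaling of the characteristic function of the standard normal distribution.\<close>

lemma gauss_fourier_line:
  fixes \<tau> y :: real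
  assumes t: "\<tau> > 0"
  shows "has_bochner_integral lborel (\<lambda>x. complex_of_real (exp (- (\<tau> * x^2))) * exp (\<i> * complex_of_real (x * y)))
     (complex_of_real (sqrt (pi / \<tau>) * exp (- (y^2 / (4 * \<tau>)))))"
proof -
  \<comment> \<open>Turns the exponent \<open>- (c * x)\<^sup>2 / 2\<close> of the normal density into \<open>- (\<tau> * x\<^sup>2)\<close>.\<close>
  define c where "c = sqrt (2 * \<tau>)"
  have c: "c > 0" "c^2 = 2 * \<tau>" using t by (simp_all add: c_def)
  interpret std: real_distribution std_normal_distribution by (rule real_dist_normal_dist)
  let ?g = "\<lambda>x. std_normal_density x *\<^sub>R iexp (y / c * x)"
  have [measurable]: "(\<lambda>x. iexp (y / c * x)) \<in> borel_measurable borel"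
    by (intro borel_measurable_continuous_onI continuous_intros)
  have "integrable std_normal_distribution (\<lambda>x. iexp (y / c * x))"
    by (rule std.integrable_const_bound[where B = 1]) auto
  then have i: "integrable lborel ?g"
    by (subst (asm) integrable_density) (auto simp: normal_density_nonneg)
  have "char std_normal_distribution (y / c) = integral\<^sup>L lborel ?g"
    unfolding char_def by (subst integral_density) (auto simp: normal_density_nonneg)
  then have v: "integral\<^sup>L lborel ?g = complex_of_real (exp (- ((y / c)^2) / 2))"
    by (simp add: char_std_normal_distribution)
  have "has_bochner_integral lborel (\<lambda>x. ?g (0 + c * x)) (complex_of_real (exp (- ((y / c)^2) / 2)) /\<^sub>R \<bar>c\<bar>)"
    using i v c by (subst lborel_has_bochner_integral_real_affine_iff[symmetric]) (auto simp: has_bochner_integral_iff)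
  then have "has_bochner_integral lborel (\<lambda>x. complex_of_real (sqrt (2 * pi)) * ?g (0 + c * x))
       (complex_of_real (sqrt (2 * pi)) * (complex_of_real (exp (- ((y / c)^2) / 2)) /\<^sub>R \<bar>c\<bar>))"
    by (rule has_bochner_integral_mult_right) 
  moreover have "complex_of_real (sqrt (2 * pi)) * ?g (0 + c * x) = complex_of_real (exp (- (\<tau> * x^2))) * exp (\<i> * complex_of_real (x * y))" for x
  proof -
    have e: "- (c * x)\<^sup>2 / 2 = - (\<tau> * x^2)" using c by (simp add: power_mult_distrib)
    have s: "complex_of_real (sqrt (2 * pi)) * complex_of_real (1 / sqrt (2 * pi)) = 1"
      by (simp flip: of_real_mult)
    have f: "y / c * (c * x) = x * y" using c by simp
    have "complex_of_real (sqrt (2 * pi)) * ?g (0 + c * x) = (complex_of_real (sqrt (2 * pi)) * complex_of_real (1 / sqrt (2 * pi))) *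
       (complex_of_real (exp (- (\<tau> * x^2))) * iexp (x * y))"
      unfolding std_normal_density_def scaleR_conv_of_real add_0 e f of_real_mult by (simp only: mult_ac)
    then show ?thesis unfolding s by simp
  qed
  moreover have "complex_of_real (sqrt (2 * pi)) * (complex_of_real (exp (- ((y / c)^2) / 2)) /\<^sub>R \<bar>c\<bar>)
     = complex_of_real (sqrt (pi / \<tau>) * exp (- (y^2 / (4 * \<tau>))))"
  proof -
    have "sqrt (2 * pi) / c = sqrt (pi / \<tau>)" using t by (simp add: c_def real_sqrt_divide[symmetric])
    moreover have "- ((y / c)^2) / 2 = - (y^2 / (4 * \<tau>))" using c by (simp add: power_divide)
    moreover have "complex_of_real (sqrt (2 * pi)) * (complex_of_real (exp (- ((y / c)^2) / 2)) /\<^sub>R \<bar>c\<bar>)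
      = complex_of_real (sqrt (2 * pi) / c * exp (- ((y / c)^2) / 2))"
      using c by (simp add: scaleR_conv_of_real field_simps)
    ultimately show ?thesis by simp
  qed
  ultimately show ?thesis by simp
qed

lemma has_bochner_integral_lborel_prod:
  fixes g :: "'a::euclidean_space \<Rightarrow> real \<Rightarrow> 'b::{real_normed_field, banach, second_countable_topology}"
  assumes g: "\<And>b. b \<in> Basis \<Longrightarrow> has_bochner_integral lborel (g b) (I b)"
  shows "has_bochner_integral lborel (\<lambda>x::'a. \<Prod>b\<in>Basis. g b (x \<bullet> b)) (\<Prod>b\<in>Basis. I b)"
proof -
  interpret P: product_sigma_finite "\<lambda>_::'a. lborel :: real measure" by standard
  let ?P = "Pi\<^sub>M (Basis :: 'a set) (\<lambda>_. lborel :: real measure)"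
  let ?s = "\<lambda>f::'a \<Rightarrow> real. \<Sum>b\<in>Basis. f b *\<^sub>R b"
  have s[measurable]: "?s \<in> measurable ?P borel" by measurable
  have m[measurable]: "g b \<in> borel_measurable borel" if "b \<in> Basis" for b
    using borel_measurable_has_bochner_integral[OF g[OF that]] by simp
  have M: "(\<lambda>x::'a. \<Prod>b\<in>Basis. g b (x \<bullet> b)) \<in> borel_measurable borel"
    by (intro borel_measurable_prod measurable_compose[OF _ m]) auto
  have e: "(\<Prod>b\<in>Basis. g b (?s f \<bullet> b)) = (\<Prod>b\<in>Basis. g b (f b))" for f
    by (intro prod.cong refl) (simp add: inner_sum_left_Basis)
  have i: "integrable ?P (\<lambda>f. \<Prod>b\<in>Basis. g b (f b))"
    using g by (intro P.product_integrable_prod) (auto simp: has_bochner_integral_iff)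
  have v: "(\<integral>f. (\<Prod>b\<in>Basis. g b (f b)) \<partial>?P) = (\<Prod>b\<in>Basis. I b)"
    using g by (subst P.product_integral_prod) (auto simp: has_bochner_integral_iff)
  show ?thesis
    unfolding has_bochner_integral_iff
  proof
    show "integrable lborel (\<lambda>x::'a. \<Prod>b\<in>Basis. g b (x \<bullet> b))"
      by (subst lborel_eq) (simp add: integrable_distr_eq[OF s M] e i)
    show "integral\<^sup>L lborel (\<lambda>x::'a. \<Prod>b\<in>Basis. g b (x \<bullet> b)) = (\<Prod>b\<in>Basis. I b)"
      by (subst lborel_eq) (simp add: integral_distr[OF s M] e v)
  qed
qed

lemma gauss_fourier:
  fixes y :: "'a::euclidean_space"
  assumes t: "\<tau> > 0"
  shows "has_bochner_integral lborel (\<lambda>x. complex_of_real (exp (- (\<tau> * (norm x)^2))) * exp (\<i> * complex_of_real (x \<bullet> y)))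
     (complex_of_real ((pi / \<tau>) powr (DIM('a) / 2) * exp (- ((norm y)^2 / (4 * \<tau>)))))"
proof -
  let ?g = "\<lambda>b x. complex_of_real (exp (- (\<tau> * x^2))) * exp (\<i> * complex_of_real (x * (y \<bullet> b)))"
  have n2: "(norm x)^2 = (\<Sum>b\<in>Basis. (x \<bullet> b)^2)" for x :: 'a
    unfolding power2_norm_eq_inner by (subst euclidean_inner) (simp add: power2_eq_square)
  have "(\<Prod>b\<in>Basis. ?g b (x \<bullet> b)) = complex_of_real (exp (- (\<tau> * (norm x)^2))) * exp (\<i> * complex_of_real (x \<bullet> y))" for x
    by (simp add: prod.distrib n2 euclidean_inner[of x y] exp_sum[symmetric] sum_distrib_left sum_negf[symmetric]
        flip: of_real_prod)
  moreover have "(\<Prod>b\<in>(Basis::'a set). complex_of_real (sqrt (pi / \<tau>) * exp (- ((y \<bullet> b)^2 / (4 * \<tau>)))))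
     = complex_of_real ((pi / \<tau>) powr (DIM('a) / 2) * exp (- ((norm y)^2 / (4 * \<tau>))))"
  proof -
    have "(\<Prod>b\<in>(Basis::'a set). sqrt (pi / \<tau>)) = (pi / \<tau>) powr (DIM('a) / 2)"
      using t by (simp add: powr_half_sqrt[symmetric] powr_power)
    moreover have "(\<Prod>b\<in>(Basis::'a set). exp (- ((y \<bullet> b)^2 / (4 * \<tau>)))) = exp (- ((norm y)^2 / (4 * \<tau>)))"
      by (simp add: exp_sum[symmetric] n2 sum_negf sum_divide_distrib)
    ultimately show ?thesis by (simp add: prod.distrib flip: of_real_prod of_real_power)
  qed
  ultimately show ?thesis
    using has_bochner_integral_lborel_prod[of ?g "\<lambda>b. complex_of_real (sqrt (pi / \<tau>) * exp (- ((y \<bullet> b)^2 / (4 * \<tau>))))", OF gauss_fourier_line[OF t]]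
    by simp
qed

lemma gauss_integral:
  assumes t: "\<tau> > 0"
  shows "has_bochner_integral lborel (\<lambda>x::'a::euclidean_space. exp (- (\<tau> * (norm x)^2))) ((pi / \<tau>) powr (DIM('a) / 2))"
proof -
  have "has_bochner_integral lborel (\<lambda>x::'a. complex_of_real (exp (- (\<tau> * (norm x)^2)))) (complex_of_real ((pi / \<tau>) powr (DIM('a) / 2)))"
    using gauss_fourier[OF t, of "0::'a"] by simp
  from has_bochner_integral_bounded_linear[OF bounded_linear_Re this] show ?thesis by simp
qed

lemma integrable_inverse_1_plus_square_line: "integrable lborel (\<lambda>x::real. 1 / (1 + x^2))"
proof -
  have "integrable lborel (\<lambda>x::real. indicator {0<..} x * (1 / (1 + x^2)))"
    using integrable_I0i_1_div_plus_square
    by (simp add: interval_lebesgue_integrable_def zero_ereal_def set_integrable_def)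
  then have h: "integrable lborel (\<lambda>x::real. indicator {0<..} (0 + c * x) * (1 / (1 + (0 + c * x)^2)))" if "c \<noteq> 0" for c
    using that by (rule lborel_integrable_real_affine)
  have "integrable lborel (\<lambda>x::real. indicator {0<..} x * (1 / (1 + x^2)) + indicator {0<..} (- x) * (1 / (1 + x^2)))"
    using h[of 1] h[of "- 1"] by (intro Bochner_Integration.integrable_add) simp_all
  then show ?thesis
  proof (rule integrable_cong_AE_imp)
    show "AE x :: real in lborel. indicator {0<..} x * (1 / (1 + x^2)) + indicator {0<..} (- x) * (1 / (1 + x^2)) = 1 / (1 + x^2)"
      by (rule AE_mp[OF AE_lborel_singleton[of "0::real"]]) (auto intro!: AE_I2 simp: indicator_def)
  qed simp
qed

text \<open>A power of \<open>1 + (norm x)\<^sup>2\<close> whose reciprocal is integrable for the simple reason that it lies below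
  the product over the coordinates of \<open>1 / (1 + x\<^sub>i\<^sup>2)\<close>.\<close>

definition weight :: "'a::euclidean_space \<Rightarrow> real" where
  "weight x = (1 + (norm x)^2) ^ DIM('a)"

lemma weight_pos: "weight x > 0" and weight_ge_1: "weight x \<ge> 1"
  by (simp_all add: weight_def add_pos_nonneg)

lemma weight_measurable [measurable]: "weight \<in> borel_measurable borel"
  unfolding weight_def[abs_def] by measurable

lemma integrable_inverse_weight: "integrable lborel (\<lambda>x::'a::euclidean_space. 1 / weight x)"
proof (rule Bochner_Integration.integrable_bound)
  show "integrable lborel (\<lambda>x::'a. \<Prod>b\<in>Basis. 1 / (1 + (x \<bullet> b)^2))"
    using has_bochner_integral_lborel_prod[of "\<lambda>_::'a. \<lambda>x::real. 1 / (1 + x^2)"] integrable_inverse_1_plus_square_line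
    by (auto simp: has_bochner_integral_iff)
  have "1 / weight x \<le> (\<Prod>b\<in>Basis. 1 / (1 + (x \<bullet> b)^2))" for x :: 'a
  proof -
    have "(\<Prod>b\<in>(Basis :: 'a set). 1 / (1 + (norm x)^2)) \<le> (\<Prod>b\<in>Basis. 1 / (1 + (x \<bullet> b)^2))"
    proof (rule prod_mono)
      fix b :: 'a assume "b \<in> Basis"
      then have "(x \<bullet> b)^2 \<le> (norm x)^2" using Basis_le_norm[of b x] by (simp add: abs_le_square_iff[symmetric])
      then show "0 \<le> 1 / (1 + (norm x)^2) \<and> 1 / (1 + (norm x)^2) \<le> 1 / (1 + (x \<bullet> b)^2)"
        by (auto intro!: divide_left_mono mult_pos_pos add_pos_nonneg)
    qed
    then show ?thesis by (simp add: weight_def power_divide)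
  qed
  moreover have "norm (1 / weight x) = 1 / weight x" for x :: 'a
    using weight_pos[of x] by simp
  ultimately show "AE x in lborel. norm (1 / weight x) \<le> norm (\<Prod>b\<in>(Basis :: 'a set). 1 / (1 + (x \<bullet> b)^2))"
    by (intro AE_I2) (metis order_trans abs_ge_self real_norm_def)
qed simp

lemma lborel_integral_translate:
  fixes f :: "'a::euclidean_space \<Rightarrow> 'b::{banach, second_countable_topology}"
  assumes f: "f \<in> borel_measurable borel"
  shows "integrable lborel (\<lambda>x. f (c + x)) \<longleftrightarrow> integrable lborel f"
    and "integral\<^sup>L lborel (\<lambda>x. f (c + x)) = integral\<^sup>L lborel f"
proof -
  have "integrable (distr lborel borel ((+) c)) f \<longleftrightarrow> integrable lborel (\<lambda>x. f (c + x))"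
    using f by (intro integrable_distr_eq) auto
  then show "integrable lborel (\<lambda>x. f (c + x)) \<longleftrightarrow> integrable lborel f" by (simp add: lborel_distr_plus)
  have "integral\<^sup>L (distr lborel borel ((+) c)) f = integral\<^sup>L lborel (\<lambda>x. f (c + x))"
    using f by (intro integral_distr) auto
  then show "integral\<^sup>L lborel (\<lambda>x. f (c + x)) = integral\<^sup>L lborel f" by (simp add: lborel_distr_plus)
qed

lemma lborel_integral_affine:
  fixes f :: "'a::euclidean_space \<Rightarrow> 'b::{banach, second_countable_topology}"
  assumes f: "f \<in> borel_measurable borel" and c: "c \<noteq> 0"
  shows "integral\<^sup>L lborel f = \<bar>c\<bar> ^ DIM('a) *\<^sub>R integral\<^sup>L lborel (\<lambda>x. f (t + c *\<^sub>R x))"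
proof -
  have [measurable]: "f \<in> borel_measurable borel" by fact
  have "integral\<^sup>L lborel f = integral\<^sup>L (density (distr lborel borel (\<lambda>x. t + c *\<^sub>R x)) (\<lambda>_. ennreal (\<bar>c\<bar> ^ DIM('a)))) f"
    using lborel_affine[of c t] c by (simp add: ennreal_power)
  also have "\<dots> = integral\<^sup>L (distr lborel borel (\<lambda>x. t + c *\<^sub>R x)) (\<lambda>x. \<bar>c\<bar> ^ DIM('a) *\<^sub>R f x)"
    using c by (subst integral_density) auto
  also have "\<dots> = integral\<^sup>L lborel (\<lambda>x. \<bar>c\<bar> ^ DIM('a) *\<^sub>R f (t + c *\<^sub>R x))"
    by (subst integral_distr) auto
  finally show ?thesis by simp
qed

section \<open>Fourier transforms of Schwartz functions\<close>

lemma smooth_on_UNIV_differentiable: "smooth_on UNIV \<phi> \<Longrightarrow> iter_partial is \<phi> differentiable (at x)"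
  by (auto simp: smooth_on_def)

lemma iter_partial_append: "iter_partial is (iter_partial js f) = iter_partial (is @ js) f"
  by (induction "is") auto

lemma smooth_on_iter_partial: "smooth_on S \<phi> \<Longrightarrow> smooth_on S (iter_partial is \<phi>)"
  by (auto simp: smooth_on_def iter_partial_append)

lemma schwartz_iter_partial: "schwartz \<phi> \<Longrightarrow> schwartz (iter_partial is \<phi>)"
  by (auto simp: schwartz_def smooth_on_iter_partial iter_partial_append)

lemma schwartz_continuous: "schwartz \<phi> \<Longrightarrow> continuous_on UNIV (iter_partial is \<phi>)"
  using smooth_on_UNIV_differentiable[of \<phi>]
  by (auto simp: schwartz_def continuous_on_eq_continuous_at intro: differentiable_imp_continuous_within)

lemma schwartz_measurable: "schwartz \<phi> \<Longrightarrow> iter_partial is \<phi> \<in> borel_measurable borel"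
  by (intro borel_measurable_continuous_onI schwartz_continuous)

lemma schwartz_norm_ge:
  fixes \<phi> :: "real^'n::finite \<Rightarrow> complex"
  assumes \<phi>: "schwartz \<phi>" and k: "k \<le> N" and l: "length is \<le> N"
  shows "norm x ^ k * norm (iter_partial is \<phi> x) \<le> schwartz_norm N \<phi>"
proof -
  have bdd: "bdd_above (range (\<lambda>x. norm x ^ k * norm (iter_partial is \<phi> x)))" for k "is"
  proof -
    have "bounded (range (\<lambda>x. norm x ^ k *\<^sub>R iter_partial is \<phi> x))" using \<phi> by (auto simp: schwartz_def)
    then obtain B where "\<And>x. norm (norm x ^ k *\<^sub>R iter_partial is \<phi> x) \<le> B" by (auto simp: bounded_iff)
    then show ?thesis by (intro bdd_aboveI[of _ B]) auto
  qed
  have le: "norm x ^ k * norm (iter_partial is \<phi> x) \<le> (SUP x. norm x ^ k * norm (iter_partial is \<phi> x))" for k "is" x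
    by (intro cSUP_upper bdd) auto
  have nn: "0 \<le> (SUP x. norm x ^ k * norm (iter_partial is \<phi> x))" for k "is"
    by (rule order_trans[OF _ le[where x = 0]]) auto
  have fin: "finite {is :: 'n list. length is \<le> N}"
    using finite_lists_length_le[of "UNIV :: 'n set" N] by simp
  have "norm x ^ k * norm (iter_partial is \<phi> x) \<le> (SUP x. norm x ^ k * norm (iter_partial is \<phi> x))" by (rule le)
  also have "\<dots> \<le> (\<Sum>is\<in>{is. length is \<le> N}. SUP x. norm x ^ k * norm (iter_partial is \<phi> x))"
    using fin l nn by (intro member_le_sum) auto
  also have "\<dots> \<le> (\<Sum>k\<le>N. \<Sum>is\<in>{is. length is \<le> N}. SUP x. norm x ^ k * norm (iter_partial is \<phi> x))"
    using k nn by (intro member_le_sum[where f = "\<lambda>k. \<Sum>is\<in>{is. length is \<le> N}. SUP x. norm x ^ k * norm (iter_partial is \<phi> x)"] sum_nonneg) auto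
  finally show ?thesis by (simp add: schwartz_norm_def)
qed

lemma weight_le: "weight (x :: 'a::euclidean_space) \<le> 2 ^ DIM('a) * (1 + norm x ^ (2 * DIM('a)))"
proof (cases "norm x \<le> 1")
  case True
  have "(1 + (norm x)^2) ^ DIM('a) \<le> 2 ^ DIM('a)"
    using True by (intro power_mono) (auto simp: power_le_one)
  also have "\<dots> \<le> 2 ^ DIM('a) * (1 + norm x ^ (2 * DIM('a)))" by simp
  finally show ?thesis by (simp add: weight_def)
next
  case False
  then have "1 \<le> (norm x)^2" by simp
  then have "(1 + (norm x)^2) ^ DIM('a) \<le> (2 * (norm x)^2) ^ DIM('a)"
    by (intro power_mono) (auto simp: add_nonneg_nonneg)
  also have "\<dots> = 2 ^ DIM('a) * norm x ^ (2 * DIM('a))" by (simp add: power_mult_distrib power_mult)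
  also have "\<dots> \<le> 2 ^ DIM('a) * (1 + norm x ^ (2 * DIM('a)))" by (intro mult_left_mono) auto
  finally show ?thesis by (simp add: weight_def)
qed

lemma schwartz_weight_bound:
  fixes \<phi> :: "real^'n::finite \<Rightarrow> complex"
  assumes \<phi>: "schwartz \<phi>" and N: "2 * CARD('n) \<le> N" and l: "length is \<le> N"
  shows "weight x * norm (iter_partial is \<phi> x) \<le> 2 ^ (CARD('n) + 1) * schwartz_norm N \<phi>"
proof -
  have "weight x * norm (iter_partial is \<phi> x) \<le> 2 ^ CARD('n) * (1 + norm x ^ (2 * CARD('n))) * norm (iter_partial is \<phi> x)"
    using weight_le[of x] by (intro mult_right_mono) auto
  also have "\<dots> = 2 ^ CARD('n) * (norm x ^ 0 * norm (iter_partial is \<phi> x) + norm x ^ (2 * CARD('n)) * norm (iter_partial is \<phi> x))"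
    by (simp add: algebra_simps)
  also have "\<dots> \<le> 2 ^ CARD('n) * (schwartz_norm N \<phi> + schwartz_norm N \<phi>)"
    using N l by (intro mult_left_mono add_mono schwartz_norm_ge \<phi>) auto
  finally show ?thesis by simp
qed

lemma schwartz_norm_nonneg: "schwartz \<phi> \<Longrightarrow> 0 \<le> schwartz_norm N \<phi>"
  using schwartz_norm_ge[of \<phi> 0 N "[]" 0] by (simp add: order_trans[OF norm_ge_zero])

lemma schwartz_le_inverse_weight:
  fixes \<phi> :: "real^'n::finite \<Rightarrow> complex"
  assumes "schwartz \<phi>" "2 * CARD('n) \<le> N" "length is \<le> N"
  shows "norm (iter_partial is \<phi> x) \<le> 2 ^ (CARD('n) + 1) * schwartz_norm N \<phi> * (1 / weight x)"
  using schwartz_weight_bound[OF assms, of x] weight_pos[of x] by (simp add: field_simps)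

lemma integrable_le_inverse_weight:
  fixes f :: "'a::euclidean_space \<Rightarrow> 'b::{banach, second_countable_topology}"
  assumes "f \<in> borel_measurable borel" and bd: "\<And>x. norm (f x) \<le> C * (1 / weight x)"
  shows "integrable lborel f" "norm (integral\<^sup>L lborel f) \<le> C * (LINT x|lborel. 1 / weight (x :: 'a))"
proof -
  have i: "integrable lborel (\<lambda>x::'a. C * (1 / weight x))"
    by (intro integrable_mult_right integrable_inverse_weight)
  show f: "integrable lborel f"
    using assms(1) order_trans[OF bd abs_ge_self] by (intro Bochner_Integration.integrable_bound[OF i]) auto
  have "norm (integral\<^sup>L lborel f) \<le> (LINT x|lborel. norm (f x))" by (rule integral_norm_bound)
  also have "\<dots> \<le> (LINT x|lborel. C * (1 / weight (x :: 'a)))"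
    using f bd by (intro integral_mono i integrable_norm)
  also have "\<dots> = C * (LINT x|lborel. 1 / weight (x :: 'a))" by (rule integral_mult_right_zero)
  finally show "norm (integral\<^sup>L lborel f) \<le> C * (LINT x|lborel. 1 / weight (x :: 'a))" .
qed

lemma schwartz_integrable:
  fixes \<phi> :: "real^'n::finite \<Rightarrow> complex"
  shows "schwartz \<phi> \<Longrightarrow> integrable lborel (iter_partial is \<phi>)"
  by (intro integrable_le_inverse_weight(1)[OF schwartz_measurable schwartz_le_inverse_weight[where N = "max (2 * CARD('n)) (length is)"]]) auto

lemma fourier_kernel_measurable [measurable]: "(\<lambda>x. exp (- (\<i> * complex_of_real (x \<bullet> \<xi>)))) \<in> borel_measurable borel"
  by (intro borel_measurable_continuous_onI continuous_intros)

lemma norm_fourier_kernel [simp]: "norm (exp (- (\<i> * complex_of_real t))) = 1"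
  by (simp add: norm_exp_eq_Re)

lemma fourier_integrable:
  assumes f: "integrable lborel f"
  shows "integrable lborel (\<lambda>x. exp (- (\<i> * complex_of_real (x \<bullet> \<xi>))) * f x)"
proof (rule Bochner_Integration.integrable_bound[OF f])
  have [measurable]: "f \<in> borel_measurable borel" using borel_measurable_integrable[OF f] by simp
  show "(\<lambda>x. exp (- (\<i> * complex_of_real (x \<bullet> \<xi>))) * f x) \<in> borel_measurable lborel" by measurable
qed (simp add: norm_mult)

lemma norm_fourier_le:
  fixes \<phi> :: "real^'n::finite \<Rightarrow> complex"
  assumes \<phi>: "schwartz \<phi>" and N: "2 * CARD('n) \<le> N" and l: "length is \<le> N"
  shows "norm (fourier (iter_partial is \<phi>) \<xi>) \<le> 2 ^ (CARD('n) + 1) * schwartz_norm N \<phi> * (LINT x|lborel. 1 / weight (x :: real^'n))"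
proof -
  have [measurable]: "iter_partial is \<phi> \<in> borel_measurable borel" by (rule schwartz_measurable[OF \<phi>])
  show ?thesis
    unfolding fourier_def using schwartz_le_inverse_weight[OF assms]
    by (intro integrable_le_inverse_weight(2)) (measurable, simp add: norm_mult)
qed

lemma partial_eq_derivative:
  fixes f :: "real^'n::finite \<Rightarrow> 'b::real_normed_vector"
  assumes "(f has_derivative D) (at x)"
  shows "partial i f x = D (axis i 1)"
proof -
  have a: "((\<lambda>u. x + u *\<^sub>R axis i (1::real)) has_derivative (\<lambda>u. u *\<^sub>R axis i 1)) (at 0)"
    by (auto intro!: derivative_eq_intros)
  have "((\<lambda>u. f (x + u *\<^sub>R axis i 1)) has_derivative (\<lambda>u. D (u *\<^sub>R axis i 1))) (at 0)"
    using diff_chain_at[OF a, of f D] assms by (simp add: o_def)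
  then have "((\<lambda>u. f (x + u *\<^sub>R axis i 1)) has_vector_derivative D (axis i 1)) (at 0)"
    by (simp add: has_vector_derivative_def linear_cmul[OF has_derivative_linear[OF assms]])
  then show ?thesis unfolding partial_def by (rule vector_derivative_at)
qed

lemma has_vector_derivative_partial:
  fixes \<phi> :: "real^'n::finite \<Rightarrow> 'b::real_normed_vector"
  assumes d: "\<phi> differentiable (at (x + t *\<^sub>R axis i 1))"
  shows "((\<lambda>t. \<phi> (x + t *\<^sub>R axis i 1)) has_vector_derivative partial i \<phi> (x + t *\<^sub>R axis i 1)) (at t)"
proof -
  obtain D where D: "(\<phi> has_derivative D) (at (x + t *\<^sub>R axis i 1))" using d by (auto simp: differentiable_def)
  have "((\<lambda>u. x + u *\<^sub>R axis i (1::real)) has_derivative (\<lambda>u. u *\<^sub>R axis i 1)) (at t)"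
    by (auto intro!: derivative_eq_intros)
  from diff_chain_at[OF this D] show ?thesis
    by (simp add: o_def has_vector_derivative_def partial_eq_derivative[OF D] linear_cmul[OF has_derivative_linear[OF D]])
qed

lemma tendsto_compose_sequence_at_0:
  fixes X :: "nat \<Rightarrow> 'a::real_normed_vector"
  assumes f: "(f \<longlongrightarrow> l) (at 0)" and X: "X \<longlonglongrightarrow> 0" "\<And>k. X k \<noteq> 0"
  shows "(\<lambda>k. f (X k)) \<longlonglongrightarrow> l"
proof (rule filterlim_compose[OF f])
  show "filterlim X (at 0) sequentially" using X by (auto simp: filterlim_at)
qed

lemma has_vector_derivative_difference_quotient:
  fixes f :: "real \<Rightarrow> 'b::real_normed_vector"
  assumes "(f has_vector_derivative D) (at x)"
  shows "((\<lambda>h. (f (x + h) - f x) /\<^sub>R h) \<longlongrightarrow> D) (at 0)"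
proof -
  have "((\<lambda>h. norm (f (x + h) - f x - h *\<^sub>R D) / norm h) \<longlongrightarrow> 0) (at 0)"
    using assms by (simp add: has_vector_derivative_def has_derivative_at)
  moreover have "\<forall>\<^sub>F h in at 0. norm (f (x + h) - f x - h *\<^sub>R D) / norm h = norm ((f (x + h) - f x) /\<^sub>R h - D)"
  proof (rule eventually_at_filter[THEN iffD2, OF always_eventually], intro allI impI)
    fix h :: real assume h: "h \<noteq> 0"
    then have "f (x + h) - f x - h *\<^sub>R D = h *\<^sub>R ((f (x + h) - f x) /\<^sub>R h - D)" by (simp add: scaleR_diff_right)
    then show "norm (f (x + h) - f x - h *\<^sub>R D) / norm h = norm ((f (x + h) - f x) /\<^sub>R h - D)" using h by simp
  qed
  ultimately have "((\<lambda>h. norm ((f (x + h) - f x) /\<^sub>R h - D)) \<longlongrightarrow> 0) (at 0)"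
    by (rule Lim_transform_eventually)
  then show ?thesis by (simp add: tendsto_norm_zero_iff LIM_zero_iff)
qed

text \<open>Integration by parts without boundary terms or slicing: for each step \<open>h\<close> the transform of the
  difference quotient in direction \<open>i\<close> is \<open>(exp (\<i> * h * \<xi>\<^sub>i) - 1) / h\<close> times the transform of \<open>\<phi>\<close>, by
  translation invariance, and \<open>h \<longlonglongrightarrow> 0\<close> under the integral.\<close>

lemma fourier_partial:
  fixes \<phi> :: "real^'n::finite \<Rightarrow> complex"
  assumes \<phi>: "schwartz \<phi>"
  shows "fourier (partial i \<phi>) \<xi> = \<i> * complex_of_real (\<xi> $ i) * fourier \<phi> \<xi>"
proof -
  let ?e = "axis i 1 :: real^'n"
  let ?K = "\<lambda>x. exp (- (\<i> * complex_of_real (x \<bullet> \<xi>)))"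
  have p: "partial i \<phi> = iter_partial [i] \<phi>" by simp
  have sp: "schwartz (partial i \<phi>)" unfolding p by (rule schwartz_iter_partial[OF \<phi>])
  have [measurable]: "\<phi> \<in> borel_measurable borel" "partial i \<phi> \<in> borel_measurable borel"
    using schwartz_measurable[OF \<phi>, of "[]"] schwartz_measurable[OF sp, of "[]"] by simp_all
  have ip: "integrable lborel \<phi>" using schwartz_integrable[OF \<phi>, of "[]"] by simp
  have vd: "((\<lambda>t. \<phi> (x + t *\<^sub>R ?e)) has_vector_derivative partial i \<phi> (x + t *\<^sub>R ?e)) (at t)" for x t
    using \<phi> smooth_on_UNIV_differentiable[of \<phi> "[]"] by (intro has_vector_derivative_partial) (auto simp: schwartz_def)
  define A where "A = 2 ^ (CARD('n) + 1) * schwartz_norm (2 * CARD('n) + 1) \<phi>"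
  have A: "A \<ge> 0" unfolding A_def using schwartz_norm_nonneg[OF \<phi>] by simp
  have Ab: "norm (partial i \<phi> x) \<le> A * (1 / weight x)" for x
    unfolding A_def p by (intro schwartz_le_inverse_weight \<phi>) auto
  \<comment> \<open>A shift by at most \<open>1\<close> changes \<open>1 + (norm x)\<^sup>2\<close> by at most a factor \<open>3\<close>.\<close>
  have near: "norm (partial i \<phi> (x + t *\<^sub>R ?e)) \<le> A * 3 ^ CARD('n) * (1 / weight x)" if t: "\<bar>t\<bar> \<le> 1" for x t
  proof -
    let ?z = "x + t *\<^sub>R ?e"
    have dim: "DIM(real^'n) = CARD('n)" by simp
    have "norm x \<le> norm ?z + norm (t *\<^sub>R ?e)" using norm_triangle_ineq4[of ?z "t *\<^sub>R ?e"] by simp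
    then have "norm x \<le> norm ?z + 1" using t by (simp add: norm_axis_1)
    then have "(norm x)^2 \<le> (norm ?z + 1)^2" by (intro power_mono) auto
    also have "\<dots> \<le> 2 * (norm ?z)^2 + 2" using sum_squares_bound[of "norm ?z" 1] by (simp add: power2_sum)
    also have "\<dots> \<le> 3 * (norm ?z)^2 + 2" by simp
    finally have "1 + (norm x)^2 \<le> 3 * (1 + (norm ?z)^2)" by simp
    then have "(1 + (norm x)^2) ^ CARD('n) \<le> (3 * (1 + (norm ?z)^2)) ^ CARD('n)"
      by (rule power_mono) simp
    then have w: "weight x \<le> 3 ^ CARD('n) * weight ?z" by (simp only: weight_def power_mult_distrib dim)
    have "1 / weight ?z \<le> 3 ^ CARD('n) * (1 / weight x)"
      using w weight_pos[of x] weight_pos[of ?z] by (simp add: field_simps)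
    from order_trans[OF Ab[of ?z] mult_left_mono[OF this A]] show ?thesis by (simp only: mult.assoc)
  qed
  let ?X = "\<lambda>k::nat. 1 / real (Suc k)"
  let ?s = "\<lambda>k x. ?K x * ((\<phi> (x + ?X k *\<^sub>R ?e) - \<phi> x) /\<^sub>R ?X k)"
  have X: "?X \<longlonglongrightarrow> 0" by (rule LIMSEQ_Suc[OF lim_1_over_n]) 
  have lim1: "(\<lambda>k. integral\<^sup>L lborel (?s k)) \<longlonglongrightarrow> integral\<^sup>L lborel (\<lambda>x. ?K x * partial i \<phi> x)"
  proof (rule integral_dominated_convergence[where w = "\<lambda>x. A * 3 ^ CARD('n) * (1 / weight x)"])
    show "integrable lborel (\<lambda>x::real^'n. A * 3 ^ CARD('n) * (1 / weight x))"
      by (intro integrable_mult_right integrable_inverse_weight)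
    show "AE x in lborel. (\<lambda>k. ?s k x) \<longlonglongrightarrow> ?K x * partial i \<phi> x"
    proof (rule AE_I2)
      fix x
      have "((\<lambda>h. (\<phi> (x + h *\<^sub>R ?e) - \<phi> x) /\<^sub>R h) \<longlongrightarrow> partial i \<phi> x) (at 0)"
        using has_vector_derivative_difference_quotient[OF vd[of x 0]] by simp
      then have "(\<lambda>k. (\<phi> (x + ?X k *\<^sub>R ?e) - \<phi> x) /\<^sub>R ?X k) \<longlonglongrightarrow> partial i \<phi> x"
        by (rule tendsto_compose_sequence_at_0[OF _ X]) simp
      then show "(\<lambda>k. ?s k x) \<longlonglongrightarrow> ?K x * partial i \<phi> x" by (intro tendsto_mult_left)
    qed
    show "AE x in lborel. norm (?s k x) \<le> A * 3 ^ CARD('n) * (1 / weight x)" for k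
    proof (rule AE_I2)
      fix x
      have "norm (\<phi> (x + ?X k *\<^sub>R ?e) - \<phi> (x + 0 *\<^sub>R ?e)) \<le> A * 3 ^ CARD('n) * (1 / weight x) * norm (?X k - 0)"
      proof (rule differentiable_bound[where S = "{0..?X k}" and f = "\<lambda>t. \<phi> (x + t *\<^sub>R ?e)" and f' = "\<lambda>t u. u *\<^sub>R partial i \<phi> (x + t *\<^sub>R ?e)"])
        show "((\<lambda>t. \<phi> (x + t *\<^sub>R ?e)) has_derivative (\<lambda>u. u *\<^sub>R partial i \<phi> (x + t *\<^sub>R ?e))) (at t within {0..?X k})" for t
          using vd[of x t] by (auto simp: has_vector_derivative_def intro: has_derivative_at_withinI)
        show "onorm (\<lambda>u. u *\<^sub>R partial i \<phi> (x + t *\<^sub>R ?e)) \<le> A * 3 ^ CARD('n) * (1 / weight x)" if "t \<in> {0..?X k}" for t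
        proof (rule onorm_le)
          have "?X k \<le> 1" by simp
          moreover have "0 \<le> t" "t \<le> ?X k" using that by auto
          ultimately have "\<bar>t\<bar> \<le> 1" by (simp only: abs_of_nonneg order_trans[of t "?X k" 1])
          then show "norm (u *\<^sub>R partial i \<phi> (x + t *\<^sub>R ?e)) \<le> A * 3 ^ CARD('n) * (1 / weight x) * norm u" for u
            using mult_right_mono[OF near[of t x], of "\<bar>u\<bar>"] by (simp add: mult.commute)
        qed
      qed auto
      then have d: "norm (\<phi> (x + ?X k *\<^sub>R ?e) - \<phi> x) \<le> A * 3 ^ CARD('n) * (1 / weight x) * norm (?X k - 0)"
        by (simp only: scaleR_zero_left add_0_right)
      have gen: "norm (?K x * (d /\<^sub>R r)) \<le> B" if "norm d \<le> B * norm (r - 0)" "0 < r" for d r B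
        using that by (simp add: norm_mult field_simps)
      show "norm (?s k x) \<le> A * 3 ^ CARD('n) * (1 / weight x)"
        by (rule gen[OF d]) simp
    qed
  qed measurable
  have eq: "integral\<^sup>L lborel (?s k) = (exp (\<i> * complex_of_real (?X k * \<xi> $ i)) - 1) / complex_of_real (?X k) * fourier \<phi> \<xi>" for k
  proof -
    let ?t = "?X k"
    have e: "?K x * ((\<phi> (x + ?t *\<^sub>R ?e) - \<phi> x) /\<^sub>R ?t)
       = (exp (\<i> * complex_of_real (?t * \<xi> $ i)) * (?K (?t *\<^sub>R ?e + x) * \<phi> (?t *\<^sub>R ?e + x)) - ?K x * \<phi> x) / complex_of_real ?t" for x
    proof -
      have "exp (\<i> * complex_of_real (?t * \<xi> $ i)) * ?K (?t *\<^sub>R ?e + x) = ?K x"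
        unfolding exp_add[symmetric] by (simp add: inner_add_left inner_axis' distrib_left)
      then have "exp (\<i> * complex_of_real (?t * \<xi> $ i)) * (?K (?t *\<^sub>R ?e + x) * \<phi> (?t *\<^sub>R ?e + x)) = ?K x * \<phi> (?t *\<^sub>R ?e + x)"
        by (simp only: mult.assoc[symmetric])
      moreover have "c * ((p - q) /\<^sub>R r) = (c * p - c * q) / complex_of_real r" for c p q r
        by (simp add: scaleR_conv_of_real divide_inverse algebra_simps)
      ultimately show ?thesis by (simp only: add.commute[of x])
    qed
    have i1: "integrable lborel (\<lambda>x. ?K x * \<phi> x)" by (rule fourier_integrable[OF ip])
    have m: "(\<lambda>x. ?K x * \<phi> x) \<in> borel_measurable borel" by measurable
    have i2: "integrable lborel (\<lambda>x. ?K (?t *\<^sub>R ?e + x) * \<phi> (?t *\<^sub>R ?e + x))"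
      using lborel_integral_translate(1)[OF m, of "?t *\<^sub>R ?e"] i1 by simp
    have v2: "integral\<^sup>L lborel (\<lambda>x. ?K (?t *\<^sub>R ?e + x) * \<phi> (?t *\<^sub>R ?e + x)) = fourier \<phi> \<xi>"
      using lborel_integral_translate(2)[OF m, of "?t *\<^sub>R ?e"] by (simp add: fourier_def)
    have "integral\<^sup>L lborel (?s k) = (exp (\<i> * complex_of_real (?t * \<xi> $ i)) * fourier \<phi> \<xi> - fourier \<phi> \<xi>) / complex_of_real ?t"
      unfolding e integral_divide_zero
      by (subst Bochner_Integration.integral_diff[OF integrable_mult_right[OF i2] i1])
         (simp only: integral_mult_right_zero v2, simp add: fourier_def)
    then show ?thesis by (simp add: algebra_simps)
  qed
  have lim2: "(\<lambda>k. (exp (\<i> * complex_of_real (?X k * \<xi> $ i)) - 1) / complex_of_real (?X k) * fourier \<phi> \<xi>)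
       \<longlonglongrightarrow> \<i> * complex_of_real (\<xi> $ i) * fourier \<phi> \<xi>"
  proof (intro tendsto_mult_right)
    have "((\<lambda>z. exp (\<i> * (z * complex_of_real (\<xi> $ i)))) has_field_derivative \<i> * complex_of_real (\<xi> $ i)) (at 0)"
      by (auto intro!: derivative_eq_intros)
    then have "((\<lambda>h. (exp (\<i> * (h * complex_of_real (\<xi> $ i))) - 1) / h) \<longlongrightarrow> \<i> * complex_of_real (\<xi> $ i)) (at 0)"
      by (simp add: DERIV_def)
    moreover have "(\<lambda>k. complex_of_real (?X k)) \<longlonglongrightarrow> 0" using tendsto_of_real[OF X, where 'a = complex] by simp
    ultimately have "(\<lambda>k. (exp (\<i> * (complex_of_real (?X k) * complex_of_real (\<xi> $ i))) - 1) / complex_of_real (?X k)) \<longlonglongrightarrow> \<i> * complex_of_real (\<xi> $ i)"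
      by (rule tendsto_compose_sequence_at_0) (simp only: of_real_eq_0_iff, simp)
    then show "(\<lambda>k. (exp (\<i> * complex_of_real (?X k * \<xi> $ i)) - 1) / complex_of_real (?X k)) \<longlonglongrightarrow> \<i> * complex_of_real (\<xi> $ i)"
      by (simp only: of_real_mult)
  qed
  show ?thesis
    unfolding fourier_def[of "partial i \<phi>"] by (rule LIMSEQ_unique[OF lim1[unfolded eq] lim2])
qed

lemma fourier_iter_partial:
  fixes \<phi> :: "real^'n::finite \<Rightarrow> complex"
  assumes \<phi>: "schwartz \<phi>"
  shows "fourier (iter_partial (replicate k i) \<phi>) \<xi> = (\<i> * complex_of_real (\<xi> $ i)) ^ k * fourier \<phi> \<xi>"
  by (induction k) (simp_all add: fourier_partial[OF schwartz_iter_partial[OF \<phi>]])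

text \<open>Quantitative, with one Schwartz seminorm and a constant independent of \<open>\<phi>\<close>: this is what makes
  \<open>\<phi> \<mapsto> \<integral> g * fourier \<phi>\<close> continuous. If \<open>\<xi>\<^sub>m\<close> is a coordinate of largest modulus, then \<open>norm \<xi>\<close> is at
  most \<open>CARD('n)\<close> times \<open>\<bar>\<xi>\<^sub>m\<bar>\<close>, so derivatives in the single direction \<open>m\<close> suffice.\<close>

lemma fourier_decay:
  "\<exists>C\<ge>0. \<forall>\<phi>. schwartz \<phi> \<longrightarrow> (\<forall>\<xi>::real^'n::finite. norm (fourier \<phi> \<xi>) \<le> C * schwartz_norm (2 * CARD('n)) \<phi> * (1 / weight \<xi>))"
proof (intro exI conjI allI impI)
  let ?n = "CARD('n)"
  let ?I = "LINT x|lborel. 1 / weight (x :: real^'n)"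
  let ?C = "2 ^ ?n * (1 + real ?n ^ (2 * ?n)) * (2 ^ (?n + 1) * ?I)"
  have I: "?I \<ge> 0" by (intro Bochner_Integration.integral_nonneg) (auto intro: weight_pos[THEN less_imp_le])
  then show "?C \<ge> 0" by simp
  fix \<phi> :: "real^'n \<Rightarrow> complex" and \<xi> :: "real^'n"
  assume \<phi>: "schwartz \<phi>"
  define D where "D = 2 ^ (?n + 1) * schwartz_norm (2 * ?n) \<phi> * ?I"
  obtain m where m: "\<And>i. \<bar>\<xi> $ i\<bar> \<le> \<bar>\<xi> $ m\<bar>"
  proof -
    have "Max (range (\<lambda>i. \<bar>\<xi> $ i\<bar>)) \<in> range (\<lambda>i. \<bar>\<xi> $ i\<bar>)" by (intro Max_in) auto
    then obtain m where "Max (range (\<lambda>i. \<bar>\<xi> $ i\<bar>)) = \<bar>\<xi> $ m\<bar>" by (rule rangeE)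
    then show ?thesis using that by (metis Max_ge finite_imageI finite rangeI)
  qed
  have "norm \<xi> \<le> (\<Sum>i\<in>UNIV. \<bar>\<xi> $ i\<bar>)" by (rule norm_le_l1_cart)
  also have "\<dots> \<le> real ?n * \<bar>\<xi> $ m\<bar>" using m sum_bounded_above[of UNIV "\<lambda>i. \<bar>\<xi> $ i\<bar>" "\<bar>\<xi> $ m\<bar>"] by simp
  finally have "norm \<xi> ^ (2 * ?n) \<le> (real ?n * \<bar>\<xi> $ m\<bar>) ^ (2 * ?n)" by (rule power_mono) simp
  then have nm: "norm \<xi> ^ (2 * ?n) \<le> real ?n ^ (2 * ?n) * \<bar>\<xi> $ m\<bar> ^ (2 * ?n)" by (simp only: power_mult_distrib)
  have d0: "norm (fourier \<phi> \<xi>) \<le> D"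
    unfolding D_def using norm_fourier_le[OF \<phi>, of "2 * ?n" "[]" \<xi>] by simp
  have "norm (fourier (iter_partial (replicate (2 * ?n) m) \<phi>) \<xi>) \<le> D"
    unfolding D_def by (intro norm_fourier_le \<phi>) auto
  then have dm: "\<bar>\<xi> $ m\<bar> ^ (2 * ?n) * norm (fourier \<phi> \<xi>) \<le> D"
    by (simp add: fourier_iter_partial[OF \<phi>] norm_mult norm_power)
  have "weight \<xi> * norm (fourier \<phi> \<xi>) \<le> 2 ^ ?n * (1 + norm \<xi> ^ (2 * ?n)) * norm (fourier \<phi> \<xi>)"
    using weight_le[of \<xi>] by (intro mult_right_mono) auto
  also have "\<dots> \<le> 2 ^ ?n * (1 + real ?n ^ (2 * ?n) * \<bar>\<xi> $ m\<bar> ^ (2 * ?n)) * norm (fourier \<phi> \<xi>)"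
    using nm by (intro mult_right_mono mult_left_mono add_left_mono) auto
  also have "\<dots> = 2 ^ ?n * (norm (fourier \<phi> \<xi>) + real ?n ^ (2 * ?n) * (\<bar>\<xi> $ m\<bar> ^ (2 * ?n) * norm (fourier \<phi> \<xi>)))"
    by (simp add: distrib_left distrib_right mult.assoc)
  also have "\<dots> \<le> 2 ^ ?n * (D + real ?n ^ (2 * ?n) * D)"
    using d0 dm by (intro mult_left_mono add_mono) auto
  also have "\<dots> = ?C * schwartz_norm (2 * ?n) \<phi>" by (simp add: D_def algebra_simps)
  finally show "norm (fourier \<phi> \<xi>) \<le> ?C * schwartz_norm (2 * ?n) \<phi> * (1 / weight \<xi>)"
    using weight_pos[of \<xi>] by (simp add: field_simps)
qed

lemma fourier_measurable:
  assumes [measurable]: "\<phi> \<in> borel_measurable borel"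
  shows "fourier \<phi> \<in> borel_measurable borel"
  unfolding fourier_def[abs_def] by measurable

lemma inv_fourier_eq:
  "inv_fourier \<phi> (x :: real^'n::finite) = complex_of_real (1 / (2 * pi) ^ CARD('n)) * fourier \<phi> (- x)"
  by (simp add: inv_fourier_def fourier_def inner_commute)

text \<open>The multiplication formula for a modulated Gaussian. It yields both the inversion formula, with
  \<open>v \<longlonglongrightarrow> \<infinity>\<close>, and the representation of the fundamental solution, by integration over \<open>v\<close>.\<close>

lemma fourier_gauss_pairing:
  fixes \<phi> :: "real^'n::finite \<Rightarrow> complex"
  assumes \<phi>: "integrable lborel \<phi>" and v: "v > 0"
  shows "(LINT \<xi>|lborel. complex_of_real (exp (- ((norm \<xi>)^2 / (4 * v)))) * (exp (\<i> * complex_of_real (\<xi> \<bullet> y)) * fourier \<phi> \<xi>))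
     = complex_of_real ((4 * pi * v) powr (CARD('n) / 2)) * (LINT x|lborel. complex_of_real (exp (- (v * (norm (y - x))^2))) * \<phi> x)"
proof -
  define \<tau> where "\<tau> = 1 / (4 * v)"
  have t: "\<tau> > 0" using v by (simp add: \<tau>_def)
  let ?g = "\<lambda>\<xi>::real^'n. complex_of_real (exp (- (\<tau> * (norm \<xi>)^2)))"
  let ?F = "\<lambda>\<xi> x. ?g \<xi> * (exp (\<i> * complex_of_real (\<xi> \<bullet> y)) * (exp (- (\<i> * complex_of_real (x \<bullet> \<xi>))) * \<phi> x))"
  have [measurable]: "\<phi> \<in> borel_measurable borel" using borel_measurable_integrable[OF \<phi>] by simp
  have ig: "integrable lborel (\<lambda>\<xi>::real^'n. exp (- (\<tau> * (norm \<xi>)^2)))"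
    using gauss_integral[OF t, where 'a = "real^'n"] by (simp add: has_bochner_integral_iff)
  have nF: "norm (?F \<xi> x) = exp (- (\<tau> * (norm \<xi>)^2)) * norm (\<phi> x)" for \<xi> x
    by (simp add: norm_mult)
  have int: "integrable (lborel \<Otimes>\<^sub>M lborel) (\<lambda>(\<xi>, x). ?F \<xi> x)"
  proof (rule lborel_pair.Fubini_integrable)
    show "(\<lambda>(\<xi>, x). ?F \<xi> x) \<in> borel_measurable (lborel \<Otimes>\<^sub>M lborel)" by measurable
    show "integrable lborel (\<lambda>\<xi>. LINT x|lborel. norm (case (\<xi>, x) of (\<xi>, x) \<Rightarrow> ?F \<xi> x))"
      unfolding split_conv nF integral_mult_right_zero by (intro integrable_mult_left ig)
    have "integrable lborel (?F \<xi>)" for \<xi>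
      using fourier_integrable[OF \<phi>] by (intro integrable_mult_right)
    then show "AE \<xi> in lborel. integrable lborel (\<lambda>x. case (\<xi>, x) of (\<xi>, x) \<Rightarrow> ?F \<xi> x)" by simp
  qed
  have "(LINT \<xi>|lborel. complex_of_real (exp (- ((norm \<xi>)^2 / (4 * v)))) * (exp (\<i> * complex_of_real (\<xi> \<bullet> y)) * fourier \<phi> \<xi>))
     = (LINT \<xi>|lborel. (LINT x|lborel. ?F \<xi> x))"
    unfolding integral_mult_right_zero fourier_def \<tau>_def by simp
  also have "\<dots> = (LINT x|lborel. (LINT \<xi>|lborel. ?F \<xi> x))"
    by (rule lborel_pair.Fubini_integral[symmetric]) (use int in simp)
  also have "\<dots> = (LINT x|lborel. complex_of_real ((4 * pi * v) powr (CARD('n) / 2)) * (complex_of_real (exp (- (v * (norm (y - x))^2))) * \<phi> x))"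
  proof (rule Bochner_Integration.integral_cong[OF refl])
    fix x
    have "?F \<xi> x = ?g \<xi> * exp (\<i> * complex_of_real (\<xi> \<bullet> (y - x))) * \<phi> x" for \<xi>
      by (simp add: exp_add[symmetric] inner_diff_right inner_commute[of x] mult.assoc[symmetric] right_diff_distrib)
    then have "(LINT \<xi>|lborel. ?F \<xi> x) = (LINT \<xi>|lborel. ?g \<xi> * exp (\<i> * complex_of_real (\<xi> \<bullet> (y - x)))) * \<phi> x"
      by (simp only: integral_mult_left_zero)
    also have "(LINT \<xi>|lborel. ?g \<xi> * exp (\<i> * complex_of_real (\<xi> \<bullet> (y - x)))) = complex_of_real ((pi / \<tau>) powr (CARD('n) / 2) * exp (- ((norm (y - x))^2 / (4 * \<tau>))))"
      using gauss_fourier[OF t, of "y - x"] by (simp add: has_bochner_integral_iff)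
    also have "pi / \<tau> = 4 * pi * v" by (simp add: \<tau>_def)
    also have "(norm (y - x))^2 / (4 * \<tau>) = v * (norm (y - x))^2" by (simp add: \<tau>_def)
    finally show "(LINT \<xi>|lborel. ?F \<xi> x) = complex_of_real ((4 * pi * v) powr (CARD('n) / 2)) * (complex_of_real (exp (- (v * (norm (y - x))^2))) * \<phi> x)"
      by simp
  qed
  finally show ?thesis by simp
qed

lemma fourier_le_inverse_weight:
  fixes \<phi> :: "real^'n::finite \<Rightarrow> complex"
  assumes "schwartz \<phi>"
  obtains C where "\<And>\<xi>. norm (fourier \<phi> \<xi>) \<le> C * (1 / weight \<xi>)"
  using fourier_decay[where 'n = 'n] assms by metis

text \<open>Gaussian regularization: as \<open>v \<longlonglongrightarrow> \<infinity>\<close> the left side of the pairing tends to the inverse transform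
  of \<open>fourier \<phi>\<close>, and on the right the rescaling \<open>x = y + z / sqrt v\<close> makes the Gaussian concentrate at \<open>y\<close>.\<close>

lemma fourier_inversion:
  fixes \<phi> :: "real^'n::finite \<Rightarrow> complex"
  assumes \<phi>: "schwartz \<phi>"
  shows "inv_fourier (fourier \<phi>) y = \<phi> y"
proof -
  have m[measurable]: "\<phi> \<in> borel_measurable borel" using schwartz_measurable[OF \<phi>, of "[]"] by simp
  have [measurable]: "fourier \<phi> \<in> borel_measurable borel" by (rule fourier_measurable) simp
  have i: "integrable lborel \<phi>" using schwartz_integrable[OF \<phi>, of "[]"] by simp
  obtain C where C: "\<And>\<xi>. norm (fourier \<phi> \<xi>) \<le> C * (1 / weight \<xi>)" using fourier_le_inverse_weight[OF \<phi>] by metis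
  have cont: "isCont \<phi> x" for x
    using schwartz_continuous[OF \<phi>, of "[]"] by (simp add: continuous_on_eq_continuous_at)
  define B where "B = schwartz_norm 0 \<phi>"
  have B: "norm (\<phi> x) \<le> B" for x
    using schwartz_norm_ge[OF \<phi>, of 0 0 "[]" x] by (simp add: B_def)
  \<comment> \<open>The square root of the parameter \<open>v = Suc k\<close> of the Gaussian, by which space is rescaled.\<close>
  define c where "c = (\<lambda>k::nat. sqrt (real (Suc k)))"
  have c: "c k > 0" "(c k)^2 = real (Suc k)" for k by (simp_all add: c_def del: of_nat_Suc)
  let ?G = "\<lambda>\<xi>. exp (\<i> * complex_of_real (\<xi> \<bullet> y)) * fourier \<phi> \<xi>"
  let ?L = "\<lambda>k \<xi>. complex_of_real (exp (- ((norm \<xi>)^2 / (4 * real (Suc k))))) * ?G \<xi>"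
  have X: "(\<lambda>k. 1 / real (Suc k)) \<longlonglongrightarrow> 0" by (rule LIMSEQ_Suc[OF lim_1_over_n])
  have lim1: "(\<lambda>k. integral\<^sup>L lborel (?L k)) \<longlonglongrightarrow> integral\<^sup>L lborel ?G"
  proof (rule integral_dominated_convergence[where w = "\<lambda>\<xi>. C * (1 / weight \<xi>)"])
    show "integrable lborel (\<lambda>\<xi>::real^'n. C * (1 / weight \<xi>))"
      by (intro integrable_mult_right integrable_inverse_weight)
    show "AE \<xi> in lborel. (\<lambda>k. ?L k \<xi>) \<longlonglongrightarrow> ?G \<xi>"
    proof (rule AE_I2)
      fix \<xi> :: "real^'n"
      have "(\<lambda>k. exp (- ((norm \<xi>)^2 / 4 * (1 / real (Suc k))))) \<longlonglongrightarrow> exp (- ((norm \<xi>)^2 / 4 * 0))"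
        by (intro tendsto_intros X)
      then have "(\<lambda>k. exp (- ((norm \<xi>)^2 / (4 * real (Suc k))))) \<longlonglongrightarrow> 1" by simp
      from tendsto_mult[OF tendsto_of_real[OF this, where 'a = complex] tendsto_const[of "?G \<xi>"]]
      show "(\<lambda>k. ?L k \<xi>) \<longlonglongrightarrow> ?G \<xi>" by simp
    qed
    show "AE \<xi> in lborel. norm (?L k \<xi>) \<le> C * (1 / weight \<xi>)" for k
    proof (rule AE_I2)
      fix \<xi> :: "real^'n"
      have "norm (?L k \<xi>) = exp (- ((norm \<xi>)^2 / (4 * real (Suc k)))) * norm (fourier \<phi> \<xi>)" by (simp add: norm_mult)
      also have "\<dots> \<le> 1 * norm (fourier \<phi> \<xi>)" by (intro mult_right_mono) (auto simp del: of_nat_Suc)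
      finally show "norm (?L k \<xi>) \<le> C * (1 / weight \<xi>)" using C[of \<xi>] by simp
    qed
  qed measurable
  let ?R = "\<lambda>k z. complex_of_real (exp (- ((norm z)^2))) * \<phi> (y + (1 / c k) *\<^sub>R z)"
  have eq: "integral\<^sup>L lborel (?L k) = complex_of_real ((4 * pi) powr (CARD('n) / 2)) * integral\<^sup>L lborel (?R k)" for k
  proof -
    let ?v = "real (Suc k)"
    have v: "?v > 0" by simp
    have nz: "1 / c k \<noteq> 0" using c[of k] by simp
    have "integral\<^sup>L lborel (?L k) = complex_of_real ((4 * pi * ?v) powr (CARD('n) / 2)) * (LINT x|lborel. complex_of_real (exp (- (?v * (norm (y - x))^2))) * \<phi> x)"
      by (rule fourier_gauss_pairing[OF i v])
    also have "(LINT x|lborel. complex_of_real (exp (- (?v * (norm (y - x))^2))) * \<phi> x)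
      = \<bar>1 / c k\<bar> ^ DIM(real^'n) *\<^sub>R (LINT z|lborel. complex_of_real (exp (- (?v * (norm (y - (y + (1 / c k) *\<^sub>R z)))^2))) * \<phi> (y + (1 / c k) *\<^sub>R z))"
      by (rule lborel_integral_affine[OF _ nz]) measurable
    also have "(LINT z|lborel. complex_of_real (exp (- (?v * (norm (y - (y + (1 / c k) *\<^sub>R z)))^2))) * \<phi> (y + (1 / c k) *\<^sub>R z))
       = integral\<^sup>L lborel (?R k)"
      using c[of k] by (intro Bochner_Integration.integral_cong refl) (simp add: power_mult_distrib power_divide del: of_nat_Suc)
    also have "\<bar>1 / c k\<bar> ^ DIM(real^'n) *\<^sub>R integral\<^sup>L lborel (?R k) = complex_of_real ((1 / c k) ^ CARD('n)) * integral\<^sup>L lborel (?R k)"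
      using c[of k] by (simp add: scaleR_conv_of_real)
    also have "complex_of_real ((4 * pi * ?v) powr (CARD('n) / 2)) * (complex_of_real ((1 / c k) ^ CARD('n)) * integral\<^sup>L lborel (?R k))
       = complex_of_real ((4 * pi * ?v) powr (CARD('n) / 2) * (1 / c k) ^ CARD('n)) * integral\<^sup>L lborel (?R k)"
      by simp
    also have "(4 * pi * ?v) powr (CARD('n) / 2) * (1 / c k) ^ CARD('n) = (4 * pi) powr (CARD('n) / 2)"
    proof -
      have "?v powr (CARD('n) / 2) = c k ^ CARD('n)"
        using c[of k] v by (simp add: c_def powr_half_sqrt[symmetric] powr_power del: of_nat_Suc)
      then have "(4 * pi * ?v) powr (CARD('n) / 2) = (4 * pi) powr (CARD('n) / 2) * c k ^ CARD('n)"
        using v by (subst powr_mult) (auto simp del: of_nat_Suc)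
      then show ?thesis using c[of k] by (simp add: power_divide)
    qed
    finally show ?thesis .
  qed
  have g1: "has_bochner_integral lborel (\<lambda>z::real^'n. exp (- ((norm z)^2))) (pi powr (CARD('n) / 2))"
    using gauss_integral[of 1, where 'a = "real^'n"] by simp
  have lim2: "(\<lambda>k. integral\<^sup>L lborel (?R k)) \<longlonglongrightarrow> integral\<^sup>L lborel (\<lambda>z::real^'n. complex_of_real (exp (- ((norm z)^2))) * \<phi> y)"
  proof (rule integral_dominated_convergence[where w = "\<lambda>z. B * exp (- ((norm z)^2))"])
    show "integrable lborel (\<lambda>z::real^'n. B * exp (- ((norm z)^2)))"
      using g1 by (intro integrable_mult_right) (simp add: has_bochner_integral_iff)
    show "AE z in lborel. (\<lambda>k. ?R k z) \<longlonglongrightarrow> complex_of_real (exp (- ((norm z)^2))) * \<phi> y"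
    proof (rule AE_I2)
      fix z :: "real^'n"
      have "(\<lambda>k. 1 / c k) \<longlonglongrightarrow> 0"
        unfolding c_def using tendsto_real_sqrt[OF X] by (simp add: real_sqrt_divide)
      then have "(\<lambda>k. y + (1 / c k) *\<^sub>R z) \<longlonglongrightarrow> y + 0 *\<^sub>R z" by (intro tendsto_intros)
      then have "(\<lambda>k. \<phi> (y + (1 / c k) *\<^sub>R z)) \<longlonglongrightarrow> \<phi> (y + 0 *\<^sub>R z)" by (rule isCont_tendsto_compose[OF cont])
      then show "(\<lambda>k. ?R k z) \<longlonglongrightarrow> complex_of_real (exp (- ((norm z)^2))) * \<phi> y" by (intro tendsto_mult_left) simp
    qed
    show "AE z in lborel. norm (?R k z) \<le> B * exp (- ((norm z)^2))" for k
      using B by (intro AE_I2) (simp add: norm_mult mult.commute)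
  qed measurable
  have val: "integral\<^sup>L lborel (\<lambda>z::real^'n. complex_of_real (exp (- ((norm z)^2))) * \<phi> y) = complex_of_real (pi powr (CARD('n) / 2)) * \<phi> y"
    using g1 by (simp add: has_bochner_integral_iff)
  have "(\<lambda>k. integral\<^sup>L lborel (?L k)) \<longlonglongrightarrow> complex_of_real ((4 * pi) powr (CARD('n) / 2)) * (complex_of_real (pi powr (CARD('n) / 2)) * \<phi> y)"
    unfolding eq by (rule tendsto_mult_left[OF lim2[unfolded val]])
  from LIMSEQ_unique[OF lim1 this]
  have "integral\<^sup>L lborel ?G = complex_of_real ((4 * pi) powr (CARD('n) / 2) * pi powr (CARD('n) / 2)) * \<phi> y"
    by simp
  also have "(4 * pi) powr (CARD('n) / 2) * pi powr (CARD('n) / 2) = (2 * pi) ^ CARD('n)"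
  proof -
    have "(4 * pi) powr (CARD('n) / 2) * pi powr (CARD('n) / 2) = ((2 * pi)^2) powr (CARD('n) / 2)"
      by (simp add: powr_mult[symmetric] power2_eq_square mult.assoc)
    also have "\<dots> = (2 * pi) powr (2 * (CARD('n) / 2))" by (subst powr_powr[symmetric]) (simp add: powr_numeral)
    finally show ?thesis by (simp add: powr_realpow)
  qed
  finally show ?thesis by (simp add: inv_fourier_def inner_commute[of y])
qed

lemma inv_fourier_gauss_pairing:
  fixes \<phi> :: "real^'n::finite \<Rightarrow> complex"
  assumes \<phi>: "integrable lborel \<phi>" and v: "v > 0"
  shows "(LINT \<xi>|lborel. complex_of_real (exp (- ((norm \<xi>)^2 / (4 * v)))) * inv_fourier \<phi> \<xi>)
     = (LINT x|lborel. complex_of_real ((v / pi) powr (CARD('n) / 2) * exp (- (v * (norm x)^2))) * \<phi> x)"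
proof -
  have [measurable]: "\<phi> \<in> borel_measurable borel" using borel_measurable_integrable[OF \<phi>] by simp
  have [measurable]: "fourier \<phi> \<in> borel_measurable borel" by (rule fourier_measurable) simp
  let ?c = "complex_of_real (1 / (2 * pi) ^ CARD('n))"
  let ?g = "\<lambda>\<xi>::real^'n. complex_of_real (exp (- ((norm \<xi>)^2 / (4 * v))))"
  have "(LINT \<xi>|lborel. ?g \<xi> * inv_fourier \<phi> \<xi>) = ?c * (LINT \<xi>|lborel. ?g \<xi> * fourier \<phi> (- \<xi>))"
    unfolding inv_fourier_eq integral_mult_right_zero[symmetric] by (simp add: mult.left_commute)
  also have "(LINT \<xi>|lborel. ?g \<xi> * fourier \<phi> (- \<xi>)) = (LINT \<xi>|lborel. ?g \<xi> * fourier \<phi> \<xi>)"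
    using lborel_integral_affine[of "\<lambda>\<xi>. ?g \<xi> * fourier \<phi> \<xi>" "- 1" 0] by simp
  also have "\<dots> = complex_of_real ((4 * pi * v) powr (CARD('n) / 2)) * (LINT x|lborel. complex_of_real (exp (- (v * (norm x)^2))) * \<phi> x)"
    using fourier_gauss_pairing[OF \<phi> v, of 0] by simp
  also have "?c * \<dots> = complex_of_real (1 / (2 * pi) ^ CARD('n) * (4 * pi * v) powr (CARD('n) / 2)) * (LINT x|lborel. complex_of_real (exp (- (v * (norm x)^2))) * \<phi> x)"
    by simp
  also have "1 / (2 * pi) ^ CARD('n) * (4 * pi * v) powr (CARD('n) / 2) = (v / pi) powr (CARD('n) / 2)"
  proof -
    have "(2 * pi) ^ CARD('n) = (2 * pi) powr (2 * (CARD('n) / 2))" by (simp add: powr_realpow)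
    also have "\<dots> = ((2 * pi)^2) powr (CARD('n) / 2)" by (subst powr_powr[symmetric]) (simp add: powr_numeral)
    finally have e: "(2 * pi) ^ CARD('n) = (4 * pi * pi) powr (CARD('n) / 2)" by (simp add: power2_eq_square mult.assoc)
    have "(4 * pi * v) / (4 * pi * pi) = v / pi" by simp
    then show ?thesis unfolding e using v by (simp add: powr_divide[symmetric])
  qed
  finally show ?thesis by (simp add: mult.assoc)
qed

section \<open>Distributions given by functions of moderate growth\<close>

lemma partial_cong_open:
  assumes "open S" "x \<in> S" "\<And>y. y \<in> S \<Longrightarrow> f y = g y"
  shows "partial i f x = partial i g x"
proof -
  have "((\<lambda>t::real. x + t *\<^sub>R axis i 1) \<longlongrightarrow> x + 0 *\<^sub>R axis i 1) (nhds 0)"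
    by (intro tendsto_intros filterlim_ident)
  then have "\<forall>\<^sub>F t in nhds 0. x + t *\<^sub>R axis i 1 \<in> S"
    using topological_tendstoD[OF _ assms(1)] assms(2) by simp
  then have "\<forall>\<^sub>F t in nhds 0. f (x + t *\<^sub>R axis i 1) = g (x + t *\<^sub>R axis i 1)"
    by eventually_elim (rule assms(3))
  then show ?thesis unfolding partial_def
    by (intro vector_derivative_cong_eq) (auto elim: eventually_mono)
qed

lemma iter_partial_cong_open:
  assumes "open S" "x \<in> S" "\<And>y. y \<in> S \<Longrightarrow> f y = g y"
  shows "iter_partial is f x = iter_partial is g x"
  using assms(2)
proof (induction "is" arbitrary: x)
  case (Cons i "is")
  show ?case unfolding iter_partial.simps by (rule partial_cong_open[OF assms(1) Cons.prems Cons.IH])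
qed (simp add: assms(3))

lemma iter_partial_zero: "iter_partial is (\<lambda>_. 0) = (\<lambda>_. 0)"
  by (induction "is") (auto simp: partial_def fun_eq_iff)

text \<open>Derivatives vanish off the support, so each seminorm is a maximum over a compact set.\<close>

lemma test_function_schwartz:
  assumes \<phi>: "test_function_on U \<phi>"
  shows "schwartz \<phi>"
proof -
  let ?K = "closure {x. \<phi> x \<noteq> 0}"
  have sm: "smooth_on UNIV \<phi>" and K: "compact ?K" using \<phi> by (auto simp: test_function_on_def)
  have z: "iter_partial is \<phi> x = 0" if "x \<in> - ?K" for "is" x
  proof -
    have "iter_partial is \<phi> x = iter_partial is (\<lambda>_. 0) x"
      by (rule iter_partial_cong_open[OF _ that]) (use closure_subset[of "{x. \<phi> x \<noteq> 0}"] in auto)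
    then show ?thesis by (simp only: iter_partial_zero)
  qed
  have "bounded (range (\<lambda>x. norm x ^ k *\<^sub>R iter_partial is \<phi> x))" for k "is"
  proof -
    have "continuous_on UNIV (iter_partial is \<phi>)"
      using smooth_on_UNIV_differentiable[OF sm]
      by (auto simp: continuous_on_eq_continuous_at intro: differentiable_imp_continuous_within)
    then have "continuous_on ?K (iter_partial is \<phi>)" by (rule continuous_on_subset) simp
    then have "continuous_on ?K (\<lambda>x. norm x ^ k *\<^sub>R iter_partial is \<phi> x)"
      by (intro continuous_intros)
    then have "compact ((\<lambda>x. norm x ^ k *\<^sub>R iter_partial is \<phi> x) ` ?K)" using K by (rule compact_continuous_image)
    then have "bounded (insert 0 ((\<lambda>x. norm x ^ k *\<^sub>R iter_partial is \<phi> x) ` ?K))"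
      by (simp add: compact_imp_bounded)
    moreover have "range (\<lambda>x. norm x ^ k *\<^sub>R iter_partial is \<phi> x) \<subseteq> insert 0 ((\<lambda>x. norm x ^ k *\<^sub>R iter_partial is \<phi> x) ` ?K)"
    proof (rule image_subsetI)
      fix x
      show "norm x ^ k *\<^sub>R iter_partial is \<phi> x \<in> insert 0 ((\<lambda>x. norm x ^ k *\<^sub>R iter_partial is \<phi> x) ` ?K)"
        using z[of x "is"] by (cases "x \<in> ?K") auto
    qed
    ultimately show ?thesis by (rule bounded_subset)
  qed
  then show ?thesis using sm by (simp add: schwartz_def)
qed

lemma integrable_times_inverse_weight:
  fixes g f :: "'a::euclidean_space \<Rightarrow> complex"
  assumes [measurable]: "g \<in> borel_measurable borel" "f \<in> borel_measurable borel"
    and int: "integrable lborel (\<lambda>x. norm (g x) * (1 / weight x))"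
    and bd: "\<And>x. norm (f x) \<le> C * (1 / weight x)"
  shows "integrable lborel (\<lambda>x. g x * f x)"
    and "norm (LINT x|lborel. g x * f x) \<le> C * (LINT x|lborel. norm (g x) * (1 / weight x))"
proof -
  have i: "integrable lborel (\<lambda>x. C * (norm (g x) * (1 / weight x)))" by (intro integrable_mult_right int)
  have le: "norm (g x * f x) \<le> C * (norm (g x) * (1 / weight x))" for x
    using mult_left_mono[OF bd[of x] norm_ge_zero[of "g x"]] by (simp only: norm_mult mult.left_commute[of "norm (g x)" C])
  show f: "integrable lborel (\<lambda>x. g x * f x)"
  proof (rule Bochner_Integration.integrable_bound[OF i])
    show "AE x in lborel. norm (g x * f x) \<le> norm (C * (norm (g x) * (1 / weight x)))"
      by (intro AE_I2 order_trans[OF le]) (simp only: real_norm_def abs_ge_self)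
  qed simp
  have "norm (LINT x|lborel. g x * f x) \<le> (LINT x|lborel. norm (g x * f x))" by (rule integral_norm_bound)
  also have "\<dots> \<le> (LINT x|lborel. C * (norm (g x) * (1 / weight x)))"
    using f le by (intro integral_mono i integrable_norm)
  also have "\<dots> = C * (LINT x|lborel. norm (g x) * (1 / weight x))" by (rule integral_mult_right_zero)
  finally show "norm (LINT x|lborel. g x * f x) \<le> C * (LINT x|lborel. norm (g x) * (1 / weight x))" .
qed

lemma schwartz_norm_le_inverse_weight:
  fixes \<phi> :: "real^'n::finite \<Rightarrow> complex"
  shows "schwartz \<phi> \<Longrightarrow> norm (\<phi> x) \<le> 2 ^ (CARD('n) + 1) * schwartz_norm (2 * CARD('n)) \<phi> * (1 / weight x)"
  using schwartz_le_inverse_weight[of \<phi> "2 * CARD('n)" "[]" x] by simp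

text \<open>Integrability against the reciprocal weight is a sufficient form of moderate growth, satisfied
  both by the inverse symbol and by the constant \<open>1\<close>.\<close>

lemma tempered_function_of_weight:
  fixes g :: "real^'n::finite \<Rightarrow> complex"
  assumes g[measurable]: "g \<in> borel_measurable borel"
    and int: "integrable lborel (\<lambda>x. norm (g x) * (1 / weight x))"
  shows "tempered_function g"
proof -
  have m: "schwartz \<phi> \<Longrightarrow> \<phi> \<in> borel_measurable borel" for \<phi> :: "real^'n \<Rightarrow> complex"
    using schwartz_measurable[of \<phi> "[]"] by simp
  have i: "schwartz \<phi> \<Longrightarrow> integrable lborel (\<lambda>x. g x * \<phi> x)" for \<phi>
    by (rule integrable_times_inverse_weight(1)[OF g m int schwartz_norm_le_inverse_weight])
  have "set_integrable lborel K g" if K: "compact K" for K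
  proof -
    obtain R where R: "\<And>x. x \<in> K \<Longrightarrow> norm x \<le> R" using compact_imp_bounded[OF K] by (auto simp: bounded_iff)
    have [measurable]: "K \<in> sets borel" using K by (simp add: borel_compact)
    have "integrable lborel (\<lambda>x. g x * complex_of_real (indicator K x))"
    proof (rule integrable_times_inverse_weight(1)[OF g _ int])
      show "norm (complex_of_real (indicator K x)) \<le> (1 + R^2) ^ CARD('n) * (1 / weight x)" for x
      proof (cases "x \<in> K")
        case True
        then have "weight x \<le> (1 + R^2) ^ CARD('n)" using R[OF True] unfolding weight_def by (auto intro!: power_mono)
        then show ?thesis using True weight_pos[of x] by (simp add: field_simps)
      next
        case False
        then show ?thesis using weight_pos[of x] by (auto intro!: divide_nonneg_pos zero_le_power add_nonneg_nonneg)
      qed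
    qed measurable
    then show ?thesis unfolding set_integrable_def by (simp add: scaleR_conv_of_real mult.commute)
  qed
  moreover have "tempered (distr_of g)"
    unfolding tempered_def
  proof (intro conjI allI impI exI)
    show "distr_of g (\<lambda>x. \<phi> x + \<psi> x) = distr_of g \<phi> + distr_of g \<psi>" if "schwartz \<phi> \<and> schwartz \<psi>" for \<phi> \<psi>
      using i that unfolding distr_of_def by (simp add: distrib_left)
    show "distr_of g (\<lambda>x. c * \<phi> x) = c * distr_of g \<phi>" for c \<phi>
      unfolding distr_of_def by (simp add: mult.left_commute[of _ c])
    show "norm (distr_of g \<phi>) \<le> (2 ^ (CARD('n) + 1) * (LINT x|lborel. norm (g x) * (1 / weight x))) * schwartz_norm (2 * CARD('n)) \<phi>"
      if "schwartz \<phi>" for \<phi>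
      using integrable_times_inverse_weight(2)[OF g m[OF that] int schwartz_norm_le_inverse_weight[OF that]]
      unfolding distr_of_def by (simp add: mult_ac)
  qed
  ultimately show ?thesis using i by (simp add: tempered_function_def locally_integrable_on_def)
qed

lemma inv_fourier_decay:
  "\<exists>C\<ge>0. \<forall>\<phi>. schwartz \<phi> \<longrightarrow> (\<forall>\<xi>::real^'n::finite. norm (inv_fourier \<phi> \<xi>) \<le> C * schwartz_norm (2 * CARD('n)) \<phi> * (1 / weight \<xi>))"
proof -
  obtain C where C: "C \<ge> 0" "\<And>\<phi> \<xi>::real^'n. schwartz \<phi> \<Longrightarrow> norm (fourier \<phi> \<xi>) \<le> C * schwartz_norm (2 * CARD('n)) \<phi> * (1 / weight \<xi>)"
    using fourier_decay[where 'n = 'n] by blast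
  let ?c = "1 / (2 * pi) ^ CARD('n)"
  have "norm (inv_fourier \<phi> \<xi>) \<le> (?c * C) * schwartz_norm (2 * CARD('n)) \<phi> * (1 / weight \<xi>)"
    if \<phi>: "schwartz \<phi>" for \<phi> and \<xi> :: "real^'n"
  proof -
    have "norm (inv_fourier \<phi> \<xi>) = ?c * norm (fourier \<phi> (- \<xi>))"
      unfolding inv_fourier_eq norm_mult norm_of_real by simp
    also have "\<dots> \<le> ?c * (C * schwartz_norm (2 * CARD('n)) \<phi> * (1 / weight (- \<xi>)))"
      by (intro mult_left_mono C \<phi>) simp
    finally show ?thesis by (simp only: mult.assoc weight_def norm_minus_cancel)
  qed
  moreover have "?c * C \<ge> 0" using C(1) by simp
  ultimately show ?thesis by blast
qed

lemma inv_fourier_measurable: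
  assumes [measurable]: "\<phi> \<in> borel_measurable borel"
  shows "inv_fourier \<phi> \<in> borel_measurable borel"
proof -
  have [measurable]: "fourier \<phi> \<in> borel_measurable borel" by (rule fourier_measurable) simp
  show ?thesis unfolding inv_fourier_eq[abs_def] by measurable
qed

lemma inv_fourier_distr_tempered:
  fixes g :: "real^'n::finite \<Rightarrow> complex"
  assumes g[measurable]: "g \<in> borel_measurable borel"
    and int: "integrable lborel (\<lambda>x. norm (g x) * (1 / weight x))"
  shows "tempered (inv_fourier_distr (distr_of g))"
proof -
  obtain C where C: "\<And>\<phi> \<xi>::real^'n. schwartz \<phi> \<Longrightarrow> norm (inv_fourier \<phi> \<xi>) \<le> C * schwartz_norm (2 * CARD('n)) \<phi> * (1 / weight \<xi>)"
    using inv_fourier_decay[where 'n = 'n] by blast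
  have m: "schwartz \<phi> \<Longrightarrow> inv_fourier \<phi> \<in> borel_measurable borel" for \<phi> :: "real^'n \<Rightarrow> complex"
    using schwartz_measurable[of \<phi> "[]"] by (intro inv_fourier_measurable) simp
  have i: "schwartz \<phi> \<Longrightarrow> integrable lborel (\<lambda>x. g x * inv_fourier \<phi> x)" for \<phi>
    by (rule integrable_times_inverse_weight(1)[OF g m int C])
  have add: "fourier (\<lambda>x. \<phi> x + \<psi> x) \<xi> = fourier \<phi> \<xi> + fourier \<psi> \<xi>" if "schwartz \<phi>" "schwartz \<psi>" for \<phi> \<psi> and \<xi> :: "real^'n"
    using schwartz_integrable[of \<phi> "[]"] schwartz_integrable[of \<psi> "[]"] that
    unfolding fourier_def by (simp add: distrib_left fourier_integrable)
  show ?thesis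
    unfolding tempered_def inv_fourier_distr_def
  proof (intro conjI allI impI exI)
    show "distr_of g (inv_fourier (\<lambda>x. \<phi> x + \<psi> x)) = distr_of g (inv_fourier \<phi>) + distr_of g (inv_fourier \<psi>)"
      if "schwartz \<phi> \<and> schwartz \<psi>" for \<phi> \<psi>
    proof -
      have "inv_fourier (\<lambda>x. \<phi> x + \<psi> x) \<xi> = inv_fourier \<phi> \<xi> + inv_fourier \<psi> \<xi>" for \<xi>
        using that by (simp add: inv_fourier_eq add distrib_left)
      then show ?thesis using i that unfolding distr_of_def by (simp add: distrib_left)
    qed
    show "distr_of g (inv_fourier (\<lambda>x. c * \<phi> x)) = c * distr_of g (inv_fourier \<phi>)" for c \<phi>
    proof -
      have "inv_fourier (\<lambda>x. c * \<phi> x) \<xi> = c * inv_fourier \<phi> \<xi>" for \<xi>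
        unfolding inv_fourier_def by (simp add: mult.left_commute[of _ c])
      then show ?thesis unfolding distr_of_def by (simp add: mult.left_commute[of _ c])
    qed
    show "norm (distr_of g (inv_fourier \<phi>)) \<le> (C * (LINT x|lborel. norm (g x) * (1 / weight x))) * schwartz_norm (2 * CARD('n)) \<phi>"
      if "schwartz \<phi>" for \<phi>
      using integrable_times_inverse_weight(2)[OF g m[OF that] int C[OF that]]
      unfolding distr_of_def by (simp add: mult_ac)
  qed
qed

lemma tempered_delta0: "tempered delta0"
  unfolding tempered_def
proof (intro conjI allI impI exI)
  show "norm (delta0 \<phi>) \<le> 1 * schwartz_norm 0 \<phi>" if "schwartz \<phi>" for \<phi> :: "real^'n::finite \<Rightarrow> complex"
    using schwartz_norm_ge[OF that, of 0 0 "[]" 0] by (simp add: delta0_def)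
qed (simp_all add: delta0_def)

lemma fourier_delta0: "fourier_distr delta0 \<phi> = integral\<^sup>L lborel \<phi>"
  by (simp add: fourier_distr_def delta0_def fourier_def)

section \<open>The fundamental solution as a distribution\<close>

lemma symbol_measurable [measurable]: "symbol s \<in> borel_measurable borel"
  unfolding symbol_def[abs_def] by measurable

lemma symbol_pos: "\<xi> \<noteq> 0 \<Longrightarrow> symbol s \<xi> > 0"
  by (simp add: symbol_def add_pos_nonneg)

lemma inverse_symbol_laplace:
  assumes s: "0 < s" "s < 1" and x: "\<xi> \<noteq> 0"
  shows "1 / symbol s \<xi> = laplace (mittag_leffler (1 - s)) ((norm \<xi>)^2)"
proof -
  have "((norm \<xi>)^2) powr s = norm \<xi> powr (2 * s)"
    using x by (simp add: powr_powr[symmetric] powr_numeral)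
  then show ?thesis using mittag_leffler_laplace[of "1 - s" "(norm \<xi>)^2"] s x by (simp add: symbol_def)
qed

text \<open>The value is \<open>Gamma b * Gamma (1 - b)\<close>: write \<open>1 / (1 + \<tau>)\<close> as a Laplace transform and apply Tonelli.\<close>

lemma integrable_powr_over_1_plus:
  fixes b :: real
  assumes b: "0 < b" "b < 1"
  shows "integrable lborel (\<lambda>\<tau>. indicator {0<..} \<tau> * (\<tau> powr (b - 1) / (1 + \<tau>)))"
proof (rule integrableI_nonneg)
  let ?F = "\<lambda>\<tau> w. ennreal (indicator {0<..} \<tau> * indicator {0<..} w * (exp (- ((1 + \<tau>) * w)) * \<tau> powr (b - 1)))"
  have "(\<integral>\<^sup>+\<tau>. ennreal (indicator {0<..} \<tau> * (\<tau> powr (b - 1) / (1 + \<tau>))) \<partial>lborel) = (\<integral>\<^sup>+\<tau>. (\<integral>\<^sup>+w. ?F \<tau> w \<partial>lborel) \<partial>lborel)"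
  proof (rule nn_integral_cong)
    fix \<tau> :: real
    show "ennreal (indicator {0<..} \<tau> * (\<tau> powr (b - 1) / (1 + \<tau>))) = (\<integral>\<^sup>+w. ?F \<tau> w \<partial>lborel)"
    proof (cases "\<tau> > 0")
      case True
      then have p: "1 + \<tau> > 0" by simp
      have "(\<integral>\<^sup>+w. ?F \<tau> w \<partial>lborel) = (\<integral>\<^sup>+w. ennreal (\<tau> powr (b - 1)) * ennreal (indicator {0<..} w * (exp (- ((1 + \<tau>) * w)) * (w powr (1 - 1)))) \<partial>lborel)"
        using True by (intro nn_integral_cong) (auto simp: ennreal_mult'[symmetric] indicator_def mult.commute)
      also have "\<dots> = ennreal (\<tau> powr (b - 1)) * (\<integral>\<^sup>+w. ennreal (indicator {0<..} w * (exp (- ((1 + \<tau>) * w)) * (w powr (1 - 1)))) \<partial>lborel)"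
        by (rule nn_integral_cmult) auto
      also have "\<dots> = ennreal (\<tau> powr (b - 1)) * ennreal (1 / (1 + \<tau>))"
        using laplace_nn_integral[OF laplaceable_powr[of 1] _ p] laplace_powr[of 1 "1 + \<tau>"] p
        by (simp add: powr_minus_divide)
      finally show ?thesis using True p by (simp add: ennreal_mult'[symmetric])
    qed simp
  qed
  also have "\<dots> = (\<integral>\<^sup>+w. (\<integral>\<^sup>+\<tau>. ?F \<tau> w \<partial>lborel) \<partial>lborel)"
    by (rule lborel_pair.Fubini') measurable
  also have "\<dots> = (\<integral>\<^sup>+w. ennreal (Gamma b) * ennreal (indicator {0<..} w * (exp (- (1 * w)) * w powr ((1 - b) - 1))) \<partial>lborel)"
  proof (rule nn_integral_cong)
    fix w :: real
    show "(\<integral>\<^sup>+\<tau>. ?F \<tau> w \<partial>lborel) = ennreal (Gamma b) * ennreal (indicator {0<..} w * (exp (- (1 * w)) * w powr ((1 - b) - 1)))"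
    proof (cases "w > 0")
      case True
      have "(\<integral>\<^sup>+\<tau>. ?F \<tau> w \<partial>lborel) = (\<integral>\<^sup>+\<tau>. ennreal (exp (- w)) * ennreal (indicator {0<..} \<tau> * (exp (- (w * \<tau>)) * \<tau> powr (b - 1))) \<partial>lborel)"
      proof (rule nn_integral_cong)
        fix \<tau> :: real
        have "exp (- ((1 + \<tau>) * w)) = exp (- w) * exp (- (w * \<tau>))" by (simp add: exp_add[symmetric] algebra_simps)
        then show "?F \<tau> w = ennreal (exp (- w)) * ennreal (indicator {0<..} \<tau> * (exp (- (w * \<tau>)) * \<tau> powr (b - 1)))"
          using True by (simp add: ennreal_mult'[symmetric] mult_ac)
      qed
      also have "\<dots> = ennreal (exp (- w)) * (\<integral>\<^sup>+\<tau>. ennreal (indicator {0<..} \<tau> * (exp (- (w * \<tau>)) * \<tau> powr (b - 1))) \<partial>lborel)"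
        by (rule nn_integral_cmult) auto
      also have "\<dots> = ennreal (exp (- w)) * ennreal (Gamma b * w powr (- b))"
        using laplace_nn_integral[OF laplaceable_powr[OF b(1)] _ True] laplace_powr[OF b(1) True] by simp
      finally show ?thesis using True Gamma_real_pos[OF b(1)] by (simp add: ennreal_mult'[symmetric] mult_ac)
    qed simp
  qed
  also have "\<dots> = ennreal (Gamma b) * (\<integral>\<^sup>+w. ennreal (indicator {0<..} w * (exp (- (1 * w)) * w powr ((1 - b) - 1))) \<partial>lborel)"
    by (rule nn_integral_cmult) auto
  also have "\<dots> = ennreal (Gamma b) * ennreal (laplace (\<lambda>w. w powr ((1 - b) - 1)) 1)"
    using b by (subst laplace_nn_integral[OF laplaceable_powr]) auto
  also have "\<dots> < \<infinity>" by (simp add: ennreal_mult_less_top)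
  finally show "(\<integral>\<^sup>+\<tau>. ennreal (indicator {0<..} \<tau> * (\<tau> powr (b - 1) / (1 + \<tau>))) \<partial>lborel) < \<infinity>" .
qed (auto intro!: AE_I2 simp: indicator_def)

text \<open>Local integrability of the inverse symbol, without polar coordinates: insert its representation as a
  superposition of Gaussians in \<open>\<xi>\<close> and integrate these first. What remains is at most a multiple of the integral
  of \<open>\<tau> powr (s - 1) / (1 + \<tau>) powr (n / 2)\<close>, which is finite because \<open>0 < s < 1\<close> and \<open>n \<ge> 2\<close>.\<close>

lemma integrable_inverse_symbol_gauss:
  assumes s: "0 < s" "s < 1" and n: "CARD('n::finite) \<ge> 2"
  shows "integrable lborel (\<lambda>\<xi>::real^'n. 1 / symbol s \<xi> * exp (- ((norm \<xi>)^2)))"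
proof (rule integrableI_nonneg)
  define h where "h = mittag_leffler (1 - s)"
  have a: "0 < 1 - s" "1 - s < 1" using s by auto
  have [measurable]: "h \<in> borel_measurable borel" unfolding h_def by measurable
  have hp: "h \<tau> \<ge> 0" for \<tau> unfolding h_def using a by (rule mittag_leffler_nonneg)
  obtain K where K: "\<And>\<tau>. \<tau> > 0 \<Longrightarrow> h \<tau> \<le> K * \<tau> powr (- (1 - s))" "K \<ge> 0" unfolding h_def using mittag_leffler_le[OF a] by metis
  let ?F = "\<lambda>(\<xi>::real^'n) \<tau>. ennreal (indicator {0<..} \<tau> * (exp (- ((1 + \<tau>) * (norm \<xi>)^2)) * h \<tau>))"
  have "(\<integral>\<^sup>+\<xi>. ennreal (1 / symbol s (\<xi>::real^'n) * exp (- ((norm \<xi>)^2))) \<partial>lborel) = (\<integral>\<^sup>+\<xi>. (\<integral>\<^sup>+\<tau>. ?F \<xi> \<tau> \<partial>lborel) \<partial>lborel)"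
  proof (rule nn_integral_cong_AE, rule AE_mp[OF AE_lborel_singleton[of "0::real^'n"]], intro AE_I2 impI)
    fix \<xi> :: "real^'n" assume x: "\<xi> \<noteq> 0"
    have "(\<integral>\<^sup>+\<tau>. ?F \<xi> \<tau> \<partial>lborel) = (\<integral>\<^sup>+\<tau>. ennreal (exp (- ((norm \<xi>)^2))) * ennreal (indicator {0<..} \<tau> * (exp (- ((norm \<xi>)^2 * \<tau>)) * h \<tau>)) \<partial>lborel)"
    proof (rule nn_integral_cong)
      fix \<tau> :: real
      have "exp (- ((1 + \<tau>) * (norm \<xi>)^2)) = exp (- ((norm \<xi>)^2)) * exp (- ((norm \<xi>)^2 * \<tau>))"
        by (simp add: exp_add[symmetric] algebra_simps)
      then show "?F \<xi> \<tau> = ennreal (exp (- ((norm \<xi>)^2))) * ennreal (indicator {0<..} \<tau> * (exp (- ((norm \<xi>)^2 * \<tau>)) * h \<tau>))"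
        by (simp add: ennreal_mult'[symmetric] mult_ac)
    qed
    also have "\<dots> = ennreal (exp (- ((norm \<xi>)^2))) * (\<integral>\<^sup>+\<tau>. ennreal (indicator {0<..} \<tau> * (exp (- ((norm \<xi>)^2 * \<tau>)) * h \<tau>)) \<partial>lborel)"
      by (rule nn_integral_cmult) auto
    also have "\<dots> = ennreal (exp (- ((norm \<xi>)^2))) * ennreal (1 / symbol s \<xi>)"
      using x laplace_nn_integral[OF mittag_leffler_laplaceable[OF a], of "(norm \<xi>)^2"] mittag_leffler_nonneg[OF a] inverse_symbol_laplace[OF s x]
      by (simp add: h_def)
    also have "\<dots> = ennreal (1 / symbol s \<xi> * exp (- ((norm \<xi>)^2)))"
      by (subst ennreal_mult'[symmetric]) (simp_all add: mult.commute)
    finally show "ennreal (1 / symbol s \<xi> * exp (- ((norm \<xi>)^2))) = (\<integral>\<^sup>+\<tau>. ?F \<xi> \<tau> \<partial>lborel)" ..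
  qed
  also have "\<dots> = (\<integral>\<^sup>+\<tau>. (\<integral>\<^sup>+\<xi>. ?F \<xi> \<tau> \<partial>lborel) \<partial>lborel)"
    by (rule lborel_pair.Fubini') measurable
  also have "\<dots> \<le> (\<integral>\<^sup>+\<tau>. ennreal (K * pi powr (CARD('n) / 2) * (indicator {0<..} \<tau> * (\<tau> powr (s - 1) / (1 + \<tau>)))) \<partial>lborel)"
  proof (rule nn_integral_mono)
    fix \<tau> :: real
    show "(\<integral>\<^sup>+\<xi>. ?F \<xi> \<tau> \<partial>lborel) \<le> ennreal (K * pi powr (CARD('n) / 2) * (indicator {0<..} \<tau> * (\<tau> powr (s - 1) / (1 + \<tau>))))"
    proof (cases "\<tau> > 0")
      case True
      then have p: "1 + \<tau> > 0" by simp
      have "(\<integral>\<^sup>+\<xi>. ?F \<xi> \<tau> \<partial>lborel) = (\<integral>\<^sup>+\<xi>. ennreal (h \<tau>) * ennreal (exp (- ((1 + \<tau>) * (norm (\<xi>::real^'n))^2))) \<partial>lborel)"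
        using True hp by (intro nn_integral_cong) (auto simp: ennreal_mult'[symmetric] mult.commute)
      also have "\<dots> = ennreal (h \<tau>) * (\<integral>\<^sup>+\<xi>. ennreal (exp (- ((1 + \<tau>) * (norm (\<xi>::real^'n))^2))) \<partial>lborel)"
        by (rule nn_integral_cmult) auto
      also have "(\<integral>\<^sup>+\<xi>. ennreal (exp (- ((1 + \<tau>) * (norm (\<xi>::real^'n))^2))) \<partial>lborel) = ennreal ((pi / (1 + \<tau>)) powr (CARD('n) / 2))"
        using gauss_integral[OF p, where 'a = "real^'n"]
        by (subst nn_integral_eq_integral) (auto simp: has_bochner_integral_iff)
      also have "ennreal (h \<tau>) * ennreal ((pi / (1 + \<tau>)) powr (CARD('n) / 2)) = ennreal (h \<tau> * (pi / (1 + \<tau>)) powr (CARD('n) / 2))"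
        using hp by (simp add: ennreal_mult'[symmetric])
      also have "\<dots> \<le> ennreal ((K * \<tau> powr (s - 1)) * (pi powr (CARD('n) / 2) * (1 / (1 + \<tau>))))"
      proof (intro ennreal_leI mult_mono)
        show "h \<tau> \<le> K * \<tau> powr (s - 1)" using K(1)[OF True] by simp
        have "(1 + \<tau>) powr 1 \<le> (1 + \<tau>) powr (CARD('n) / 2)" using True n by (intro powr_mono) auto
        then have "1 / (1 + \<tau>) powr (CARD('n) / 2) \<le> 1 / (1 + \<tau>)" using True by (intro divide_left_mono) auto
        then have "pi powr (CARD('n) / 2) * (1 / (1 + \<tau>) powr (CARD('n) / 2)) \<le> pi powr (CARD('n) / 2) * (1 / (1 + \<tau>))"
          by (intro mult_left_mono) auto
        then show "(pi / (1 + \<tau>)) powr (CARD('n) / 2) \<le> pi powr (CARD('n) / 2) * (1 / (1 + \<tau>))"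
          using True by (simp add: powr_divide)
      qed (use K True in auto)
      finally show ?thesis using True by (simp add: mult_ac)
    qed simp
  qed
  also have "\<dots> = ennreal (LINT \<tau>|lborel. K * pi powr (CARD('n) / 2) * (indicator {0<..} \<tau> * (\<tau> powr (s - 1) / (1 + \<tau>))))"
    using K(2) by (intro nn_integral_eq_integral integrable_mult_right integrable_powr_over_1_plus s) (auto intro!: AE_I2 simp: indicator_def)
  also have "\<dots> < \<infinity>" by simp
  finally show "(\<integral>\<^sup>+\<xi>. ennreal (1 / symbol s (\<xi>::real^'n) * exp (- ((norm \<xi>)^2))) \<partial>lborel) < \<infinity>" .
  show "AE \<xi>::real^'n in lborel. 0 \<le> 1 / symbol s \<xi> * exp (- ((norm \<xi>)^2))"
    by (intro AE_I2) (simp add: symbol_def)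
qed measurable

lemma integrable_inverse_symbol_weight:
  assumes s: "0 < s" "s < 1" and n: "CARD('n::finite) \<ge> 2"
  shows "integrable lborel (\<lambda>\<xi>::real^'n. norm (complex_of_real (1 / symbol s \<xi>)) * (1 / weight \<xi>))"
proof (rule Bochner_Integration.integrable_bound)
  show "integrable lborel (\<lambda>\<xi>::real^'n. exp 1 * (1 / symbol s \<xi> * exp (- ((norm \<xi>)^2))) + 1 / weight \<xi>)"
    by (intro Bochner_Integration.integrable_add integrable_mult_right integrable_inverse_symbol_gauss[OF assms] integrable_inverse_weight)
  have le: "norm (complex_of_real (1 / symbol s \<xi>)) * (1 / weight \<xi>) \<le> exp 1 * (1 / symbol s \<xi> * exp (- ((norm \<xi>)^2))) + 1 / weight \<xi>" for \<xi> :: "real^'n"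
  proof -
    have sp: "symbol s \<xi> \<ge> 0" by (simp add: symbol_def)
    have w: "0 < 1 / weight \<xi>" "1 / weight \<xi> \<le> 1" using weight_pos[of \<xi>] weight_ge_1[of \<xi>] by auto
    have n: "norm (complex_of_real (1 / symbol s \<xi>)) = 1 / symbol s \<xi>" unfolding norm_of_real using sp by simp
    show ?thesis
    proof (cases "norm \<xi> \<le> 1")
      case True
      then have "1 \<le> exp 1 * exp (- ((norm \<xi>)^2))" by (simp add: exp_add[symmetric] power_le_one)
      then have "1 / weight \<xi> \<le> exp 1 * exp (- ((norm \<xi>)^2))" using w(2) by linarith
      then have "1 / symbol s \<xi> * (1 / weight \<xi>) \<le> 1 / symbol s \<xi> * (exp 1 * exp (- ((norm \<xi>)^2)))"
        by (rule mult_left_mono) (use sp in simp)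
      moreover have "1 / symbol s \<xi> * (exp 1 * exp (- ((norm \<xi>)^2))) = exp 1 * (1 / symbol s \<xi> * exp (- ((norm \<xi>)^2)))"
        by (rule mult.left_commute)
      ultimately show ?thesis unfolding n using w(1) by linarith
    next
      case False
      then have "1 \<le> symbol s \<xi>" by (simp add: symbol_def add_increasing2)
      then have "1 / symbol s \<xi> * (1 / weight \<xi>) \<le> 1 * (1 / weight \<xi>)" using w by (intro mult_right_mono) auto
      moreover have "0 \<le> exp 1 * (1 / symbol s \<xi> * exp (- ((norm \<xi>)^2)))" using sp by simp
      ultimately show ?thesis unfolding n by linarith
    qed
  qed
  have "norm (norm (complex_of_real (1 / symbol s \<xi>)) * (1 / weight \<xi>))
      \<le> norm (exp 1 * (1 / symbol s \<xi> * exp (- ((norm \<xi>)^2))) + 1 / weight \<xi>)" for \<xi> :: "real^'n"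
  proof -
    have "0 \<le> norm (complex_of_real (1 / symbol s \<xi>)) * (1 / weight \<xi>)"
      using weight_pos[of \<xi>] by (intro mult_nonneg_nonneg) auto
    then show ?thesis unfolding real_norm_def using le[of \<xi>] by linarith
  qed
  then show "AE \<xi>::real^'n in lborel. norm (norm (complex_of_real (1 / symbol s \<xi>)) * (1 / weight \<xi>))
      \<le> norm (exp 1 * (1 / symbol s \<xi> * exp (- ((norm \<xi>)^2))) + 1 / weight \<xi>)"
    by (rule AE_I2)
qed measurable

lemma Gamma_distr_tempered:
  assumes s: "0 < s" "s < 1" and n: "CARD('n::finite) \<ge> 2"
  shows "tempered (Gamma_distr s :: 'n distr)"
  unfolding Gamma_distr_def by (intro inv_fourier_distr_tempered integrable_inverse_symbol_weight assms) measurable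

text \<open>The multiplier relation is immediate from \<open>symbol * (1 / symbol) = 1\<close> off the origin; the inversion
  formula identifies the Fourier transform of \<open>Gamma_distr\<close>.\<close>

lemma Gamma_distr_fundamental:
  assumes s: "0 < s" "s < 1" and n: "CARD('n::finite) \<ge> 2"
  shows "Ls s (Gamma_distr s :: 'n distr) delta0"
  unfolding Ls_def fourier_multiplier_def
proof (intro conjI exI)
  let ?m = "\<lambda>\<xi>::real^'n. complex_of_real (1 / symbol s \<xi>)"
  let ?u = "\<lambda>\<xi>::real^'n. complex_of_real (symbol s \<xi>) * ?m \<xi>"
  show "tempered (Gamma_distr s :: 'n distr)" by (rule Gamma_distr_tempered[OF assms])
  show "tempered delta0" by (rule tempered_delta0)
  show "tempered_function ?m"
    by (intro tempered_function_of_weight integrable_inverse_symbol_weight assms) measurable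
  have u: "AE \<xi> in lborel. ?u \<xi> = 1"
  proof (rule AE_mp[OF AE_lborel_singleton[of "0::real^'n"]], intro AE_I2 impI)
    fix \<xi> :: "real^'n" assume "\<xi> \<noteq> 0"
    then show "?u \<xi> = 1" using symbol_pos[of \<xi> s] by simp
  qed
  show "tempered_function ?u"
  proof (intro tempered_function_of_weight)
    show "integrable lborel (\<lambda>\<xi>. norm (?u \<xi>) * (1 / weight \<xi>))"
    proof (rule integrable_cong_AE_imp[OF integrable_inverse_weight])
      show "AE \<xi> in lborel. 1 / weight \<xi> = norm (?u \<xi>) * (1 / weight \<xi>)"
        by (rule AE_mp[OF u]) (intro AE_I2 impI, simp)
    qed measurable
  qed measurable
  show "eq_distr (fourier_distr (Gamma_distr s)) (distr_of ?m)"
    unfolding eq_distr_def fourier_distr_def Gamma_distr_def inv_fourier_distr_def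
  proof (intro allI impI)
    fix \<phi> :: "real^'n \<Rightarrow> complex" assume "schwartz \<phi>"
    then have "inv_fourier (fourier \<phi>) = \<phi>" by (intro ext fourier_inversion)
    then show "distr_of ?m (inv_fourier (fourier \<phi>)) = distr_of ?m \<phi>" by simp
  qed
  show "eq_distr (fourier_distr delta0) (distr_of ?u)"
    unfolding eq_distr_def
  proof (intro allI impI)
    fix \<phi> :: "real^'n \<Rightarrow> complex" assume \<phi>: "schwartz \<phi>"
    have [measurable]: "\<phi> \<in> borel_measurable borel" using schwartz_measurable[OF \<phi>, of "[]"] by simp
    have "integral\<^sup>L lborel \<phi> = (LINT \<xi>|lborel. ?u \<xi> * \<phi> \<xi>)"
    proof (rule integral_cong_AE)
      show "AE \<xi> in lborel. \<phi> \<xi> = ?u \<xi> * \<phi> \<xi>"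
        by (rule AE_mp[OF u]) (intro AE_I2 impI, simp)
    qed measurable
    then show "fourier_distr delta0 \<phi> = distr_of ?u \<phi>"
      by (simp add: fourier_delta0 distr_of_def)
  qed
qed

section \<open>Representation by a superposition of heat kernels\<close>

text \<open>The fundamental solution as a superposition of heat kernels.\<close>

definition Gamma_kernel :: "real \<Rightarrow> real^'n::finite \<Rightarrow> real" where
  "Gamma_kernel s x = heat (real CARD('n)) (mittag_leffler (1 - s)) ((norm x)^2)"

lemma mittag_leffler_heat_laplaceable:
  assumes s: "0 < s" "s < 1" and m: "m \<ge> 2"
  shows "laplaceable (heat_density m (mittag_leffler (1 - s)))"
proof -
  have a: "0 < 1 - s" "1 - s < 1" using s by auto
  obtain K where K: "\<And>\<tau>. \<tau> > 0 \<Longrightarrow> mittag_leffler (1 - s) \<tau> \<le> K * \<tau> powr (- (1 - s))" using mittag_leffler_le[OF a] by metis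
  show ?thesis
    using K mittag_leffler_nonneg[OF a] s m by (intro heat_laplaceable[of _ K "- (1 - s)"]) auto
qed

lemma laplace_mittag_leffler_inverted:
  assumes s: "0 < s" "s < 1" and lam: "lam > 0"
  shows "integrable lborel (\<lambda>v. indicator {0<..} v * (exp (- (lam / (4 * v))) * (mittag_leffler (1 - s) (1 / (4 * v)) / (4 * v^2))))"
    and "laplace (mittag_leffler (1 - s)) lam = (LINT v|lborel. indicator {0<..} v * (exp (- (lam / (4 * v))) * (mittag_leffler (1 - s) (1 / (4 * v)) / (4 * v^2))))"
proof -
  let ?g = "\<lambda>v::real. 1 / (4 * v)" and ?g' = "\<lambda>v::real. - 1 / (4 * v^2)"
  let ?f = "\<lambda>\<tau>. exp (- (lam * \<tau>)) * mittag_leffler (1 - s) \<tau>"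
  have a: "0 < 1 - s" "1 - s < 1" using s by auto
  have rng: "?g ` {0<..} = {0<..}"
  proof (intro equalityI subsetI)
    fix y :: real assume "y \<in> {0<..}"
    then show "y \<in> ?g ` {0<..}" by (intro image_eqI[of _ _ "1 / (4 * y)"]) auto
  qed auto
  have der: "(?g has_field_derivative ?g' v) (at v within {0<..})" if "v \<in> {0<..}" for v
    using that by (auto intro!: derivative_eq_intros simp: power2_eq_square)
  have inj: "inj_on ?g {0<..}" by (auto intro!: inj_onI)
  have l: "set_integrable lborel {0<..} ?f" using mittag_leffler_laplaceable[OF a] lam by (auto simp: laplaceable_def)
  have m: "?g \<in> borel_measurable borel" "?g' \<in> borel_measurable borel" "?f \<in> borel_measurable borel" by measurable
  have S: "{0::real<..} \<in> sets borel" by simp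
  note sub = lborel_substitution[OF S _ m(3,1,2) der inj, unfolded rng, OF S]
  have e: "indicator {0<..} v *\<^sub>R (\<bar>?g' v\<bar> * ?f (?g v)) = indicator {0<..} v * (exp (- (lam / (4 * v))) * (mittag_leffler (1 - s) (1 / (4 * v)) / (4 * v^2)))" for v
    by simp
  show "integrable lborel (\<lambda>v. indicator {0<..} v * (exp (- (lam / (4 * v))) * (mittag_leffler (1 - s) (1 / (4 * v)) / (4 * v^2))))"
    using sub(1) l unfolding set_integrable_def e by simp
  show "laplace (mittag_leffler (1 - s)) lam = (LINT v|lborel. indicator {0<..} v * (exp (- (lam / (4 * v))) * (mittag_leffler (1 - s) (1 / (4 * v)) / (4 * v^2))))"
    using sub(2)[OF _ l] unfolding laplace_def set_lebesgue_integral_def e by simp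
qed

lemma Gamma_kernel_measurable [measurable]: "Gamma_kernel s \<in> borel_measurable borel"
  unfolding Gamma_kernel_def[abs_def] heat_def by measurable

lemma Gamma_kernel_nonneg: "0 < s \<Longrightarrow> s < 1 \<Longrightarrow> Gamma_kernel s x \<ge> 0"
  unfolding Gamma_kernel_def heat_def heat_density_def by (intro laplace_nonneg) (simp add: mittag_leffler_nonneg)

text \<open>Fubini twice. First \<open>1 / symbol\<close> is replaced by its Gaussian superposition and the \<open>\<xi>\<close>-integral is
  done by the multiplication formula; then the \<open>v\<close>-integral of the resulting heat kernels is collected
  into \<open>Gamma_kernel\<close>. The second exchange needs only integrability of \<open>Gamma_kernel * \<phi>\<close>, since the
  integrand is nonnegative apart from the factor \<open>\<phi>\<close>.\<close>

lemma Gamma_distr_kernel: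
  fixes \<phi> :: "real^'n::finite \<Rightarrow> complex"
  assumes s: "0 < s" "s < 1" and n: "CARD('n) \<ge> 2" and \<phi>: "schwartz \<phi>"
    and int: "integrable lborel (\<lambda>x. complex_of_real (Gamma_kernel s x) * \<phi> x)"
  shows "Gamma_distr s \<phi> = distr_of (\<lambda>x. complex_of_real (Gamma_kernel s x)) \<phi>"
proof -
  \<comment> \<open>The Mittag-Leffler function after the substitution \<open>\<tau> = 1 / (4 * v)\<close>, with the Jacobian.\<close>
  define W where "W = (\<lambda>v. indicator {0<..} v * (mittag_leffler (1 - s) (1 / (4 * v)) / (4 * v^2)))"
  have a: "0 < 1 - s" "1 - s < 1" using s by auto
  have W[measurable]: "W \<in> borel_measurable borel" unfolding W_def by measurable
  have Wp: "W v \<ge> 0" for v unfolding W_def using mittag_leffler_nonneg[OF a] by simp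
  let ?m = "\<lambda>\<xi>::real^'n. complex_of_real (1 / symbol s \<xi>)"
  have ip: "integrable lborel \<phi>" using schwartz_integrable[OF \<phi>, of "[]"] by simp
  have [measurable]: "\<phi> \<in> borel_measurable borel" using schwartz_measurable[OF \<phi>, of "[]"] by simp
  define \<psi> where "\<psi> = inv_fourier \<phi>"
  have psm[measurable]: "\<psi> \<in> borel_measurable borel" unfolding \<psi>_def by (rule inv_fourier_measurable) simp
  obtain C where C: "\<And>\<xi>. norm (\<psi> \<xi>) \<le> C * (1 / weight \<xi>)"
    unfolding \<psi>_def using inv_fourier_decay[where 'n = 'n] \<phi> by metis
  have im: "integrable lborel (\<lambda>\<xi>. ?m \<xi> * \<psi> \<xi>)"
    by (rule integrable_times_inverse_weight(1)[OF _ psm integrable_inverse_symbol_weight[OF s n] C]) measurable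
  let ?F = "\<lambda>(\<xi>::real^'n) v. complex_of_real (exp (- ((norm \<xi>)^2 / (4 * v)))) * complex_of_real (W v) * \<psi> \<xi>"
  have L: "integrable lborel (\<lambda>v. exp (- ((norm \<xi>)^2 / (4 * v))) * W v)"
    "(LINT v|lborel. exp (- ((norm \<xi>)^2 / (4 * v))) * W v) = 1 / symbol s \<xi>" if "\<xi> \<noteq> 0" for \<xi> :: "real^'n"
    using laplace_mittag_leffler_inverted[OF s, of "(norm \<xi>)^2"] that inverse_symbol_laplace[OF s that]
    by (simp_all add: W_def mult.left_commute)
  have ae: "AE \<xi> in lborel. (\<xi> :: real^'n) \<noteq> 0" by (rule AE_lborel_singleton)
  have int1: "integrable (lborel \<Otimes>\<^sub>M lborel) (\<lambda>(\<xi>, v). ?F \<xi> v)"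
  proof (rule lborel_pair.Fubini_integrable)
    show "(\<lambda>(\<xi>, v). ?F \<xi> v) \<in> borel_measurable (lborel \<Otimes>\<^sub>M lborel)" by measurable
    have nF: "norm (?F \<xi> v) = exp (- ((norm \<xi>)^2 / (4 * v))) * W v * norm (\<psi> \<xi>)" for \<xi> v
      using Wp by (simp add: norm_mult)
    show "integrable lborel (\<lambda>\<xi>. LINT v|lborel. norm (case (\<xi>, v) of (\<xi>, v) \<Rightarrow> ?F \<xi> v))"
      unfolding split_conv nF integral_mult_left_zero
    proof (rule integrable_cong_AE_imp[OF integrable_norm[OF im]])
      show "AE \<xi> in lborel. norm (?m \<xi> * \<psi> \<xi>) = (LINT v|lborel. exp (- ((norm \<xi>)^2 / (4 * v))) * W v) * norm (\<psi> \<xi>)"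
      proof (rule AE_mp[OF ae], intro AE_I2 impI)
        fix \<xi> :: "real^'n" assume "\<xi> \<noteq> 0"
        then show "norm (?m \<xi> * \<psi> \<xi>) = (LINT v|lborel. exp (- ((norm \<xi>)^2 / (4 * v))) * W v) * norm (\<psi> \<xi>)"
          using symbol_pos[of \<xi> s] unfolding L(2)[OF \<open>\<xi> \<noteq> 0\<close>] norm_mult norm_of_real by simp
      qed
    qed measurable
    show "AE \<xi> in lborel. integrable lborel (\<lambda>v. case (\<xi>, v) of (\<xi>, v) \<Rightarrow> ?F \<xi> v)"
      unfolding split_conv
    proof (rule AE_mp[OF ae], intro AE_I2 impI)
      fix \<xi> :: "real^'n" assume "\<xi> \<noteq> 0"
      then have "integrable lborel (\<lambda>v. complex_of_real (exp (- ((norm \<xi>)^2 / (4 * v))) * W v) * \<psi> \<xi>)"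
        using L(1)[of \<xi>] by (intro integrable_mult_left integrable_of_real)
      then show "integrable lborel (?F \<xi>)" by simp
    qed
  qed
  have "Gamma_distr s \<phi> = (LINT \<xi>|lborel. ?m \<xi> * \<psi> \<xi>)"
    by (simp add: Gamma_distr_def inv_fourier_distr_def distr_of_def \<psi>_def)
  also have "\<dots> = (LINT \<xi>|lborel. (LINT v|lborel. ?F \<xi> v))"
  proof (rule integral_cong_AE)
    show "AE \<xi> in lborel. ?m \<xi> * \<psi> \<xi> = (LINT v|lborel. ?F \<xi> v)"
    proof (rule AE_mp[OF ae], intro AE_I2 impI)
      fix \<xi> :: "real^'n" assume x: "\<xi> \<noteq> 0"
      have "(LINT v|lborel. ?F \<xi> v) = (LINT v|lborel. complex_of_real (exp (- ((norm \<xi>)^2 / (4 * v))) * W v)) * \<psi> \<xi>"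
        unfolding of_real_mult by (rule integral_mult_left_zero)
      also have "(LINT v|lborel. complex_of_real (exp (- ((norm \<xi>)^2 / (4 * v))) * W v)) = complex_of_real (1 / symbol s \<xi>)"
        unfolding integral_complex_of_real L(2)[OF x] ..
      finally show "?m \<xi> * \<psi> \<xi> = (LINT v|lborel. ?F \<xi> v)" ..
    qed
  qed measurable
  also have "\<dots> = (LINT v|lborel. (LINT \<xi>|lborel. ?F \<xi> v))"
    by (rule lborel_pair.Fubini_integral[symmetric]) (use int1 in simp)
  also have "\<dots> = (LINT v|lborel. (LINT x|lborel. complex_of_real (indicator {0<..} v * (exp (- ((norm x)^2 * v)) * heat_density (CARD('n)) (mittag_leffler (1 - s)) v)) * \<phi> x))"
  proof (rule Bochner_Integration.integral_cong[OF refl])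
    fix v :: real
    show "(LINT \<xi>|lborel. ?F \<xi> v) = (LINT x|lborel. complex_of_real (indicator {0<..} v * (exp (- ((norm x)^2 * v)) * heat_density (CARD('n)) (mittag_leffler (1 - s)) v)) * \<phi> x)"
    proof (cases "v > 0")
      case True
      have "(LINT \<xi>|lborel. ?F \<xi> v) = complex_of_real (W v) * (LINT \<xi>|lborel. complex_of_real (exp (- ((norm \<xi>)^2 / (4 * v)))) * \<psi> \<xi>)"
        by (subst integral_mult_right_zero[symmetric]) (simp only: mult_ac)
      also have "\<dots> = complex_of_real (W v) * (LINT x|lborel. complex_of_real ((v / pi) powr (CARD('n) / 2) * exp (- (v * (norm x)^2))) * \<phi> x)"
        unfolding \<psi>_def inv_fourier_gauss_pairing[OF ip True] ..
      also have "\<dots> = (LINT x|lborel. complex_of_real (indicator {0<..} v * (exp (- ((norm x)^2 * v)) * heat_density (CARD('n)) (mittag_leffler (1 - s)) v)) * \<phi> x)"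
        unfolding integral_mult_right_zero[symmetric]
        using True by (intro Bochner_Integration.integral_cong refl) (simp add: W_def heat_density_def mult_ac)
      finally show ?thesis .
    qed (simp add: W_def)
  qed
  also have "\<dots> = (LINT x|lborel. (LINT v|lborel. complex_of_real (indicator {0<..} v * (exp (- ((norm x)^2 * v)) * heat_density (CARD('n)) (mittag_leffler (1 - s)) v)) * \<phi> x))"
  proof (rule lborel_pair.Fubini_integral)
    let ?H = "\<lambda>x v. indicator {0<..} v * (exp (- ((norm x)^2 * v)) * heat_density (CARD('n)) (mittag_leffler (1 - s)) v)"
    have Hp: "?H x v \<ge> 0" for x :: "real^'n" and v
      using mittag_leffler_nonneg[OF a] by (simp add: heat_density_def)
    have Hi: "integrable lborel (?H x)" if "x \<noteq> 0" for x :: "real^'n"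
      using that n by (intro laplaceable_integrable mittag_leffler_heat_laplaceable s) auto
    have Hv: "(LINT v|lborel. ?H x v) = Gamma_kernel s x" for x :: "real^'n"
      by (simp add: Gamma_kernel_def heat_def laplace_def set_lebesgue_integral_def)
    show "integrable (lborel \<Otimes>\<^sub>M lborel) (\<lambda>(x, v). complex_of_real (?H x v) * \<phi> x)"
    proof (rule lborel_pair.Fubini_integrable)
      show "(\<lambda>(x, v). complex_of_real (?H x v) * \<phi> x) \<in> borel_measurable (lborel \<Otimes>\<^sub>M lborel)" by measurable
      have nH: "norm (complex_of_real (?H x v) * \<phi> x) = ?H x v * norm (\<phi> x)" for x v
        unfolding norm_mult norm_of_real using Hp[of v x] by (simp only: abs_of_nonneg)
      have "norm (complex_of_real (Gamma_kernel s x) * \<phi> x) = Gamma_kernel s x * norm (\<phi> x)" for x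
        using Gamma_kernel_nonneg[OF s, of x] by (simp add: norm_mult)
      then show "integrable lborel (\<lambda>x. LINT v|lborel. norm (case (x, v) of (x, v) \<Rightarrow> complex_of_real (?H x v) * \<phi> x))"
        unfolding split_conv nH integral_mult_left_zero Hv using integrable_norm[OF int] by simp
      show "AE x in lborel. integrable lborel (\<lambda>v. case (x, v) of (x, v) \<Rightarrow> complex_of_real (?H x v) * \<phi> x)"
        unfolding split_conv
        by (rule AE_mp[OF ae]) (intro AE_I2 impI integrable_mult_left integrable_of_real Hi)
    qed
  qed
  also have "\<dots> = distr_of (\<lambda>x. complex_of_real (Gamma_kernel s x)) \<phi>"
    unfolding distr_of_def integral_mult_left_zero integral_complex_of_real
    by (simp add: Gamma_kernel_def heat_def laplace_def set_lebesgue_integral_def)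
  finally show ?thesis .
qed

lemma Gamma_kernel_represents:
  assumes s: "0 < s" "s < 1" and n: "CARD('n::finite) \<ge> 2"
    and cont: "continuous_on (- {0}) (Gamma_kernel s :: real^'n \<Rightarrow> real)"
  shows "represented_on (- {0}) (Gamma_distr s :: 'n distr) (\<lambda>x. complex_of_real (Gamma_kernel s x))"
  unfolding represented_on_def
proof (intro conjI allI impI)
  let ?k = "\<lambda>x::real^'n. complex_of_real (Gamma_kernel s x)"
  have c: "continuous_on (- {0}) ?k" using cont by (rule continuous_on_of_real)
  show "locally_integrable_on (- {0}) ?k"
    unfolding locally_integrable_on_def set_integrable_def
  proof (intro allI impI)
    fix K :: "(real^'n) set" assume K: "compact K \<and> K \<subseteq> - {0}"
    have "continuous_on K ?k" by (rule continuous_on_subset[OF c]) (use K in simp)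
    then show "integrable lborel (\<lambda>x. indicator K x *\<^sub>R ?k x)" using K by (intro borel_integrable_compact) auto
  qed
  fix \<phi> :: "real^'n \<Rightarrow> complex" assume t: "test_function_on (- {0}) \<phi>"
  let ?K = "closure {x. \<phi> x \<noteq> 0}"
  have K: "compact ?K" "?K \<subseteq> - {0}" using t by (auto simp: test_function_on_def)
  have sch: "schwartz \<phi>" by (rule test_function_schwartz[OF t])
  have "integrable lborel (\<lambda>x. indicator ?K x *\<^sub>R (?k x * \<phi> x))"
  proof (rule borel_integrable_compact[OF K(1)])
    have "continuous_on UNIV \<phi>" using schwartz_continuous[OF sch, of "[]"] by simp
    then show "continuous_on ?K (\<lambda>x. ?k x * \<phi> x)"
      using K by (intro continuous_intros continuous_on_subset[OF c]) (auto intro: continuous_on_subset)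
  qed
  also have "(\<lambda>x. indicator ?K x *\<^sub>R (?k x * \<phi> x)) = (\<lambda>x. ?k x * \<phi> x)"
    using closure_subset[of "{x. \<phi> x \<noteq> 0}"] by (auto simp: indicator_def fun_eq_iff)
  finally show "Gamma_distr s \<phi> = distr_of ?k \<phi>"
    by (rule Gamma_distr_kernel[OF s n sch])
qed

section \<open>Smoothness and gradient of radial Laplace transforms\<close>

lemma has_derivative_radial:
  fixes x :: "'a::real_inner"
  assumes "(g has_real_derivative d) (at ((norm x)^2))"
  shows "((\<lambda>x. g ((norm x)^2)) has_derivative (\<lambda>h. d * (2 * (x \<bullet> h)))) (at x)"
proof -
  have "((\<lambda>x::'a. (norm x)^2) has_derivative (\<lambda>h. 2 * (x \<bullet> h))) (at x)"
    unfolding power2_norm_eq_inner by (auto intro!: derivative_eq_intros simp: inner_commute)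
  from has_derivative_compose[OF this, of g "(*) d"] assms show ?thesis
    by (simp add: has_field_derivative_def)
qed

text \<open>An algebra of functions that contains \<open>\<lambda>x. laplace q ((norm x)\<^sup>2)\<close> and is closed under partial
  derivatives off the origin: differentiating the transform of \<open>v ^ k * q v\<close> in direction \<open>i\<close>
  gives \<open>- 2 * x\<^sub>i\<close> times a transform of the same form. Smoothness follows.\<close>

inductive radial_laplace_poly :: "(real \<Rightarrow> real) \<Rightarrow> (real^'n::finite \<Rightarrow> real) \<Rightarrow> bool" for q where
  moment: "radial_laplace_poly q (\<lambda>x. laplace (\<lambda>v. v ^ k * q v) ((norm x)^2))"
| const: "radial_laplace_poly q (\<lambda>x. c)"
| coord: "radial_laplace_poly q (\<lambda>x. x $ i)"
| add: "radial_laplace_poly q f \<Longrightarrow> radial_laplace_poly q g \<Longrightarrow> radial_laplace_poly q (\<lambda>x. f x + g x)"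
| mult: "radial_laplace_poly q f \<Longrightarrow> radial_laplace_poly q g \<Longrightarrow> radial_laplace_poly q (\<lambda>x. f x * g x)"

lemma laplaceable_moment: "laplaceable q \<Longrightarrow> laplaceable (\<lambda>v. v ^ k * q v)"
proof (induction k)
  case (Suc k)
  from laplaceable_times[OF Suc.IH[OF Suc.prems]] show ?case by (simp add: mult.assoc)
qed simp

lemma radial_laplace_poly_derivative:
  fixes f :: "real^'n::finite \<Rightarrow> real"
  assumes q: "laplaceable q" and f: "radial_laplace_poly q f"
  shows "(\<forall>x\<in>-{0}. f differentiable (at x)) \<and> (\<forall>i. \<exists>g. radial_laplace_poly q g \<and> (\<forall>x\<in>-{0}. partial i f x = g x))"
  using f
proof (induction rule: radial_laplace_poly.induct)
  case (moment k)
  let ?f = "\<lambda>x::real^'n. laplace (\<lambda>v. v ^ k * q v) ((norm x)^2)"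
  have d: "(?f has_derivative (\<lambda>h. - laplace (\<lambda>v. v ^ Suc k * q v) ((norm x)^2) * (2 * (x \<bullet> h)))) (at x)" if "x \<in> - {0}" for x
    using laplace_deriv[OF laplaceable_moment[OF q], of "(norm x)^2" k] that
    by (intro has_derivative_radial) (simp add: mult.assoc)
  let ?g = "\<lambda>i (x::real^'n). (- 2) * x $ i * laplace (\<lambda>v. v ^ Suc k * q v) ((norm x)^2)"
  have g: "radial_laplace_poly q (?g i)" for i
    by (intro radial_laplace_poly.intros)
  have p: "partial i ?f x = ?g i x" if "x \<in> - {0}" for i x
    using partial_eq_derivative[OF d[OF that], of i] by (simp add: inner_axis)
  show ?case
  proof (intro conjI ballI allI)
    show "?f differentiable (at x)" if "x \<in> - {0}" for x
      unfolding differentiable_def by (rule exI) (rule d[OF that])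
    show "\<exists>g. radial_laplace_poly q g \<and> (\<forall>x\<in>-{0}. partial i ?f x = g x)" for i
      by (intro exI[of _ "?g i"] conjI ballI g p)
  qed
next
  case (const c)
  have "partial i (\<lambda>x::real^'n. c) x = 0" for i and x :: "real^'n"
    using partial_eq_derivative[OF has_derivative_const[of c "at x"]] by simp
  then show ?case by (intro conjI allI ballI exI[of _ "\<lambda>_. 0"] radial_laplace_poly.const differentiable_const)
next
  case (coord j)
  have d: "((\<lambda>x::real^'n. x $ j) has_derivative (\<lambda>x. x $ j)) (at x)" for x
    by (intro bounded_linear.has_derivative[OF bounded_linear_vec_nth] has_derivative_ident)
  show ?case
  proof (intro conjI ballI allI)
    show "(\<lambda>x::real^'n. x $ j) differentiable (at x)" for x
      unfolding differentiable_def by (rule exI) (rule d)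
    show "\<exists>g. radial_laplace_poly q g \<and> (\<forall>x\<in>-{0}. partial i (\<lambda>x::real^'n. x $ j) x = g x)" for i
      by (intro exI[of _ "\<lambda>_. axis i 1 $ j"] conjI ballI radial_laplace_poly.const partial_eq_derivative[OF d])
  qed
next
  case (add f g)
  have p: "partial i (\<lambda>x. f x + g x) x = partial i f x + partial i g x" if x: "x \<in> - {0}" for i x
  proof -
    from add x obtain D E where D: "(f has_derivative D) (at x)" and E: "(g has_derivative E) (at x)" by (meson differentiable_def)
    show ?thesis
      unfolding partial_eq_derivative[OF D] partial_eq_derivative[OF E] partial_eq_derivative[OF has_derivative_add[OF D E]] ..
  qed
  show ?case
  proof (intro conjI allI)
    show "\<forall>x\<in>-{0}. (\<lambda>x. f x + g x) differentiable (at x)" using add by auto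
    fix i
    obtain f' g' where "radial_laplace_poly q f'" "\<forall>x\<in>-{0}. partial i f x = f' x" "radial_laplace_poly q g'" "\<forall>x\<in>-{0}. partial i g x = g' x"
      using add by blast
    then show "\<exists>h. radial_laplace_poly q h \<and> (\<forall>x\<in>-{0}. partial i (\<lambda>x. f x + g x) x = h x)"
      by (intro exI[of _ "\<lambda>x. f' x + g' x"]) (auto simp: p intro: radial_laplace_poly.add)
  qed
next
  case (mult f g)
  have p: "partial i (\<lambda>x. f x * g x) x = f x * partial i g x + partial i f x * g x" if x: "x \<in> - {0}" for i x
  proof -
    from mult x obtain D E where D: "(f has_derivative D) (at x)" and E: "(g has_derivative E) (at x)" by (meson differentiable_def)
    show ?thesis
      unfolding partial_eq_derivative[OF D] partial_eq_derivative[OF E] partial_eq_derivative[OF has_derivative_mult[OF D E]] ..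
  qed
  show ?case
  proof (intro conjI allI)
    show "\<forall>x\<in>-{0}. (\<lambda>x. f x * g x) differentiable (at x)" using mult by auto
    fix i
    obtain f' g' where "radial_laplace_poly q f'" "\<forall>x\<in>-{0}. partial i f x = f' x" "radial_laplace_poly q g'" "\<forall>x\<in>-{0}. partial i g x = g' x"
      using mult by blast
    then show "\<exists>h. radial_laplace_poly q h \<and> (\<forall>x\<in>-{0}. partial i (\<lambda>x. f x * g x) x = h x)"
      using mult by (intro exI[of _ "\<lambda>x. f x * g' x + f' x * g x"]) (auto simp: p intro: radial_laplace_poly.intros)
  qed
qed

lemma radial_laplace_poly_smooth:
  fixes f :: "real^'n::finite \<Rightarrow> real"
  assumes q: "laplaceable q" and f: "radial_laplace_poly q f"
  shows "smooth_on (- {0}) f"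
proof -
  have op: "open (- {0::real^'n})" by auto
  have "\<exists>g. radial_laplace_poly q g \<and> (\<forall>x\<in>-{0}. iter_partial is f x = g x)" for "is"
  proof (induction "is")
    case Nil
    then show ?case using f by auto
  next
    case (Cons i "is")
    then obtain g where g: "radial_laplace_poly q g" "\<forall>x\<in>-{0}. iter_partial is f x = g x" by blast
    obtain g' where g': "radial_laplace_poly q g'" "\<forall>x\<in>-{0}. partial i g x = g' x"
      using radial_laplace_poly_derivative[OF q g(1)] by blast
    have "iter_partial (i # is) f x = g' x" if "x \<in> - {0}" for x
      using partial_cong_open[OF op that, of "iter_partial is f" g i] g(2) g'(2) that by simp
    then show ?case using g'(1) by blast
  qed
  then have "iter_partial is f differentiable (at x)" if "x \<in> - {0}" for "is" x
  proof -
    obtain g where g: "radial_laplace_poly q g" "\<forall>x\<in>-{0}. iter_partial is f x = g x"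
      using \<open>\<And>is. \<exists>g. radial_laplace_poly q g \<and> (\<forall>x\<in>-{0}. iter_partial is f x = g x)\<close> by blast
    then obtain D where "(g has_derivative D) (at x)"
      using radial_laplace_poly_derivative[OF q g(1)] \<open>x \<in> - {0}\<close> by (meson differentiable_def)
    then have "(iter_partial is f has_derivative D) (at x)"
      by (rule has_derivative_transform_within_open[OF _ op that]) (use g in auto)
    then show ?thesis by (auto simp: differentiable_def)
  qed
  then show ?thesis using op by (simp add: smooth_on_def)
qed

lemma Gamma_kernel_smooth:
  assumes s: "0 < s" "s < 1" and n: "CARD('n::finite) \<ge> 2"
  shows "smooth_on (- {0}) (Gamma_kernel s :: real^'n \<Rightarrow> real)"
proof -
  let ?q = "heat_density (real CARD('n)) (mittag_leffler (1 - s))"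
  have "laplaceable ?q" using n by (intro mittag_leffler_heat_laplaceable s) auto
  moreover have "Gamma_kernel s = (\<lambda>x::real^'n. laplace (\<lambda>v. v ^ 0 * ?q v) ((norm x)^2))"
    by (simp add: Gamma_kernel_def[abs_def] heat_def)
  ultimately show ?thesis using radial_laplace_poly_smooth[OF _ radial_laplace_poly.moment] by metis
qed

lemma grad_Gamma_kernel:
  fixes x :: "real^'n::finite"
  assumes s: "0 < s" "s < 1" and n: "CARD('n) \<ge> 2" and x: "x \<noteq> 0"
  shows "grad (Gamma_kernel s) x = (- (2 * pi) * heat (real CARD('n) + 2) (mittag_leffler (1 - s)) ((norm x)^2)) *\<^sub>R x"
proof -
  let ?d = "- pi * heat (real CARD('n) + 2) (mittag_leffler (1 - s)) ((norm x)^2)"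
  have "(heat (real CARD('n)) (mittag_leffler (1 - s)) has_real_derivative ?d) (at ((norm x)^2))"
    using x n by (intro heat_deriv mittag_leffler_heat_laplaceable s) auto
  then have "(Gamma_kernel s has_derivative (\<lambda>h. ?d * (2 * (x \<bullet> h)))) (at x)"
    unfolding Gamma_kernel_def[abs_def] by (rule has_derivative_radial)
  from partial_eq_derivative[OF this] show ?thesis
    by (simp add: vec_eq_iff grad_def inner_axis)
qed

section \<open>From power bounds to expansions\<close>

lemma smallo_at_0_powr:
  fixes F :: "'a::real_normed_vector \<Rightarrow> real"
  assumes bd: "\<And>x. x \<noteq> 0 \<Longrightarrow> \<bar>F x\<bar> \<le> C * norm x powr p" and pq: "q < p"
  shows "F \<in> o[at 0](\<lambda>x. norm x powr q)"
proof -
  have "F \<in> O[at 0](\<lambda>x. norm x powr p)"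
    using bd by (intro bigoI[of _ C]) (auto simp: eventually_at_filter)
  moreover have "(\<lambda>x::'a. norm x powr p) \<in> o[at 0](\<lambda>x. norm x powr q)"
  proof (rule smalloI_tendsto)
    have "((\<lambda>x::'a. norm x powr (p - q)) \<longlongrightarrow> 0 powr (p - q)) (at 0)"
      using pq by (intro tendsto_powr' tendsto_const tendsto_norm_zero tendsto_ident_at) auto
    then show "((\<lambda>x::'a. norm x powr p / norm x powr q) \<longlongrightarrow> 0) (at 0)" by (simp add: powr_diff)
  qed (auto simp: eventually_at_filter)
  ultimately show ?thesis by (rule landau_o.big_small_trans)
qed

lemma smallo_at_infinity_powr:
  fixes F :: "'a::real_normed_vector \<Rightarrow> real"
  assumes bd: "\<And>x. x \<noteq> 0 \<Longrightarrow> \<bar>F x\<bar> \<le> C * norm x powr p" and pq: "p < q"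
  shows "F \<in> o[at_infinity](\<lambda>x. norm x powr q)"
proof -
  have ev: "\<forall>\<^sub>F x::'a in at_infinity. x \<noteq> 0" by (auto simp: eventually_at_infinity intro!: exI[of _ 1])
  have "F \<in> O[at_infinity](\<lambda>x. norm x powr p)"
    using bd by (intro bigoI[of _ C] eventually_mono[OF ev]) auto
  moreover have "(\<lambda>x::'a. norm x powr p) \<in> o[at_infinity](\<lambda>x. norm x powr q)"
  proof (rule smalloI_tendsto)
    have "((\<lambda>x::'a. norm x powr (p - q)) \<longlongrightarrow> 0) at_infinity"
      using pq by (intro tendsto_neg_powr filterlim_norm_at_top) auto
    then show "((\<lambda>x::'a. norm x powr p / norm x powr q) \<longlongrightarrow> 0) at_infinity" by (simp add: powr_diff)
    show "\<forall>\<^sub>F x::'a in at_infinity. norm x powr q \<noteq> 0" by (rule eventually_mono[OF ev]) simp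
  qed
  ultimately show ?thesis by (rule landau_o.big_small_trans)
qed

lemma bigo_at_0_one:
  fixes F :: "'a::real_normed_vector \<Rightarrow> real"
  assumes bd: "\<And>x. x \<noteq> 0 \<Longrightarrow> \<bar>F x\<bar> \<le> B + C * norm x powr p" and p: "p \<ge> 0"
  shows "F \<in> O[at 0](\<lambda>_. 1)"
proof (rule bigoI[of _ "\<bar>B\<bar> + \<bar>C\<bar>"])
  have "\<bar>F x\<bar> \<le> \<bar>B\<bar> + \<bar>C\<bar>" if x: "x \<noteq> 0" "norm x < 1" for x
  proof -
    have "norm x powr p \<le> 1" using x p by (intro powr_le1) auto
    then have "\<bar>C\<bar> * norm x powr p \<le> \<bar>C\<bar> * 1" by (intro mult_left_mono) auto
    moreover have "C * norm x powr p \<le> \<bar>C\<bar> * norm x powr p" by (intro mult_right_mono) auto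
    ultimately show ?thesis using bd[OF x(1)] by linarith
  qed
  then show "\<forall>\<^sub>F x in at 0. norm (F x) \<le> (\<bar>B\<bar> + \<bar>C\<bar>) * norm (1::real)"
    by (auto simp: eventually_at intro!: exI[of _ 1])
qed

lemma norm_square_powr: "x \<noteq> 0 \<Longrightarrow> ((norm x)^2) powr y = norm x powr (2 * y)"
  by (simp add: powr_powr[symmetric] powr_numeral)

context
  fixes s :: real
  assumes s: "0 < s" "s < 1"
begin

lemma Gamma_kernel_expansion:
  fixes A B C \<alpha> \<beta> \<gamma> :: real
  assumes bd: "\<forall>\<tau>>0. \<bar>mittag_leffler (1 - s) \<tau> - (A * \<tau> powr \<alpha> / Gamma (1 + \<alpha>) + B * \<tau> powr \<beta> / Gamma (1 + \<beta>))\<bar> \<le> C * \<tau> powr \<gamma>"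
    and e: "\<alpha> < CARD('n) / 2 - 1" "\<beta> < CARD('n) / 2 - 1" "\<gamma> < CARD('n) / 2 - 1"
  obtains C' where "\<And>x::real^'n::finite. x \<noteq> 0 \<Longrightarrow>
    \<bar>Gamma_kernel s x - (A * kappa CARD('n) (2 * \<alpha> + 2) * norm x powr (2 * \<alpha> + 2 - CARD('n))
       + B * kappa CARD('n) (2 * \<beta> + 2) * norm x powr (2 * \<beta> + 2 - CARD('n)))\<bar> \<le> C' * norm x powr (2 * \<gamma> + 2 - CARD('n))"
proof -
  obtain C' where C': "\<And>\<rho>. \<rho> > 0 \<Longrightarrow> \<bar>heat CARD('n) (mittag_leffler (1 - s)) \<rho> - (A * kappa CARD('n) (2 * \<alpha> + 2) * \<rho> powr (\<alpha> + 1 - CARD('n) / 2)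
      + B * kappa CARD('n) (2 * \<beta> + 2) * \<rho> powr (\<beta> + 1 - CARD('n) / 2))\<bar> \<le> C' * \<rho> powr (\<gamma> + 1 - CARD('n) / 2)"
    using heat_expansion[OF mittag_leffler_measurable bd[rule_format] e] by blast
  have ex: "2 * (y + 1 - CARD('n) / 2) = 2 * y + 2 - CARD('n)" for y :: real by simp
  show ?thesis
  proof (rule that)
    fix x :: "real^'n" assume x: "x \<noteq> 0"
    then have "(norm x)^2 > 0" by simp
    from C'[OF this] show "\<bar>Gamma_kernel s x - (A * kappa CARD('n) (2 * \<alpha> + 2) * norm x powr (2 * \<alpha> + 2 - CARD('n))
       + B * kappa CARD('n) (2 * \<beta> + 2) * norm x powr (2 * \<beta> + 2 - CARD('n)))\<bar> \<le> C' * norm x powr (2 * \<gamma> + 2 - CARD('n))"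
      unfolding norm_square_powr[OF x] ex Gamma_kernel_def .
  qed
qed

lemma grad_Gamma_kernel_expansion:
  fixes A B C \<alpha> \<beta> \<gamma> :: real
  assumes n: "CARD('n) \<ge> 2"
    and bd: "\<forall>\<tau>>0. \<bar>mittag_leffler (1 - s) \<tau> - (A * \<tau> powr \<alpha> / Gamma (1 + \<alpha>) + B * \<tau> powr \<beta> / Gamma (1 + \<beta>))\<bar> \<le> C * \<tau> powr \<gamma>"
    and e: "\<alpha> < CARD('n) / 2" "\<beta> < CARD('n) / 2" "\<gamma> < CARD('n) / 2"
  obtains C' where "\<And>x::real^'n::finite. x \<noteq> 0 \<Longrightarrow>
    norm (grad (Gamma_kernel s) x - (- (A * (2 * pi * kappa (CARD('n) + 2) (2 * \<alpha> + 2)) * norm x powr (2 * \<alpha> - CARD('n))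
       + B * (2 * pi * kappa (CARD('n) + 2) (2 * \<beta> + 2)) * norm x powr (2 * \<beta> - CARD('n)))) *\<^sub>R x) \<le> C' * norm x powr (2 * \<gamma> + 1 - CARD('n))"
proof -
  let ?m = "CARD('n) + 2"
  have e': "\<alpha> < ?m / 2 - 1" "\<beta> < ?m / 2 - 1" "\<gamma> < ?m / 2 - 1" using e by (simp_all add: field_simps)
  obtain C' where C': "\<And>\<rho>. \<rho> > 0 \<Longrightarrow> \<bar>heat ?m (mittag_leffler (1 - s)) \<rho> - (A * kappa ?m (2 * \<alpha> + 2) * \<rho> powr (\<alpha> + 1 - ?m / 2)
      + B * kappa ?m (2 * \<beta> + 2) * \<rho> powr (\<beta> + 1 - ?m / 2))\<bar> \<le> C' * \<rho> powr (\<gamma> + 1 - ?m / 2)"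
    using heat_expansion[OF mittag_leffler_measurable bd[rule_format] e'] by blast
  have ex: "2 * (y + 1 - ?m / 2) = 2 * y - CARD('n)" for y :: real by (simp add: field_simps)
  show ?thesis
  proof (rule that)
    fix x :: "real^'n" assume x: "x \<noteq> 0"
    define H where "H = heat ?m (mittag_leffler (1 - s)) ((norm x)^2)"
    define M where "M = A * kappa ?m (2 * \<alpha> + 2) * norm x powr (2 * \<alpha> - CARD('n)) + B * kappa ?m (2 * \<beta> + 2) * norm x powr (2 * \<beta> - CARD('n))"
    have "(norm x)^2 > 0" using x by simp
    from C'[OF this] have HM: "\<bar>H - M\<bar> \<le> C' * norm x powr (2 * \<gamma> - CARD('n))"
      unfolding norm_square_powr[OF x] ex H_def M_def .
    have g: "grad (Gamma_kernel s) x = (- (2 * pi) * H) *\<^sub>R x"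
      unfolding H_def of_nat_add of_nat_numeral by (rule grad_Gamma_kernel[OF s n x])
    have "A * (2 * pi * kappa (CARD('n) + 2) (2 * \<alpha> + 2)) * norm x powr (2 * \<alpha> - CARD('n))
       + B * (2 * pi * kappa (CARD('n) + 2) (2 * \<beta> + 2)) * norm x powr (2 * \<beta> - CARD('n)) = 2 * pi * M"
      by (simp add: M_def algebra_simps)
    then have "grad (Gamma_kernel s) x - (- (A * (2 * pi * kappa (CARD('n) + 2) (2 * \<alpha> + 2)) * norm x powr (2 * \<alpha> - CARD('n))
       + B * (2 * pi * kappa (CARD('n) + 2) (2 * \<beta> + 2)) * norm x powr (2 * \<beta> - CARD('n)))) *\<^sub>R x
       = (- (2 * pi) * (H - M)) *\<^sub>R x"
      unfolding g by (simp only: scaleR_diff_left[symmetric]) (simp add: algebra_simps)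
    then have "norm (grad (Gamma_kernel s) x - (- (A * (2 * pi * kappa (CARD('n) + 2) (2 * \<alpha> + 2)) * norm x powr (2 * \<alpha> - CARD('n))
       + B * (2 * pi * kappa (CARD('n) + 2) (2 * \<beta> + 2)) * norm x powr (2 * \<beta> - CARD('n)))) *\<^sub>R x) = 2 * pi * \<bar>H - M\<bar> * norm x"
      by (simp add: abs_mult)
    also have "\<dots> \<le> 2 * pi * (C' * norm x powr (2 * \<gamma> - CARD('n))) * norm x"
      using HM by (intro mult_right_mono mult_left_mono) auto
    also have "\<dots> = (2 * pi * C') * (norm x * norm x powr (2 * \<gamma> - CARD('n)))" by simp
    also have "norm x * norm x powr (2 * \<gamma> - CARD('n)) = norm x powr (2 * \<gamma> + 1 - CARD('n))"
      using x powr_mult_base[of "norm x" "2 * \<gamma> - CARD('n)"] by (simp add: algebra_simps)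
    finally show "norm (grad (Gamma_kernel s) x - (- (A * (2 * pi * kappa (CARD('n) + 2) (2 * \<alpha> + 2)) * norm x powr (2 * \<alpha> - CARD('n))
       + B * (2 * pi * kappa (CARD('n) + 2) (2 * \<beta> + 2)) * norm x powr (2 * \<beta> - CARD('n)))) *\<^sub>R x) \<le> (2 * pi * C') * norm x powr (2 * \<gamma> + 1 - CARD('n))" .
  qed
qed

text \<open>The form in which \<open>heat_expansion\<close> applies: the constant \<open>1\<close> is \<open>\<tau> powr 0 / Gamma (1 + 0)\<close>.\<close>

lemma mittag_leffler_small_expansion:
  assumes "1 - s < e" "e < 1" "e \<le> 2 * (1 - s)"
  obtains C where "\<And>\<tau>. \<tau> > 0 \<Longrightarrow>
    \<bar>mittag_leffler (1 - s) \<tau> - (1 * \<tau> powr 0 / Gamma (1 + 0) + (- 1) * \<tau> powr (1 - s) / Gamma (1 + (1 - s)))\<bar> \<le> C * \<tau> powr e"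
proof -
  have a: "0 < 1 - s" "1 - s < 1" using s by auto
  obtain C where "\<And>\<tau>. \<tau> > 0 \<Longrightarrow> \<bar>mittag_leffler (1 - s) \<tau> - (1 - \<tau> powr (1 - s) / Gamma (1 + (1 - s)))\<bar> \<le> C * \<tau> powr e"
    using mittag_leffler_small[OF a assms] by metis
  then show ?thesis by (intro that[of C]) simp
qed

text \<open>Where the second term of the expansion of the Mittag-Leffler function is not integrable against the
  heat kernel of dimension \<open>m\<close>, it still is in dimension \<open>m + 2\<close>, that is, for the derivative.
  Integration recovers the expansion up to a constant \<open>L\<close>.\<close>

lemma heat_primitive:
  assumes m: "m \<ge> 2" and g: "g > 0"
    and bd: "\<And>\<rho>. \<rho> > 0 \<Longrightarrow> \<bar>heat (m + 2) (mittag_leffler (1 - s)) \<rho> - M \<rho>\<bar> \<le> C * \<rho> powr (g - 1)"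
    and P: "\<And>\<rho>. \<rho> > 0 \<Longrightarrow> (P has_real_derivative - pi * M \<rho>) (at \<rho>)"
  shows "\<exists>L. \<forall>\<rho>>0. \<bar>heat m (mittag_leffler (1 - s)) \<rho> - (P \<rho> + L)\<bar> \<le> pi * C / g * \<rho> powr g"
proof -
  have "\<exists>L. \<forall>\<rho>>0. \<bar>(heat m (mittag_leffler (1 - s)) \<rho> - P \<rho>) - L\<bar> \<le> pi * C / g * \<rho> powr g"
  proof (rule integrate_bound[OF _ _ g])
    fix \<rho> :: real assume r: "\<rho> > 0"
    show "((\<lambda>\<rho>. heat m (mittag_leffler (1 - s)) \<rho> - P \<rho>) has_real_derivative (- pi * heat (m + 2) (mittag_leffler (1 - s)) \<rho> - - pi * M \<rho>)) (at \<rho>)"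
      using r m by (intro DERIV_diff P heat_deriv mittag_leffler_heat_laplaceable s) auto
    have "\<bar>- pi * heat (m + 2) (mittag_leffler (1 - s)) \<rho> - - pi * M \<rho>\<bar> = pi * \<bar>heat (m + 2) (mittag_leffler (1 - s)) \<rho> - M \<rho>\<bar>"
    proof -
      have "- pi * heat (m + 2) (mittag_leffler (1 - s)) \<rho> - - pi * M \<rho> = (- pi) * (heat (m + 2) (mittag_leffler (1 - s)) \<rho> - M \<rho>)"
        by (simp add: algebra_simps)
      then show ?thesis by (simp only: abs_mult abs_minus_cancel) simp
    qed
    also have "\<dots> \<le> pi * (C * \<rho> powr (g - 1))" using bd[OF r] by (intro mult_left_mono) auto
    finally show "\<bar>- pi * heat (m + 2) (mittag_leffler (1 - s)) \<rho> - - pi * M \<rho>\<bar> \<le> pi * C * \<rho> powr (g - 1)" by (simp add: mult.assoc)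
  qed
  then show ?thesis by (simp add: diff_diff_eq)
qed

end

section \<open>Asymptotic expansions of the fundamental solution\<close>

lemma sphere_area_2: "sphere_area 2 = 2 * pi"
  by (simp add: sphere_area_def)

lemma pi_powr_half_odd: "pi powr (3 / 2) = pi * sqrt pi" "pi powr (5 / 2) = pi^2 * sqrt pi"
proof -
  show "pi powr (3 / 2) = pi * sqrt pi" using powr_add[of pi 1 "1 / 2"] by (simp add: powr_half_sqrt)
  show "pi powr (5 / 2) = pi^2 * sqrt pi" using powr_add[of pi 2 "1 / 2"] by (simp add: powr_half_sqrt powr_numeral)
qed

lemma sphere_area_3: "sphere_area 3 = 4 * pi"
  by (simp add: sphere_area_def Gamma_three_halves pi_powr_half_odd)

lemma kappa_5_3: "2 * pi * kappa 5 3 = 1 / (2 * pi^2)"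
proof -
  have "kappa 5 3 = 1 / (8 * (pi^2 * sqrt pi) * (sqrt pi / 2))"
    by (simp add: kappa_def Gamma_three_halves pi_powr_half_odd powr_numeral)
  also have "8 * (pi^2 * sqrt pi) * (sqrt pi / 2) = 4 * pi^3"
    by (simp add: power2_eq_square power3_eq_cube)
  finally show ?thesis by (simp add: power2_eq_square power3_eq_cube)
qed

context
  fixes s :: real
  assumes s: "0 < s" "s < 1"
begin

lemma small_exponent:
  assumes "1 - s < b"
  obtains e where "1 - s < e" "e < 1" "e \<le> 2 * (1 - s)" "e < b"
proof
  define c where "c = min (min 1 (2 * (1 - s))) b"
  have "1 - s < c" using s assms by (simp add: c_def)
  then show "1 - s < (1 - s + c) / 2" "(1 - s + c) / 2 < 1" "(1 - s + c) / 2 \<le> 2 * (1 - s)" "(1 - s + c) / 2 < b"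
    using s by (auto simp: c_def)
qed

lemma Gamma_kernel_at_0:
  assumes n: "CARD('n::finite) \<ge> 3" "4 - 2 * s < real CARD('n)"
  shows "(\<lambda>x::real^'n. Gamma_kernel s x - (norm x powr (2 - real CARD('n)) / ((real CARD('n) - 2) * sphere_area CARD('n))
        - kappa CARD('n) (4 - 2 * s) * norm x powr (4 - 2 * s - real CARD('n))))
      \<in> o[at 0](\<lambda>x. norm x powr (4 - 2 * s - real CARD('n)))"
proof -
  obtain e where e: "1 - s < e" "e < 1" "e \<le> 2 * (1 - s)" "e < CARD('n) / 2 - 1"
    using small_exponent[of "CARD('n) / 2 - 1"] n by auto
  have lt: "0 < real CARD('n) / 2 - 1" "1 - s < real CARD('n) / 2 - 1" "e < real CARD('n) / 2 - 1" using n e s by auto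
  obtain C where C: "\<forall>\<tau>>0. \<bar>mittag_leffler (1 - s) \<tau> - (1 * \<tau> powr 0 / Gamma (1 + 0) + (- 1) * \<tau> powr (1 - s) / Gamma (1 + (1 - s)))\<bar> \<le> C * \<tau> powr e"
    using mittag_leffler_small_expansion[OF s e(1-3)] by metis
  obtain C' where C': "\<And>x::real^'n. x \<noteq> 0 \<Longrightarrow>
    \<bar>Gamma_kernel s x - (1 * kappa CARD('n) (2 * 0 + 2) * norm x powr (2 * 0 + 2 - real CARD('n))
       + (- 1) * kappa CARD('n) (2 * (1 - s) + 2) * norm x powr (2 * (1 - s) + 2 - real CARD('n)))\<bar> \<le> C' * norm x powr (2 * e + 2 - real CARD('n))"
    using Gamma_kernel_expansion[OF s C lt] by metis
  show ?thesis
  proof (rule smallo_at_0_powr)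
    fix x :: "real^'n" assume x: "x \<noteq> 0"
    have "2 * (1 - s) + 2 = 4 - 2 * s" by simp
    then show "\<bar>Gamma_kernel s x - (norm x powr (2 - real CARD('n)) / ((real CARD('n) - 2) * sphere_area CARD('n))
        - kappa CARD('n) (4 - 2 * s) * norm x powr (4 - 2 * s - real CARD('n)))\<bar> \<le> C' * norm x powr (2 * e + 2 - real CARD('n))"
      using C'[OF x] kappa_two[OF n(1)] by simp
  qed (use e in simp)
qed

lemma grad_Gamma_kernel_at_0:
  assumes n: "CARD('n::finite) \<ge> 2" "real CARD('n) \<noteq> 4 - 2 * s"
  shows "(\<lambda>x::real^'n. norm (grad (Gamma_kernel s) x - (- ((1 / (sphere_area CARD('n) * norm x ^ CARD('n))) *\<^sub>R x)
                    - ((4 - 2 * s - real CARD('n)) * kappa CARD('n) (4 - 2 * s)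
                        * norm x powr (2 - 2 * s - real CARD('n))) *\<^sub>R x)))
          \<in> o[at 0](\<lambda>x. norm x powr (3 - 2 * s - real CARD('n)))"
proof -
  obtain e where e: "1 - s < e" "e < 1" "e \<le> 2 * (1 - s)" "e < 1"
    using small_exponent[of 1] s by auto
  have lt: "0 < real CARD('n) / 2" "1 - s < real CARD('n) / 2" "e < real CARD('n) / 2" using n e s by auto
  obtain C where C: "\<forall>\<tau>>0. \<bar>mittag_leffler (1 - s) \<tau> - (1 * \<tau> powr 0 / Gamma (1 + 0) + (- 1) * \<tau> powr (1 - s) / Gamma (1 + (1 - s)))\<bar> \<le> C * \<tau> powr e"
    using mittag_leffler_small_expansion[OF s e(1-3)] by metis
  obtain C' where C': "\<And>x::real^'n. x \<noteq> 0 \<Longrightarrow>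
    norm (grad (Gamma_kernel s) x - (- (1 * (2 * pi * kappa (CARD('n) + 2) (2 * 0 + 2)) * norm x powr (2 * 0 - real CARD('n))
       + (- 1) * (2 * pi * kappa (CARD('n) + 2) (2 * (1 - s) + 2)) * norm x powr (2 * (1 - s) - real CARD('n)))) *\<^sub>R x) \<le> C' * norm x powr (2 * e + 1 - real CARD('n))"
    using grad_Gamma_kernel_expansion[OF s n(1) C lt] by metis
  have k: "2 * pi * kappa (CARD('n) + 2) (4 - 2 * s) = (real CARD('n) - (4 - 2 * s)) * kappa CARD('n) (4 - 2 * s)"
    using n s by (intro kappa_add_2) auto
  have k2: "2 * pi * kappa (CARD('n) + 2) 2 = 1 / sphere_area CARD('n)" by (rule kappa_add_2_two) simp
  show ?thesis
  proof (rule smallo_at_0_powr)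
    fix x :: "real^'n" assume x: "x \<noteq> 0"
    have e1: "2 * (1 - s) + 2 = 4 - 2 * s" "2 * (1 - s) - real CARD('n) = 2 - 2 * s - real CARD('n)" "2 * 0 + 2 = (2::real)" "2 * 0 - real CARD('n) = - real CARD('n)" by simp_all
    have "norm x powr (- real CARD('n)) = 1 / norm x ^ CARD('n)" using x by (simp add: powr_minus_divide powr_realpow)
    then have "(- ((1 / (sphere_area CARD('n) * norm x ^ CARD('n))) *\<^sub>R x) - ((4 - 2 * s - real CARD('n)) * kappa CARD('n) (4 - 2 * s) * norm x powr (2 - 2 * s - real CARD('n))) *\<^sub>R x)
      = (- (1 * (1 / sphere_area CARD('n)) * norm x powr (- real CARD('n)) + (- 1) * ((real CARD('n) - (4 - 2 * s)) * kappa CARD('n) (4 - 2 * s)) * norm x powr (2 - 2 * s - real CARD('n)))) *\<^sub>R x"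
      by (simp only: scaleR_minus_left[symmetric] scaleR_diff_left[symmetric]) (simp add: algebra_simps)
    then show "\<bar>norm (grad (Gamma_kernel s) x - (- ((1 / (sphere_area CARD('n) * norm x ^ CARD('n))) *\<^sub>R x) - ((4 - 2 * s - real CARD('n)) * kappa CARD('n) (4 - 2 * s) * norm x powr (2 - 2 * s - real CARD('n))) *\<^sub>R x))\<bar>
      \<le> C' * norm x powr (2 * e + 1 - real CARD('n))"
      using C'[OF x] unfolding e1 k k2 by (simp only: abs_norm_cancel)
  qed (use e in simp)
qed

text \<open>Dimensions \<open>2\<close> and \<open>3\<close>, where \<open>1 - s > n / 2 - 1\<close> and the expansion at the origin contains an
  undetermined constant. The leading term \<open>P\<close> is left open as a primitive, because it is a logarithm
  in dimension \<open>2\<close> and a power in dimension \<open>3\<close>.\<close>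

lemma heat_constant_term:
  fixes n :: nat
  assumes n: "n \<ge> 2" "real n / 2 - 1 < 1 - s"
    and P: "\<forall>\<rho>>0. (P has_real_derivative - (pi * kappa (n + 2) 2 * \<rho> powr (- real n / 2))) (at \<rho>)"
  obtains L C g where "g > (1 - s) + 1 - n / 2"
    "\<And>\<rho>. \<rho> > 0 \<Longrightarrow> \<bar>heat n (mittag_leffler (1 - s)) \<rho> - (P \<rho> + L - kappa n (4 - 2 * s) * \<rho> powr ((1 - s) + 1 - n / 2))\<bar> \<le> C * \<rho> powr g"
proof -
  obtain e where e: "1 - s < e" "e < 1" "e \<le> 2 * (1 - s)" "e < 1"
    using small_exponent[of 1] s by auto
  have lt: "0 < real (n + 2) / 2 - 1" "1 - s < real (n + 2) / 2 - 1" "e < real (n + 2) / 2 - 1" using n e s by (auto simp: add_divide_distrib)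
  obtain C where C: "\<forall>\<tau>>0. \<bar>mittag_leffler (1 - s) \<tau> - (1 * \<tau> powr 0 / Gamma (1 + 0) + (- 1) * \<tau> powr (1 - s) / Gamma (1 + (1 - s)))\<bar> \<le> C * \<tau> powr e"
    using mittag_leffler_small_expansion[OF s e(1-3)] by metis
  define M where "M = (\<lambda>\<rho>. 1 * kappa (n + 2) (2 * 0 + 2) * \<rho> powr (0 + 1 - real (n + 2) / 2)
      + (- 1) * kappa (n + 2) (2 * (1 - s) + 2) * \<rho> powr ((1 - s) + 1 - real (n + 2) / 2))"
  obtain C' where C': "\<And>\<rho>. \<rho> > 0 \<Longrightarrow> \<bar>heat (n + 2) (mittag_leffler (1 - s)) \<rho> - M \<rho>\<bar> \<le> C' * \<rho> powr (e + 1 - real (n + 2) / 2)"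
    using heat_expansion[OF mittag_leffler_measurable C[rule_format] lt] unfolding M_def by blast
  define g where "g = e + 1 - n / 2"
  have g: "g > 0" using e n by (simp add: g_def)
  \<comment> \<open>A primitive of \<open>- pi\<close> times the expansion in dimension \<open>n + 2\<close>; its second term vanishes at \<open>0\<close>.\<close>
  define Q where "Q = (\<lambda>\<rho>. P \<rho> - kappa n (4 - 2 * s) * \<rho> powr ((1 - s) + 1 - n / 2))"
  have k: "2 * pi * kappa (n + 2) (4 - 2 * s) = (real n - (4 - 2 * s)) * kappa n (4 - 2 * s)"
    using n s by (intro kappa_add_2) auto
  have "\<exists>L. \<forall>\<rho>>0. \<bar>heat n (mittag_leffler (1 - s)) \<rho> - (Q \<rho> + L)\<bar> \<le> pi * C' / g * \<rho> powr g"
  proof (rule heat_primitive[OF s _ g])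
    show "\<bar>heat (real n + 2) (mittag_leffler (1 - s)) \<rho> - M \<rho>\<bar> \<le> C' * \<rho> powr (g - 1)" if "\<rho> > 0" for \<rho>
    proof -
      have ex: "e + 1 - real (n + 2) / 2 = g - 1" by (simp add: g_def field_simps)
      have m: "real (n + 2) = real n + 2" by simp
      show ?thesis using C'[OF that] unfolding ex unfolding m .
    qed
    show "(Q has_real_derivative - pi * M \<rho>) (at \<rho>)" if r: "\<rho> > 0" for \<rho>
    proof -
      let ?c = "(1 - s) + 1 - real n / 2"
      have "(Q has_real_derivative - (pi * kappa (n + 2) 2 * \<rho> powr (- real n / 2)) - kappa n (4 - 2 * s) * (?c * \<rho> powr (?c - 1))) (at \<rho>)"
        unfolding Q_def by (intro DERIV_diff P[rule_format] DERIV_cmult has_real_derivative_powr r)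
      moreover have "- (pi * kappa (n + 2) 2 * \<rho> powr (- real n / 2)) - kappa n (4 - 2 * s) * (?c * \<rho> powr (?c - 1)) = - pi * M \<rho>"
      proof -
        have ex: "0 + 1 - real (n + 2) / 2 = - real n / 2" "(1 - s) + 1 - real (n + 2) / 2 = ?c - 1" "2 * (1 - s) + 2 = 4 - 2 * s" "2 * 0 + 2 = (2::real)"
          by (simp_all add: field_simps)
        have "kappa n (4 - 2 * s) * ?c = - (pi * kappa (n + 2) (4 - 2 * s))"
          using k by (simp add: field_simps)
        then have "kappa n (4 - 2 * s) * (?c * \<rho> powr (?c - 1)) = - (pi * kappa (n + 2) (4 - 2 * s)) * \<rho> powr (?c - 1)"
          by (simp only: mult.assoc[symmetric])
        then show ?thesis unfolding M_def ex by (simp add: algebra_simps)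
      qed
      ultimately show ?thesis by (simp only:)
    qed
  qed (use n in simp)
  then obtain L where L: "\<forall>\<rho>>0. \<bar>heat n (mittag_leffler (1 - s)) \<rho> - (Q \<rho> + L)\<bar> \<le> pi * C' / g * \<rho> powr g" by blast
  show ?thesis
  proof (rule that)
    show "g > (1 - s) + 1 - n / 2" using e by (simp add: g_def)
    fix \<rho> :: real assume "\<rho> > 0"
    then show "\<bar>heat n (mittag_leffler (1 - s)) \<rho> - (P \<rho> + L - kappa n (4 - 2 * s) * \<rho> powr ((1 - s) + 1 - n / 2))\<bar> \<le> pi * C' / g * \<rho> powr g"
      using L by (simp add: Q_def algebra_simps)
  qed
qed

lemma Gamma_kernel_at_0_dim_3:
  assumes n: "CARD('n::finite) = 3" "s < 1 / 2"
  shows "\<exists>C. (\<lambda>x::real^'n. Gamma_kernel s x - (1 / (4 * pi * norm x) + C - kappa 3 (4 - 2 * s) * norm x powr (1 - 2 * s)))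
     \<in> o[at 0](\<lambda>x. norm x powr (1 - 2 * s))"
proof -
  let ?P = "\<lambda>\<rho>. 1 / (4 * pi) * \<rho> powr (- 1 / 2)"
  have "kappa (3 + 2) 2 = 1 / (8 * pi^2)"
    using kappa_add_2_two[of 3] by (simp add: sphere_area_3 power2_eq_square field_simps)
  then have k: "pi * kappa (3 + 2) 2 = 1 / (8 * pi)" by (simp add: power2_eq_square)
  have P: "\<forall>\<rho>>0. (?P has_real_derivative - (pi * kappa (3 + 2) 2 * \<rho> powr (- real 3 / 2))) (at \<rho>)"
  proof (intro allI impI)
    fix \<rho> :: real assume r: "\<rho> > 0"
    have "\<rho> powr (- 3 / 2) = \<rho> powr (- 1 / 2) / \<rho>" using r powr_diff[of \<rho> "- 1 / 2" 1] by simp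
    then show "(?P has_real_derivative - (pi * kappa (3 + 2) 2 * \<rho> powr (- real 3 / 2))) (at \<rho>)"
      unfolding k using r by (auto intro!: derivative_eq_intros)
  qed
  have lt: "real 3 / 2 - 1 < 1 - s" using n by simp
  have n2: "3 \<ge> (2 :: nat)" by simp
  obtain L C g where g: "g > (1 - s) + 1 - real 3 / 2"
    and b: "\<And>\<rho>. \<rho> > 0 \<Longrightarrow> \<bar>heat (real 3) (mittag_leffler (1 - s)) \<rho> - (?P \<rho> + L - kappa 3 (4 - 2 * s) * \<rho> powr ((1 - s) + 1 - real 3 / 2))\<bar> \<le> C * \<rho> powr g"
    by (rule heat_constant_term[OF n2 lt P]) (rule that)
  show ?thesis
  proof (intro exI smallo_at_0_powr)
    fix x :: "real^'n" assume x: "x \<noteq> 0"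
    then have "(norm x)^2 > 0" by simp
    note b' = b[OF this, unfolded norm_square_powr[OF x]]
    have "2 * ((1 - s) + 1 - real 3 / 2) = 1 - 2 * s" "2 * (- 1 / 2) = (- 1 :: real)" by simp_all
    moreover have "1 / (4 * pi) * norm x powr - 1 = 1 / (4 * pi * norm x)" using x by (simp add: powr_minus_divide)
    ultimately show "\<bar>Gamma_kernel s x - (1 / (4 * pi * norm x) + L - kappa 3 (4 - 2 * s) * norm x powr (1 - 2 * s))\<bar> \<le> C * norm x powr (2 * g)"
      using b' unfolding Gamma_kernel_def n(1) by simp
  qed (use g in simp)
qed

lemma Gamma_kernel_at_0_dim_2:
  assumes n: "CARD('n::finite) = 2"
  shows "\<exists>C. (\<lambda>x::real^'n. Gamma_kernel s x - (1 / (2 * pi) * ln (1 / norm x) + C - kappa 2 (4 - 2 * s) * norm x powr (2 - 2 * s)))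
     \<in> o[at 0](\<lambda>x. norm x powr (2 - 2 * s))"
proof -
  let ?P = "\<lambda>\<rho>. - (1 / (4 * pi)) * ln \<rho>"
  have k: "pi * kappa (2 + 2) 2 = 1 / (4 * pi)"
    using kappa_add_2_two[of 2] by (simp add: sphere_area_2 field_simps)
  have P: "\<forall>\<rho>>0. (?P has_real_derivative - (pi * kappa (2 + 2) 2 * \<rho> powr (- real 2 / 2))) (at \<rho>)"
    unfolding k by (auto intro!: derivative_eq_intros simp: powr_minus_divide)
  have lt: "real 2 / 2 - 1 < 1 - s" using s by simp
  have n2: "2 \<ge> (2 :: nat)" by simp
  obtain L C g where g: "g > (1 - s) + 1 - real 2 / 2"
    and b: "\<And>\<rho>. \<rho> > 0 \<Longrightarrow> \<bar>heat (real 2) (mittag_leffler (1 - s)) \<rho> - (?P \<rho> + L - kappa 2 (4 - 2 * s) * \<rho> powr ((1 - s) + 1 - real 2 / 2))\<bar> \<le> C * \<rho> powr g"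
    by (rule heat_constant_term[OF n2 lt P]) (rule that)
  show ?thesis
  proof (intro exI smallo_at_0_powr)
    fix x :: "real^'n" assume x: "x \<noteq> 0"
    then have "(norm x)^2 > 0" by simp
    note b' = b[OF this, unfolded norm_square_powr[OF x]]
    have "2 * ((1 - s) + 1 - real 2 / 2) = 2 - 2 * s" by simp
    moreover have "- (1 / (4 * pi)) * ln ((norm x)^2) = 1 / (2 * pi) * ln (1 / norm x)" using x by (simp add: ln_realpow ln_div)
    ultimately show "\<bar>Gamma_kernel s x - (1 / (2 * pi) * ln (1 / norm x) + L - kappa 2 (4 - 2 * s) * norm x powr (2 - 2 * s))\<bar> \<le> C * norm x powr (2 * g)"
      using b' unfolding Gamma_kernel_def n(1) by simp
  qed (use g in simp)
qed

lemma Gamma_kernel_at_infinity: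
  assumes n: "CARD('n::finite) \<ge> 2"
  shows "(\<lambda>x::real^'n. Gamma_kernel s x - (kappa CARD('n) (2 * s) * norm x powr (2 * s - real CARD('n))
                    - kappa CARD('n) (4 * s - 2) * norm x powr (4 * s - 2 - real CARD('n))))
          \<in> o[at_infinity](\<lambda>x. norm x powr (4 * s - 2 - real CARD('n)))" (is ?V)
    and "(\<lambda>x::real^'n. norm (grad (Gamma_kernel s) x
                    - (- (((real CARD('n) - 2 * s) * kappa CARD('n) (2 * s)
                           * (1 / norm x powr (real CARD('n) + 2 - 2 * s))) *\<^sub>R x)
                       + ((real CARD('n) + 2 - 4 * s) * kappa CARD('n) (4 * s - 2)
                           * (1 / norm x powr (real CARD('n) + 4 - 4 * s))) *\<^sub>R x)))
          \<in> o[at_infinity](\<lambda>x. norm x powr (4 * s - 3 - real CARD('n)))" (is ?G)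
proof -
  have a: "0 < 1 - s" "1 - s < 1" using s by auto
  let ?\<alpha> = "- (1 - s)" and ?\<beta> = "- (2 * (1 - s))" and ?\<gamma> = "- (3 * (1 - s))"
  obtain C where "\<And>\<tau>. \<tau> > 0 \<Longrightarrow>
    \<bar>mittag_leffler (1 - s) \<tau> - (\<tau> powr ?\<alpha> / Gamma (1 - (1 - s)) - \<tau> powr ?\<beta> / Gamma (1 - 2 * (1 - s)))\<bar> \<le> C * \<tau> powr ?\<gamma>"
    using mittag_leffler_large[OF a] by metis
  then have C: "\<forall>\<tau>>0. \<bar>mittag_leffler (1 - s) \<tau> - (1 * \<tau> powr ?\<alpha> / Gamma (1 + ?\<alpha>) + (- 1) * \<tau> powr ?\<beta> / Gamma (1 + ?\<beta>))\<bar> \<le> C * \<tau> powr ?\<gamma>"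
    by simp
  have lt: "?\<alpha> < real CARD('n) / 2 - 1" "?\<beta> < real CARD('n) / 2 - 1" "?\<gamma> < real CARD('n) / 2 - 1"
    "?\<alpha> < real CARD('n) / 2" "?\<beta> < real CARD('n) / 2" "?\<gamma> < real CARD('n) / 2" using s n by auto
  have ex: "2 * ?\<alpha> + 2 = 2 * s" "2 * ?\<beta> + 2 = 4 * s - 2" by simp_all
  show ?V
  proof -
    obtain C' where C': "\<And>x::real^'n. x \<noteq> 0 \<Longrightarrow>
      \<bar>Gamma_kernel s x - (1 * kappa CARD('n) (2 * ?\<alpha> + 2) * norm x powr (2 * ?\<alpha> + 2 - real CARD('n))
         + (- 1) * kappa CARD('n) (2 * ?\<beta> + 2) * norm x powr (2 * ?\<beta> + 2 - real CARD('n)))\<bar> \<le> C' * norm x powr (2 * ?\<gamma> + 2 - real CARD('n))"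
      using Gamma_kernel_expansion[OF s C lt(1-3)] by metis
    show ?thesis
    proof (rule smallo_at_infinity_powr)
      fix x :: "real^'n" assume x: "x \<noteq> 0"
      show "\<bar>Gamma_kernel s x - (kappa CARD('n) (2 * s) * norm x powr (2 * s - real CARD('n))
                    - kappa CARD('n) (4 * s - 2) * norm x powr (4 * s - 2 - real CARD('n)))\<bar> \<le> C' * norm x powr (2 * ?\<gamma> + 2 - real CARD('n))"
        using C'[OF x] unfolding ex by simp
    qed (use s in simp)
  qed
  show ?G
  proof -
    obtain C' where C': "\<And>x::real^'n. x \<noteq> 0 \<Longrightarrow>
      norm (grad (Gamma_kernel s) x - (- (1 * (2 * pi * kappa (CARD('n) + 2) (2 * ?\<alpha> + 2)) * norm x powr (2 * ?\<alpha> - real CARD('n))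
         + (- 1) * (2 * pi * kappa (CARD('n) + 2) (2 * ?\<beta> + 2)) * norm x powr (2 * ?\<beta> - real CARD('n)))) *\<^sub>R x) \<le> C' * norm x powr (2 * ?\<gamma> + 1 - real CARD('n))"
      using grad_Gamma_kernel_expansion[OF s n C lt(4-6)] by metis
    have k: "2 * pi * kappa (CARD('n) + 2) (2 * s) = (real CARD('n) - 2 * s) * kappa CARD('n) (2 * s)"
      "2 * pi * kappa (CARD('n) + 2) (4 * s - 2) = (real CARD('n) - (4 * s - 2)) * kappa CARD('n) (4 * s - 2)"
    proof -
      have "real CARD('n) \<ge> 2" using n by simp
      then have c: "real CARD('n) - 2 * s > - 2" "real CARD('n) \<noteq> 2 * s" "real CARD('n) - (4 * s - 2) > - 2" "real CARD('n) \<noteq> 4 * s - 2"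
        using s by linarith+
      show "2 * pi * kappa (CARD('n) + 2) (2 * s) = (real CARD('n) - 2 * s) * kappa CARD('n) (2 * s)"
        by (rule kappa_add_2[OF c(1,2)])
      show "2 * pi * kappa (CARD('n) + 2) (4 * s - 2) = (real CARD('n) - (4 * s - 2)) * kappa CARD('n) (4 * s - 2)"
        by (rule kappa_add_2[OF c(3,4)])
    qed
    show ?thesis
    proof (rule smallo_at_infinity_powr)
      fix x :: "real^'n" assume x: "x \<noteq> 0"
      have p: "1 / norm x powr (real CARD('n) + 2 - 2 * s) = norm x powr (2 * ?\<alpha> - real CARD('n))"
        "1 / norm x powr (real CARD('n) + 4 - 4 * s) = norm x powr (2 * ?\<beta> - real CARD('n))"
        unfolding powr_minus_divide[symmetric] by (simp_all add: algebra_simps)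
      have "(- (((real CARD('n) - 2 * s) * kappa CARD('n) (2 * s) * norm x powr (2 * ?\<alpha> - real CARD('n))) *\<^sub>R x)
             + ((real CARD('n) + 2 - 4 * s) * kappa CARD('n) (4 * s - 2) * norm x powr (2 * ?\<beta> - real CARD('n))) *\<^sub>R x)
         = (- (1 * ((real CARD('n) - 2 * s) * kappa CARD('n) (2 * s)) * norm x powr (2 * ?\<alpha> - real CARD('n))
             + (- 1) * ((real CARD('n) - (4 * s - 2)) * kappa CARD('n) (4 * s - 2)) * norm x powr (2 * ?\<beta> - real CARD('n)))) *\<^sub>R x"
        by (simp only: scaleR_minus_left[symmetric] scaleR_add_left[symmetric]) (simp add: algebra_simps)
      then show "\<bar>norm (grad (Gamma_kernel s) x
                    - (- (((real CARD('n) - 2 * s) * kappa CARD('n) (2 * s)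
                           * (1 / norm x powr (real CARD('n) + 2 - 2 * s))) *\<^sub>R x)
                       + ((real CARD('n) + 2 - 4 * s) * kappa CARD('n) (4 * s - 2)
                           * (1 / norm x powr (real CARD('n) + 4 - 4 * s))) *\<^sub>R x))\<bar> \<le> C' * norm x powr (2 * ?\<gamma> + 1 - real CARD('n))"
        using C'[OF x] unfolding ex k p by (simp only: abs_norm_cancel)
    qed (use s in simp)
  qed
qed

end

lemma half_unit: "0 < (1 / 2 :: real)" "(1 / 2 :: real) < 1"
  by simp_all

lemma mittag_leffler_half_small_expansion:
  obtains C where "\<forall>\<tau>>0. \<bar>mittag_leffler (1 - 1 / 2) \<tau> - (1 * \<tau> powr 0 / Gamma (1 + 0) + (- 1) * \<tau> powr (1 / 2) / Gamma (1 + 1 / 2))\<bar> \<le> C * \<tau> powr 1"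
proof -
  obtain C where "\<And>\<tau>. \<tau> > 0 \<Longrightarrow> \<bar>mittag_leffler (1 / 2) \<tau> - (1 - \<tau> powr (1 / 2) / Gamma (3 / 2))\<bar> \<le> C * \<tau>"
    using mittag_leffler_half_small by metis
  then show ?thesis by (intro that[of C]) simp
qed

lemma grad_Gamma_kernel_half_at_0:
  assumes n: "CARD('n::finite) = 3"
  shows "(\<lambda>x::real^'n. norm (grad (Gamma_kernel (1 / 2)) x - (- ((1 / (4 * pi * norm x ^ 3)) *\<^sub>R x)
                    + (1 / (2 * pi ^ 2) * (1 / norm x ^ 2)) *\<^sub>R x)))
          \<in> O[at 0](\<lambda>_. 1)"
proof -
  obtain C where C: "\<forall>\<tau>>0. \<bar>mittag_leffler (1 - 1 / 2) \<tau> - (1 * \<tau> powr 0 / Gamma (1 + 0) + (- 1) * \<tau> powr (1 / 2) / Gamma (1 + 1 / 2))\<bar> \<le> C * \<tau> powr 1"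
    by (rule mittag_leffler_half_small_expansion)
  have lt: "0 < real CARD('n) / 2" "1 / 2 < real CARD('n) / 2" "1 < real CARD('n) / 2" and n2: "CARD('n) \<ge> 2" using n by auto
  obtain C' where C': "\<And>x::real^'n. x \<noteq> 0 \<Longrightarrow>
    norm (grad (Gamma_kernel (1 / 2)) x - (- (1 * (2 * pi * kappa (CARD('n) + 2) (2 * 0 + 2)) * norm x powr (2 * 0 - real CARD('n))
       + (- 1) * (2 * pi * kappa (CARD('n) + 2) (2 * (1 / 2) + 2)) * norm x powr (2 * (1 / 2) - real CARD('n)))) *\<^sub>R x) \<le> C' * norm x powr (2 * 1 + 1 - real CARD('n))"
    using grad_Gamma_kernel_expansion[OF half_unit n2 C lt] by metis
  have k2: "2 * pi * kappa 5 2 = 1 / (4 * pi)" using kappa_add_2_two[of 3] by (simp add: sphere_area_3)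
  show ?thesis
  proof (rule bigo_at_0_one)
    fix x :: "real^'n" assume x: "x \<noteq> 0"
    have e1: "CARD('n) + 2 = 5" "2 * (1 / 2) + 2 = (3::real)" "2 * 0 + 2 = (2::real)" "2 * 0 - real CARD('n) = - 3" "2 * (1 / 2) - real CARD('n) = - 2" "2 * 1 + 1 - real CARD('n) = 0"
      using n by simp_all
    have p: "norm x powr - 3 = 1 / norm x ^ 3" "norm x powr - 2 = 1 / norm x ^ 2" using x by (simp_all add: powr_minus_divide powr_numeral)
    have "(- ((1 / (4 * pi * norm x ^ 3)) *\<^sub>R x) + (1 / (2 * pi ^ 2) * (1 / norm x ^ 2)) *\<^sub>R x)
      = (- (1 * (1 / (4 * pi)) * (1 / norm x ^ 3) + (- 1) * (1 / (2 * pi ^ 2)) * (1 / norm x ^ 2))) *\<^sub>R x"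
      by (simp only: scaleR_minus_left[symmetric] scaleR_add_left[symmetric]) simp
    then show "\<bar>norm (grad (Gamma_kernel (1 / 2)) x - (- ((1 / (4 * pi * norm x ^ 3)) *\<^sub>R x) + (1 / (2 * pi ^ 2) * (1 / norm x ^ 2)) *\<^sub>R x))\<bar>
      \<le> 0 + C' * norm x powr 0"
      using C'[OF x] unfolding e1 k2 kappa_5_3 p by (simp only: abs_norm_cancel add_0)
  qed simp
qed

text \<open>For \<open>s = 1 / 2\<close> in dimension \<open>3\<close> the second term of the derivative is a multiple of \<open>1 / \<rho>\<close>, whose
  primitive is the logarithm.\<close>

lemma Gamma_kernel_half_at_0:
  assumes n: "CARD('n::finite) = 3"
  shows "(\<lambda>x::real^'n. Gamma_kernel (1 / 2) x - (1 / (4 * pi * norm x) - 1 / (2 * pi ^ 2) * ln (1 / norm x)))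
          \<in> O[at 0](\<lambda>_. 1)"
proof -
  obtain C where C: "\<forall>\<tau>>0. \<bar>mittag_leffler (1 - 1 / 2) \<tau> - (1 * \<tau> powr 0 / Gamma (1 + 0) + (- 1) * \<tau> powr (1 / 2) / Gamma (1 + 1 / 2))\<bar> \<le> C * \<tau> powr 1"
    by (rule mittag_leffler_half_small_expansion)
  have lt: "0 < real 5 / 2 - 1" "1 / 2 < real 5 / 2 - 1" "1 < real 5 / 2 - 1" by simp_all
  obtain C' where C': "\<And>\<rho>. \<rho> > 0 \<Longrightarrow> \<bar>heat (real 5) (mittag_leffler (1 - 1 / 2)) \<rho> - (1 * kappa 5 (2 * 0 + 2) * \<rho> powr (0 + 1 - real 5 / 2)
      + (- 1) * kappa 5 (2 * (1 / 2) + 2) * \<rho> powr (1 / 2 + 1 - real 5 / 2))\<bar> \<le> C' * \<rho> powr (1 + 1 - real 5 / 2)"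
    using heat_expansion[OF mittag_leffler_measurable C[rule_format] lt] by blast
  define M where "M = (\<lambda>\<rho>. kappa 5 2 * \<rho> powr (- 3 / 2) - kappa 5 3 * \<rho> powr (- 1))"
  let ?P = "\<lambda>\<rho>. 1 / (4 * pi) * \<rho> powr (- 1 / 2) + 1 / (4 * pi ^ 2) * ln \<rho>"
  have k2: "pi * kappa 5 2 = 1 / (8 * pi)" using kappa_add_2_two[of 3] by (simp add: sphere_area_3 field_simps)
  have k3: "pi * kappa 5 3 = 1 / (4 * pi ^ 2)" using kappa_5_3 by (simp add: field_simps)
  have "\<exists>L. \<forall>\<rho>>0. \<bar>heat 3 (mittag_leffler (1 - 1 / 2)) \<rho> - (?P \<rho> + L)\<bar> \<le> pi * C' / (1 / 2) * \<rho> powr (1 / 2)"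
  proof (rule heat_primitive[OF half_unit])
    show "\<bar>heat (3 + 2) (mittag_leffler (1 - 1 / 2)) \<rho> - M \<rho>\<bar> \<le> C' * \<rho> powr (1 / 2 - 1)" if "\<rho> > 0" for \<rho>
      using C'[OF that] by (simp add: M_def)
    show "(?P has_real_derivative - pi * M \<rho>) (at \<rho>)" if r: "\<rho> > 0" for \<rho>
    proof -
      have "(?P has_real_derivative 1 / (4 * pi) * ((- 1 / 2) * \<rho> powr (- 1 / 2 - 1)) + 1 / (4 * pi ^ 2) * (1 / \<rho>)) (at \<rho>)"
        by (intro DERIV_add DERIV_cmult has_real_derivative_powr r DERIV_ln_divide)
      moreover have "1 / (4 * pi) * ((- 1 / 2) * \<rho> powr (- 1 / 2 - 1)) + 1 / (4 * pi ^ 2) * (1 / \<rho>) = - pi * M \<rho>"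
      proof -
        have "- pi * M \<rho> = - (pi * kappa 5 2) * \<rho> powr (- 3 / 2) + (pi * kappa 5 3) * \<rho> powr (- 1)"
          by (simp add: M_def algebra_simps)
        moreover have "\<rho> powr (- 1) = 1 / \<rho>" using r by (simp add: powr_minus_divide)
        moreover have "- 1 / 2 - 1 = (- 3 / 2 :: real)" by simp
        ultimately show ?thesis unfolding k2 k3 by simp
      qed
      ultimately show ?thesis by (simp only:)
    qed
  qed simp_all
  then obtain L where L: "\<And>\<rho>. \<rho> > 0 \<Longrightarrow> \<bar>heat 3 (mittag_leffler (1 - 1 / 2)) \<rho> - (?P \<rho> + L)\<bar> \<le> pi * C' / (1 / 2) * \<rho> powr (1 / 2)" by blast
  show ?thesis
  proof (rule bigo_at_0_one[where p = 1 and B = "\<bar>L\<bar>" and C = "pi * C' / (1 / 2)"])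
    fix x :: "real^'n" assume x: "x \<noteq> 0"
    then have "(norm x)^2 > 0" by simp
    note b = L[OF this, unfolded norm_square_powr[OF x]]
    have "2 * (- 1 / 2) = (- 1 :: real)" "2 * (1 / 2) = (1 :: real)" by simp_all
    moreover have "1 / (4 * pi) * norm x powr - 1 = 1 / (4 * pi * norm x)" using x by (simp add: powr_minus_divide)
    moreover have "1 / (4 * pi ^ 2) * ln ((norm x)^2) = - (1 / (2 * pi ^ 2) * ln (1 / norm x))"
      using x by (simp add: ln_realpow ln_div)
    moreover have "Gamma_kernel (1 / 2) x = heat 3 (mittag_leffler (1 - 1 / 2)) ((norm x)^2)" by (simp add: Gamma_kernel_def n)
    ultimately have "\<bar>Gamma_kernel (1 / 2) x - (1 / (4 * pi * norm x) + - (1 / (2 * pi ^ 2) * ln (1 / norm x)) + L)\<bar> \<le> pi * C' / (1 / 2) * norm x powr 1"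
      using b by (simp only:)
    then show "\<bar>Gamma_kernel (1 / 2) x - (1 / (4 * pi * norm x) - 1 / (2 * pi ^ 2) * ln (1 / norm x))\<bar> \<le> \<bar>L\<bar> + pi * C' / (1 / 2) * norm x powr 1"
      by linarith
  qed simp
qed

lemma Gamma_kernel_half_at_infinity:
  assumes n: "CARD('n::finite) \<ge> 2"
  shows "(\<lambda>x::real^'n. Gamma_kernel (1 / 2) x - (kappa CARD('n) 1 * norm x powr (1 - real CARD('n))
                    + kappa CARD('n) (- 1) * norm x powr (- real CARD('n) - 1)))
          \<in> o[at_infinity](\<lambda>x. norm x powr (- real CARD('n) - 1))" (is ?V)
    and "(\<lambda>x::real^'n. norm (grad (Gamma_kernel (1 / 2)) x
                    - (- (((real CARD('n) - 1) * kappa CARD('n) 1 * (1 / norm x ^ (CARD('n) + 1))) *\<^sub>R x)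
                       - ((real CARD('n) + 1) * kappa CARD('n) (- 1) * (1 / norm x ^ (CARD('n) + 3))) *\<^sub>R x)))
          \<in> o[at_infinity](\<lambda>x. norm x powr (- real CARD('n) - 2))" (is ?G)
proof -
  obtain C where "\<And>\<tau>. \<tau> > 0 \<Longrightarrow>
    \<bar>mittag_leffler (1 / 2) \<tau> - (\<tau> powr (- 1 / 2) / Gamma (1 / 2) + \<tau> powr (- 3 / 2) / Gamma (- 1 / 2))\<bar> \<le> C * \<tau> powr (- 5 / 2)"
    using mittag_leffler_half_large by metis
  then have C: "\<forall>\<tau>>0. \<bar>mittag_leffler (1 - 1 / 2) \<tau> - (1 * \<tau> powr (- 1 / 2) / Gamma (1 + - 1 / 2) + 1 * \<tau> powr (- 3 / 2) / Gamma (1 + - 3 / 2))\<bar> \<le> C * \<tau> powr (- 5 / 2)"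
    by simp
  have N: "real CARD('n) \<ge> 2" using n by simp
  have lt: "- 1 / 2 < real CARD('n) / 2 - 1" "- 3 / 2 < real CARD('n) / 2 - 1" "- 5 / 2 < real CARD('n) / 2 - 1"
    "- 1 / 2 < real CARD('n) / 2" "- 3 / 2 < real CARD('n) / 2" "- 5 / 2 < real CARD('n) / 2" using N by linarith+
  have ex: "2 * (- 1 / 2) + 2 = (1::real)" "2 * (- 3 / 2) + 2 = (- 1::real)" by simp_all
  show ?V
  proof -
    obtain C' where C': "\<And>x::real^'n. x \<noteq> 0 \<Longrightarrow>
      \<bar>Gamma_kernel (1 / 2) x - (1 * kappa CARD('n) (2 * (- 1 / 2) + 2) * norm x powr (2 * (- 1 / 2) + 2 - real CARD('n))
         + 1 * kappa CARD('n) (2 * (- 3 / 2) + 2) * norm x powr (2 * (- 3 / 2) + 2 - real CARD('n)))\<bar> \<le> C' * norm x powr (2 * (- 5 / 2) + 2 - real CARD('n))"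
      using Gamma_kernel_expansion[OF half_unit C lt(1-3)] by metis
    show ?thesis
    proof (rule smallo_at_infinity_powr)
      fix x :: "real^'n" assume x: "x \<noteq> 0"
      have q: "- 1 - real CARD('n) = - real CARD('n) - 1" by simp
      show "\<bar>Gamma_kernel (1 / 2) x - (kappa CARD('n) 1 * norm x powr (1 - real CARD('n))
                    + kappa CARD('n) (- 1) * norm x powr (- real CARD('n) - 1))\<bar> \<le> C' * norm x powr (2 * (- 5 / 2) + 2 - real CARD('n))"
        using C'[OF x] unfolding ex q mult_1 .
    qed simp
  qed
  show ?G
  proof -
    obtain C' where C': "\<And>x::real^'n. x \<noteq> 0 \<Longrightarrow>
      norm (grad (Gamma_kernel (1 / 2)) x - (- (1 * (2 * pi * kappa (CARD('n) + 2) (2 * (- 1 / 2) + 2)) * norm x powr (2 * (- 1 / 2) - real CARD('n))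
         + 1 * (2 * pi * kappa (CARD('n) + 2) (2 * (- 3 / 2) + 2)) * norm x powr (2 * (- 3 / 2) - real CARD('n)))) *\<^sub>R x) \<le> C' * norm x powr (2 * (- 5 / 2) + 1 - real CARD('n))"
      using grad_Gamma_kernel_expansion[OF half_unit n C lt(4-6)] by metis
    have c: "real CARD('n) - 1 > - 2" "real CARD('n) \<noteq> 1" "real CARD('n) - - 1 > - 2" "real CARD('n) \<noteq> - 1"
      using N by linarith+
    have k: "2 * pi * kappa (CARD('n) + 2) 1 = (real CARD('n) - 1) * kappa CARD('n) 1"
      by (rule kappa_add_2[OF c(1,2)])
    have k': "2 * pi * kappa (CARD('n) + 2) (- 1) = (real CARD('n) - - 1) * kappa CARD('n) (- 1)"
      by (rule kappa_add_2[OF c(3,4)])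
    show ?thesis
    proof (rule smallo_at_infinity_powr)
      fix x :: "real^'n" assume x: "x \<noteq> 0"
      then have np: "norm x > 0" by simp
      have p: "1 / norm x ^ (CARD('n) + 1) = norm x powr (2 * (- 1 / 2) - real CARD('n))"
      proof -
        have "2 * (- 1 / 2) - real CARD('n) = - real (CARD('n) + 1)" by simp
        then show ?thesis by (simp only: powr_minus_divide powr_realpow[OF np])
      qed
      have p': "1 / norm x ^ (CARD('n) + 3) = norm x powr (2 * (- 3 / 2) - real CARD('n))"
      proof -
        have "2 * (- 3 / 2) - real CARD('n) = - real (CARD('n) + 3)" by simp
        then show ?thesis by (simp only: powr_minus_divide powr_realpow[OF np])
      qed
      have "(- (((real CARD('n) - 1) * kappa CARD('n) 1 * norm x powr (2 * (- 1 / 2) - real CARD('n))) *\<^sub>R x)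
             - ((real CARD('n) + 1) * kappa CARD('n) (- 1) * norm x powr (2 * (- 3 / 2) - real CARD('n))) *\<^sub>R x)
         = (- (1 * ((real CARD('n) - 1) * kappa CARD('n) 1) * norm x powr (2 * (- 1 / 2) - real CARD('n))
             + 1 * ((real CARD('n) - - 1) * kappa CARD('n) (- 1)) * norm x powr (2 * (- 3 / 2) - real CARD('n)))) *\<^sub>R x"
        by (simp only: scaleR_minus_left[symmetric] scaleR_diff_left[symmetric]) (simp add: algebra_simps)
      then show "\<bar>norm (grad (Gamma_kernel (1 / 2)) x
                    - (- (((real CARD('n) - 1) * kappa CARD('n) 1 * (1 / norm x ^ (CARD('n) + 1))) *\<^sub>R x)
                       - ((real CARD('n) + 1) * kappa CARD('n) (- 1) * (1 / norm x ^ (CARD('n) + 3))) *\<^sub>R x))\<bar> \<le> C' * norm x powr (2 * (- 5 / 2) + 1 - real CARD('n))"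
        using C'[OF x] unfolding ex k k' p p' by (simp only: abs_norm_cancel)
    qed simp
  qed
qed

lemma Gamma_kernel_continuous:
  assumes s: "0 < s" "s < 1" and n: "CARD('n::finite) \<ge> 2"
  shows "continuous_on (- {0}) (Gamma_kernel s :: real^'n \<Rightarrow> real)"
proof -
  have sm: "smooth_on (- {0}) (Gamma_kernel s :: real^'n \<Rightarrow> real)" by (rule Gamma_kernel_smooth[OF assms])
  have "iter_partial [] (Gamma_kernel s :: real^'n \<Rightarrow> real) differentiable (at x)" if "x \<in> - {0}" for x
    using sm that unfolding smooth_on_def by blast
  then show ?thesis
    by (intro continuous_at_imp_continuous_on ballI differentiable_imp_continuous_within) simp
qed

theorem theorem1p1:
  fixes n :: nat and s :: real
  assumes n_def: "n = CARD('n::finite)" and n2: "n \<ge> 2" and s: "0 < s" "s < 1"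
  shows "tempered (Gamma_distr s :: 'n distr) \<and>
    Ls s (Gamma_distr s :: 'n distr) delta0 \<and>
    (\<exists>G :: real^'n \<Rightarrow> real.
      smooth_on (- {0}) G \<and>
      (\<forall>x y. x \<noteq> 0 \<and> y \<noteq> 0 \<and> norm x = norm y \<longrightarrow> G x = G y) \<and>
      represented_on (- {0}) (Gamma_distr s) (\<lambda>x. complex_of_real (G x)) \<and>

      (n \<ge> 3 \<and> 4 - 2 * s < real n \<longrightarrow>
        (\<lambda>x. G x - (norm x powr (2 - real n) / ((real n - 2) * sphere_area n)
                    - kappa n (4 - 2 * s) * norm x powr (4 - 2 * s - real n)))
          \<in> o[at 0](\<lambda>x. norm x powr (4 - 2 * s - real n)) \<and>
        (\<lambda>x. norm (grad G x - (- ((1 / (sphere_area n * norm x ^ n)) *\<^sub>R x)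
                    - ((4 - 2 * s - real n) * kappa n (4 - 2 * s)
                        * norm x powr (2 - 2 * s - real n)) *\<^sub>R x)))
          \<in> o[at 0](\<lambda>x. norm x powr (3 - 2 * s - real n))) \<and>

      (n = 3 \<and> s = 1 / 2 \<longrightarrow>
        (\<lambda>x. G x - (1 / (4 * pi * norm x) - 1 / (2 * pi ^ 2) * ln (1 / norm x)))
          \<in> O[at 0](\<lambda>_. 1) \<and>
        (\<lambda>x. norm (grad G x - (- ((1 / (4 * pi * norm x ^ 3)) *\<^sub>R x)
                    + (1 / (2 * pi ^ 2) * (1 / norm x ^ 2)) *\<^sub>R x)))
          \<in> O[at 0](\<lambda>_. 1)) \<and>

      (n = 3 \<and> s < 1 / 2 \<longrightarrow>
        (\<exists>C :: real.
          (\<lambda>x. G x - (1 / (4 * pi * norm x) + C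
                      - kappa 3 (4 - 2 * s) * norm x powr (1 - 2 * s)))
            \<in> o[at 0](\<lambda>x. norm x powr (1 - 2 * s))) \<and>
        (\<lambda>x. norm (grad G x - (- ((1 / (4 * pi * norm x ^ 3)) *\<^sub>R x)
                    - ((1 - 2 * s) * kappa 3 (4 - 2 * s)
                        * norm x powr (- 1 - 2 * s)) *\<^sub>R x)))
          \<in> o[at 0](\<lambda>x. norm x powr (- 2 * s))) \<and>

      (n = 2 \<longrightarrow>
        (\<exists>C :: real.
          (\<lambda>x. G x - (1 / (2 * pi) * ln (1 / norm x) + C
                      - kappa 2 (4 - 2 * s) * norm x powr (2 - 2 * s)))
            \<in> o[at 0](\<lambda>x. norm x powr (2 - 2 * s))) \<and>
        (\<lambda>x. norm (grad G x - (- ((1 / (2 * pi * norm x ^ 2)) *\<^sub>R x)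
                    - ((2 - 2 * s) * kappa 2 (4 - 2 * s)
                        * norm x powr (- 2 * s)) *\<^sub>R x)))
          \<in> o[at 0](\<lambda>x. norm x powr (1 - 2 * s))) \<and>

      (s \<noteq> 1 / 2 \<longrightarrow>
        (\<lambda>x. G x - (kappa n (2 * s) * norm x powr (2 * s - real n)
                    - kappa n (4 * s - 2) * norm x powr (4 * s - 2 - real n)))
          \<in> o[at_infinity](\<lambda>x. norm x powr (4 * s - 2 - real n)) \<and>
        (\<lambda>x. norm (grad G x
                    - (- (((real n - 2 * s) * kappa n (2 * s)
                           * (1 / norm x powr (real n + 2 - 2 * s))) *\<^sub>R x)
                       + ((real n + 2 - 4 * s) * kappa n (4 * s - 2)
                           * (1 / norm x powr (real n + 4 - 4 * s))) *\<^sub>R x)))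
          \<in> o[at_infinity](\<lambda>x. norm x powr (4 * s - 3 - real n))) \<and>

      (s = 1 / 2 \<longrightarrow>
        (\<lambda>x. G x - (kappa n 1 * norm x powr (1 - real n)
                    + kappa n (- 1) * norm x powr (- real n - 1)))
          \<in> o[at_infinity](\<lambda>x. norm x powr (- real n - 1)) \<and>
        (\<lambda>x. norm (grad G x
                    - (- (((real n - 1) * kappa n 1 * (1 / norm x ^ (n + 1))) *\<^sub>R x)
                       - ((real n + 1) * kappa n (- 1) * (1 / norm x ^ (n + 3))) *\<^sub>R x)))
          \<in> o[at_infinity](\<lambda>x. norm x powr (- real n - 2))))"
proof (intro conjI exI[of _ "Gamma_kernel s :: real^'n \<Rightarrow> real"] impI, unfold n_def, goal_cases)
  have N: "CARD('n) \<ge> 2" using n_def n2 by simp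
  {
    case 1
    show ?case by (rule Gamma_distr_tempered[OF s N])
  next
    case 2
    show ?case by (rule Gamma_distr_fundamental[OF s N])
  next
    case 3
    show ?case by (rule Gamma_kernel_smooth[OF s N])
  next
    case 4
    show ?case by (simp add: Gamma_kernel_def)
  next
    case 5
    show ?case by (rule Gamma_kernel_represents[OF s N Gamma_kernel_continuous[OF s N]])
  next
    case 6
    then show ?case by (intro Gamma_kernel_at_0[OF s]) auto
  next
    case 7
    then show ?case by (intro grad_Gamma_kernel_at_0[OF s N]) auto
  next
    case 8
    then have c: "CARD('n) = 3" and h: "s = 1 / 2" by auto
    show ?case unfolding h by (rule Gamma_kernel_half_at_0[OF c])
  next
    case 9
    then have c: "CARD('n) = 3" and h: "s = 1 / 2" by auto
    show ?case unfolding h by (rule grad_Gamma_kernel_half_at_0[OF c])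
  next
    case 10
    then show ?case by (intro Gamma_kernel_at_0_dim_3[OF s]) auto
  next
    case 11
    then have c: "CARD('n) = 3" "real CARD('n) \<noteq> 4 - 2 * s" by auto
    have e: "4 - 2 * s - real 3 = 1 - 2 * s" "2 - 2 * s - real 3 = - 1 - 2 * s" "3 - 2 * s - real 3 = - 2 * s" by simp_all
    show ?case using grad_Gamma_kernel_at_0[OF s N c(2)] unfolding c(1) e sphere_area_3 .
  next
    case 12
    then show ?case by (intro Gamma_kernel_at_0_dim_2[OF s])
  next
    case 13
    then have c: "CARD('n) = 2" "real CARD('n) \<noteq> 4 - 2 * s" using s by auto
    have e: "4 - 2 * s - real 2 = 2 - 2 * s" "2 - 2 * s - real 2 = - 2 * s" "3 - 2 * s - real 2 = 1 - 2 * s" by simp_all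
    show ?case using grad_Gamma_kernel_at_0[OF s N c(2)] unfolding c(1) e sphere_area_2 .
  next
    case 14
    show ?case by (rule Gamma_kernel_at_infinity(1)[OF s N])
  next
    case 15
    show ?case by (rule Gamma_kernel_at_infinity(2)[OF s N])
  next
    case 16
    show ?case unfolding \<open>s = 1 / 2\<close> by (rule Gamma_kernel_half_at_infinity(1)[OF N])
  next
    case 17
    show ?case unfolding \<open>s = 1 / 2\<close> by (rule Gamma_kernel_half_at_infinity(2)[OF N])
  }
qed

end
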